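(* The classical complex Grothendieck constant satisfies \[ K_G^{\mathbb C}>1.35584631827168 . \]
   Context: The classical complex Grothendieck constant $K_G^{\mathbb C}$ is the least number $K$ such that \[ \Bigl|\sum_{i=1}^m\sum_{j=1}^n a_{ij}\langle x_i,y_j\rangle\Bigr| \le K\max_{|\varepsilon_i|=|\delta_j|=1} \Bigl|\sum_{i=1}^m\sum_{j=1}^n a_{ij}\varepsilon_i\overline{\delta_j}\Bigr| \] for all positive integers $m,n,d$, every complex matrix $A=(a_{ij})\in\mathbb C^{m\times n}$, and all unit vectors $x_i,y_j\in\mathbb C^d$; the maximum is over complex scalars $\varepsilon_1,\dots,\varepsilon_m,\delta_1,\dots,\delta_n$ of modulus one. Complex inner products are linear in the first variable. The decimal denotes the corresponding exact rational number. *)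

theory Defs
  imports Complex_Main "Jordan_Normal_Form.Matrix" "Jordan_Normal_Form.Conjugate"
begin

definition unit_vecs :: "nat \<Rightarrow> complex vec set" where
  "unit_vecs d = {v \<in> carrier_vec d. v \<bullet>c v = 1}"

text \<open>The set below is the continuous image of a nonempty compact torus, so its supremum is attained:
  \<^term>\<open>Sup\<close> is the maximum. Only the values of \<open>\<epsilon>\<close> and \<open>\<delta>\<close> at indices of \<open>A\<close> matter.\<close>

definition unimodular_max :: "complex mat \<Rightarrow> real" where
  "unimodular_max A =
     Sup {cmod (\<Sum>i<dim_row A. \<Sum>j<dim_col A. A $$ (i, j) * \<epsilon> i * cnj (\<delta> j)) | \<epsilon> \<delta>.
       (\<forall>i<dim_row A. cmod (\<epsilon> i) = 1) \<and> (\<forall>j<dim_col A. cmod (\<delta> j) = 1)}"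

text \<open>The product \<open>v \<bullet>c w\<close> conjugates \<open>w\<close>, so it is linear in the first variable.\<close>

definition complex_grothendieck_bound :: "real \<Rightarrow> bool" where
  "complex_grothendieck_bound K \<longleftrightarrow>
     (\<forall>m n d. 0 < m \<longrightarrow> 0 < n \<longrightarrow> 0 < d \<longrightarrow>
       (\<forall>A \<in> carrier_mat m n. \<forall>x y.
         (\<forall>i<m. x i \<in> unit_vecs d) \<longrightarrow> (\<forall>j<n. y j \<in> unit_vecs d) \<longrightarrow>
         cmod (\<Sum>i<m. \<Sum>j<n. A $$ (i, j) * (x i \<bullet>c y j)) \<le> K * unimodular_max A))"

text \<open>\<^const>\<open>Least\<close> is specified only if a least bound exists, so using this constant requires
  Grothendieck's inequality (some real bound exists) and closedness of the set of bounds.\<close>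

definition complex_grothendieck_constant :: real where
  "complex_grothendieck_constant = (LEAST K. complex_grothendieck_bound K)"

end

(*
  On complex Gaussian space C^n let T = P_1 - d P_3 with d = 58/100, where P_1 projects onto the
  holomorphic linear functions and P_3 onto the cubic chaos of bidegree (2, 1). Discretizing
  (f, g) |-> <T f, g> gives matrices. On the vector function x |-> x / |x|, whose coordinates are
  almost linear in high dimension, the form tends to 1. On scalar unimodular f and g it is at
  most 0.7375, so in the limit the constant is at least 1 / 0.7375 > 1.3559; n = 10^6 suffices.

  For the scalar bound write p = (f + g) / 2 and q = (f - g) / 2, so that
  <T f, g> = |P_1 p|^2 - |P_1 q|^2 - d |P_3 p|^2 + d |P_3 q|^2. A rotation makes P_1 p equal to
  a z_1 with a >= 0. The dangerous term d |P_3 q|^2 is bounded by a weighted L^2 norm of q whose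
  weights depend on |z_1| and distinguish the components of q along and across the phase of
  z_1; since |f| = |g| = 1 constrains p and q pointwise, this norm plus a linear functional
  of p is bounded pointwise. Step function weights found numerically then certify the bound
  in three ranges of a.

  Since the constant is defined by LEAST, Grothendieck's inequality is also needed with some
  constant; 128 results from Rademacher sums truncated at height 8.
*)
theory Submission
  imports Defs "HOL-Probability.Probability"
begin

\<comment> \<open>Jordan_Normal_Form uses the dollar sign for its own vectors.\<close>
notation vec_nth (infixl "$h" 90)

section \<open>Gaussian measure on complex space\<close>

text \<open>With P_1 alone the scalar maximum is (E|z_1|)^2 = pi / 4, reached when both functions
  are the phase of z_1, so the ratio would be only 4 / pi < 1.274. That phase is not linear: its
  inner product with the cubic z_1 (|z_1|^2 - 2) is - sqrt(pi) / 4. Subtracting d P_3 therefore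
  lowers the value of the phase, whereas the direction x / |x| keeps its value up to O(1/n). The
  price is an indefinite operator. Cauchy-Schwarz no longer reduces the scalar problem to f = g, and
  f = - g turns the penalty into a gain of up to d. The estimate d |P_3 q|^2 <= d |q|^2 is
  affordable only while P_1 p is small. For larger a the pointwise constraints must enter: |p|^2 +
  |q|^2 = 1, and p and q are orthogonal as real vectors. Where p follows the phase of z_1, q is
  therefore small or points across that phase, and this is why the weights treat the two directions
  differently.\<close>

lemma uminus_image_eq_vimage: "uminus ` A = uminus -` A" for A :: "'a::group_add set"
proof (intro subset_antisym subsetI)
  fix x assume "x \<in> uminus -` A"
  then have "- (- x) \<in> uminus ` A" by (intro imageI) simp
  then show "x \<in> uminus ` A" by simp
qed auto

text \<open>Uniqueness of a translation invariant measure: integrate \<open>indicator A x * indicator B (x + y)\<close>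
  in both orders against the image measure and \<^const>\<open>lborel\<close>, with \<open>B\<close> the unit ball.\<close>

lemma emeasure_lborel_linear_isometry:
  fixes U :: "'a::euclidean_space \<Rightarrow> 'a"
  assumes lin: "linear U" and iso: "\<And>x. norm (U x) = norm x" and A: "A \<in> sets borel"
  shows "emeasure (distr lborel borel U) A = emeasure lborel (uminus ` A)"
proof -
  define N where "N = distr lborel borel U"
  have cont: "continuous_on UNIV U"
    by (rule linear_continuous_on) (use lin in \<open>simp add: linear_conv_bounded_linear\<close>)
  have meas[measurable]: "U \<in> borel_measurable borel"
    using cont by (rule borel_measurable_continuous_onI)
  have injU: "inj U"
    using lin iso by (metis linear_injective_0 norm_eq_zero)
  then have surjU: "surj U"
    using linear_inj_imp_surj[OF lin] by blast
  have setsN[measurable_cong]: "sets N = sets borel" by (simp add: N_def)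
  have spaceN: "space N = UNIV" by (simp add: N_def)
  have ballinv: "U -` ball 0 r = ball 0 r" for r
    using iso by (auto simp: ball_def dist_norm)
  have Nball: "emeasure N (ball 0 r) = emeasure lborel (ball 0 r :: 'a set)" for r
    unfolding N_def by (subst emeasure_distr) (auto simp: ballinv)
  have transl: "distr N borel ((+) c) = N" for c
  proof -
    obtain d where d: "c = U d" using surjU by (metis surjD)
    have "distr N borel ((+) c) = distr lborel borel (\<lambda>x. c + U x)"
      unfolding N_def by (subst distr_distr) (auto simp: comp_def)
    also have "(\<lambda>x. c + U x) = U \<circ> ((+) d)"
      by (auto simp: d linear_add[OF lin])
    also have "distr lborel borel (U \<circ> ((+) d)) = distr (distr lborel borel ((+) d)) borel U"
      by (subst distr_distr) auto
    also have "distr lborel borel ((+) d) = lborel" by (rule lborel_distr_plus)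
    finally show ?thesis by (simp add: N_def)
  qed
  interpret N: sigma_finite_measure N
  proof
    show "\<exists>A. countable A \<and> A \<subseteq> sets N \<and> \<Union> A = space N \<and> (\<forall>a\<in>A. emeasure N a \<noteq> \<infinity>)"
    proof (intro exI[of _ "range (\<lambda>n::nat. ball 0 (real n))"] conjI)
      show "\<Union> (range (\<lambda>n::nat. ball 0 (real n))) = space N"
        by (auto simp: spaceN reals_Archimedean2)
      show "\<forall>a\<in>range (\<lambda>n::nat. ball 0 (real n)). emeasure N a \<noteq> \<infinity>"
        using emeasure_lborel_ball_finite by (auto simp: Nball less_top)
    qed (auto simp: setsN)
  qed
  interpret P: pair_sigma_finite N lborel ..
  have *: "emeasure N A * emeasure lborel B = emeasure N B * emeasure lborel (uminus ` A)"
    if [measurable]: "A \<in> sets borel" "B \<in> sets borel" for A B :: "'a set"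
  proof -
    have tr: "(\<integral>\<^sup>+y. f y \<partial>lborel) = (\<integral>\<^sup>+y. f (c + y) \<partial>lborel)"
      if [measurable]: "f \<in> borel_measurable borel" for f and c :: 'a
      by (subst lborel_distr_plus[of c, symmetric], subst nn_integral_distr) auto
    have trN: "(\<integral>\<^sup>+y. f y \<partial>N) = (\<integral>\<^sup>+y. f (c + y) \<partial>N)"
      if [measurable]: "f \<in> borel_measurable borel" for f and c :: 'a
      by (subst transl[of c, symmetric], subst nn_integral_distr) (auto simp: measurable_cong_sets[OF setsN refl])
    have "emeasure N A * emeasure lborel B = (\<integral>\<^sup>+x. indicator A x * emeasure lborel B \<partial>N)"
      by (subst nn_integral_multc) (auto simp: setsN)
    also have "\<dots> = (\<integral>\<^sup>+x. (\<integral>\<^sup>+y. indicator A x * indicator B (x + y) \<partial>lborel) \<partial>N)"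
    proof (intro nn_integral_cong)
      fix x :: 'a
      have "(\<integral>\<^sup>+y. indicator A x * indicator B (x + y) \<partial>lborel) = indicator A x * (\<integral>\<^sup>+y. indicator B (x + y) \<partial>lborel)"
        by (rule nn_integral_cmult) simp
      also have "(\<integral>\<^sup>+y. indicator B (x + y) \<partial>lborel) = (\<integral>\<^sup>+y. indicator B y \<partial>lborel)"
        by (rule tr[of "indicator B" x, symmetric]) simp
      also have "\<dots> = emeasure lborel B" by simp
      finally show "indicator A x * emeasure lborel B = (\<integral>\<^sup>+y. indicator A x * indicator B (x + y) \<partial>lborel)"
        by simp
    qed
    also have "\<dots> = (\<integral>\<^sup>+y. (\<integral>\<^sup>+x. indicator A x * indicator B (x + y) \<partial>N) \<partial>lborel)"
      by (rule P.Fubini'[symmetric]) simp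
    also have "\<dots> = (\<integral>\<^sup>+y. (\<integral>\<^sup>+x. indicator A (-y + x) * indicator B x \<partial>N) \<partial>lborel)"
    proof (rule nn_integral_cong)
      fix y :: 'a
      show "(\<integral>\<^sup>+x. indicator A x * indicator B (x + y) \<partial>N) = (\<integral>\<^sup>+x. indicator A (-y + x) * indicator B x \<partial>N)"
        using trN[of "\<lambda>x. indicator A x * indicator B (x + y)" "-y"] by (simp add: algebra_simps)
    qed
    also have "\<dots> = (\<integral>\<^sup>+x. (\<integral>\<^sup>+y. indicator A (-y + x) * indicator B x \<partial>lborel) \<partial>N)"
      by (rule P.Fubini') simp
    also have "\<dots> = (\<integral>\<^sup>+x. indicator B x * emeasure lborel (uminus ` A) \<partial>N)"
    proof (intro nn_integral_cong)
      fix x :: 'a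
      have im: "uminus ` A = uminus -` A" by (rule uminus_image_eq_vimage)
      have [measurable]: "uminus ` A \<in> sets borel"
        unfolding im using measurable_sets_borel[of uminus borel A] by simp
      have "(\<integral>\<^sup>+y. indicator A (-y + x) * indicator B x \<partial>lborel) = (\<integral>\<^sup>+y. indicator A (-y + x) \<partial>lborel) * indicator B x"
        by (rule nn_integral_multc) simp
      also have "(\<integral>\<^sup>+y. indicator A (-y + x) \<partial>lborel) = (\<integral>\<^sup>+y. indicator A (-y) \<partial>(lborel :: 'a measure))"
        by (subst tr[of _ x]) auto
      also have "\<dots> = (\<integral>\<^sup>+y. indicator (uminus ` A) y \<partial>lborel)"
        by (intro nn_integral_cong) (auto simp: im split: split_indicator)
      also have "\<dots> = emeasure lborel (uminus ` A)" by simp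
      finally show "(\<integral>\<^sup>+y. indicator A (-y + x) * indicator B x \<partial>lborel) = indicator B x * emeasure lborel (uminus ` A)"
        by (simp add: mult.commute)
    qed
    also have "\<dots> = emeasure N B * emeasure lborel (uminus ` A)"
      by (subst nn_integral_multc) (auto simp: setsN)
    finally show ?thesis .
  qed
  have um: "uminus ` ball 0 1 = (ball 0 1 :: 'a set)"
    by (auto simp: uminus_image_eq_vimage)
  let ?v = "emeasure lborel (ball 0 1 :: 'a set)"
  have v: "?v \<noteq> 0" "?v \<noteq> \<infinity>"
    using emeasure_lborel_ball_finite[of "0::'a" 1] content_ball_pos[of 1 "0::'a"]
    by (auto simp: measure_def)
  have "?v * emeasure N A = ?v * emeasure lborel (uminus ` A)"
    using *[OF A, of "ball 0 1"] by (simp add: um Nball mult.commute)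
  then have "emeasure N A = emeasure lborel (uminus ` A)"
    using v by (simp add: ennreal_mult_cancel_left)
  then show ?thesis by (simp add: N_def)
qed

text \<open>The uniqueness argument leaves a reflected set on the right. It applies to the identity
  map as well, and comparing the two instances removes the reflection.\<close>

lemma lborel_distr_linear_isometry:
  fixes U :: "'a::euclidean_space \<Rightarrow> 'a"
  assumes "linear U" and "\<And>x. norm (U x) = norm x"
  shows "distr lborel borel U = lborel"
proof (rule measure_eqI)
  fix A assume "A \<in> sets (distr lborel borel U)"
  then have A: "A \<in> sets borel" by simp
  have "emeasure (distr lborel borel (\<lambda>x. x)) A = emeasure lborel (uminus ` A)"
    by (rule emeasure_lborel_linear_isometry) (use A in \<open>auto simp: linear_id[unfolded id_def]\<close>)
  moreover have "distr lborel borel (\<lambda>x. x :: 'a) = lborel"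
    by (simp add: distr_id2)
  ultimately show "emeasure (distr lborel borel U) A = emeasure lborel A"
    using emeasure_lborel_linear_isometry[OF assms A] by simp
qed simp

lemma distr_density_isometry:
  fixes U :: "'a::euclidean_space \<Rightarrow> 'a"
  assumes U: "linear U" "\<And>x. norm (U x) = norm x"
    and f[measurable]: "f \<in> borel_measurable borel" and inv: "\<And>x. f (U x) = f x"
  shows "distr (density lborel f) borel U = density lborel f"
proof -
  have [measurable]: "U \<in> borel_measurable borel"
    using linear_continuous_on[of U UNIV] U(1)
    by (intro borel_measurable_continuous_onI) (simp add: linear_conv_bounded_linear)
  have "distr (density lborel f) borel U = distr (density lborel (\<lambda>x. f (U x))) borel U"
    by (simp add: inv)
  also have "\<dots> = density (distr lborel borel U) f"
    by (rule density_distr[symmetric]) auto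
  finally show ?thesis by (simp add: lborel_distr_linear_isometry[OF U])
qed

text \<open>Normalized so that |z|^2 is exponential with parameter 1. In particular E|z|^2 = 1, and
  the coordinate functions on the product space are orthonormal.\<close>

definition cgauss :: "complex measure" where
  "cgauss = density lborel (\<lambda>z. ennreal (exp (- (cmod z)\<^sup>2) / pi))"

lemma sets_cgauss[simp, measurable_cong]: "sets cgauss = sets borel"
  and space_cgauss[simp]: "space cgauss = UNIV"
  by (simp_all add: cgauss_def)

lemma power2_less_iff_less_sqrt: "0 \<le> x \<Longrightarrow> x\<^sup>2 < b \<longleftrightarrow> x < sqrt b"
  and less_power2_iff_sqrt_less: "0 \<le> x \<Longrightarrow> b < x\<^sup>2 \<longleftrightarrow> sqrt b < x" for x b :: real
  using real_sqrt_less_iff[of "x\<^sup>2" b] real_sqrt_less_iff[of b "x\<^sup>2"] by simp_all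

text \<open>Polar coordinates in area form: the disc of squared radius b has area pi b. It is enough
  to compare the measures on open intervals, whose preimages are annuli, discs or empty.\<close>

lemma distr_lborel_cmod_sq:
  "distr lborel borel (\<lambda>z. (cmod z)\<^sup>2) = density lborel (\<lambda>t. ennreal (pi * indicator {0..} t))"
  (is "?M = ?N")
proof (rule measure_eqI_generator_eq)
  let ?E = "range (\<lambda>(a, b). box a b::real set)"
  have *: "emeasure ?M (box a b) = ennreal (pi * (max b 0 - max a 0))"
    and **: "emeasure ?N (box a b) = ennreal (pi * (max b 0 - max a 0))" if ab: "a \<le> b" for a b
  proof -
    let ?a = "max a 0" let ?b = "max b 0"
    have em: "emeasure ?M (box a b) = emeasure lborel ((\<lambda>z. (cmod z)\<^sup>2) -` box a b)"
      by (subst emeasure_distr) simp_all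
    show "emeasure ?M (box a b) = ennreal (pi * (?b - ?a))"
    proof (cases "0 < b")
      case False
      then have e: "(\<lambda>z. (cmod z)\<^sup>2) -` box a b = {}"
        by (auto simp: not_less) (meson less_le_trans not_less zero_le_power2 order_trans)
      show ?thesis unfolding em e using False ab by simp
    next
      case True
      show ?thesis
      proof (cases "0 \<le> a")
        case a: True
        have e: "(\<lambda>z. (cmod z)\<^sup>2) -` box a b = ball 0 (sqrt b) - cball 0 (sqrt a)"
          by (auto simp: power2_less_iff_less_sqrt less_power2_iff_sqrt_less)
        have "emeasure lborel (ball 0 (sqrt b) - cball 0 (sqrt a) :: complex set)
            = emeasure lborel (ball 0 (sqrt b) :: complex set) - emeasure lborel (cball 0 (sqrt a) :: complex set)"
        proof (cases "a = b")
          case True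
          have "ball 0 (sqrt b) - cball 0 (sqrt b) = ({} :: complex set)" by auto
          then have "emeasure lborel (ball 0 (sqrt b) - cball 0 (sqrt b) :: complex set) = 0"
            by (simp only: emeasure_empty)
          with True a show ?thesis by (simp add: emeasure_ball emeasure_cball)
        next
          case False
          with ab have "sqrt a < sqrt b" by simp
          then have "cball 0 (sqrt a) \<subseteq> (ball 0 (sqrt b) :: complex set)"
            by (auto intro: le_less_trans[OF _ real_sqrt_less_mono])
          then show ?thesis
            by (intro emeasure_Diff) (auto simp: emeasure_cball a)
        qed
        also have "\<dots> = ennreal (pi * (b - a))"
          using a True ab by (simp add: emeasure_ball emeasure_cball unit_ball_vol_2 ennreal_minus algebra_simps)
        finally show ?thesis unfolding em e using a True ab by simp
      next
        case a: False
        have e: "(\<lambda>z. (cmod z)\<^sup>2) -` box a b = ball 0 (sqrt b)"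
          using a True by (auto simp: power2_less_iff_less_sqrt) (smt (verit) zero_le_power2)
        show ?thesis unfolding em e using a True by (simp add: emeasure_ball unit_ball_vol_2)
      qed
    qed
    have "emeasure ?N (box a b) = (\<integral>\<^sup>+t. ennreal pi * indicator ({0..} \<inter> box a b) t \<partial>lborel)"
      by (subst emeasure_density) (auto intro!: nn_integral_cong split: split_indicator)
    also have "\<dots> = ennreal pi * emeasure lborel ({0..} \<inter> box a b)"
      by (rule nn_integral_cmult_indicator) auto
    also have "emeasure lborel ({0..} \<inter> box a b) = ennreal (?b - ?a)"
    proof (cases "0 \<le> a")
      case True
      then have "{0..} \<inter> box a b = {a<..<b}" by auto
      with True ab show ?thesis by simp
    next
      case False
      then have "{0..} \<inter> box a b = {0..<b}" by auto
      then show ?thesis using False by (cases "0 \<le> b") auto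
    qed
    also have "ennreal pi * ennreal (?b - ?a) = ennreal (pi * (?b - ?a))"
      using ab by (intro ennreal_mult[symmetric]) auto
    finally show "emeasure ?N (box a b) = ennreal (pi * (?b - ?a))" .
  qed
  show "Int_stable ?E"
    by (auto simp: Int_stable_def box_Int_box simp del: box_real)
  show "?E \<subseteq> Pow UNIV" "sets ?M = sigma_sets UNIV ?E" "sets ?N = sigma_sets UNIV ?E"
    by (simp_all add: borel_eq_box)
  let ?A = "\<lambda>n::nat. box (- real n) (real n) :: real set"
  show "range ?A \<subseteq> ?E" by (auto simp del: box_real)
  show "(\<Union>i. ?A i) = UNIV" using UN_box_eq_UNIV[where 'a=real] by (simp del: box_real)
  show "emeasure ?M (?A i) \<noteq> \<infinity>" for i using *[of "- real i" "real i"] by simp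
  show "emeasure ?M X = emeasure ?N X" if "X \<in> ?E" for X
  proof -
    from that obtain ab where X: "X = (case ab of (a, b) \<Rightarrow> box a b)" by (rule imageE)
    obtain a b where ab: "ab = (a, b)" by (cases ab)
    have X: "X = box a b" by (simp only: X ab prod.case)
    show ?thesis
    proof (cases "a \<le> b")
      case True
      show ?thesis by (simp only: X *[OF True] **[OF True])
    next
      case False
      then have "X = {}" by (simp add: X)
      then show ?thesis by (simp only: emeasure_empty)
    qed
  qed
qed

abbreviation exp1 :: "real measure" where
  "exp1 \<equiv> density lborel (exponential_density 1)"

text \<open>Turns every radial integral into an integral against the exponential distribution, whose
  moments and tails are explicit.\<close>

lemma distr_cgauss_cmod_sq: "distr cgauss borel (\<lambda>z. (cmod z)\<^sup>2) = exp1"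
proof -
  have "distr cgauss borel (\<lambda>z. (cmod z)\<^sup>2) = density (distr lborel borel (\<lambda>z. (cmod z)\<^sup>2)) (\<lambda>t. ennreal (exp (- t) / pi))"
    unfolding cgauss_def by (rule density_distr[symmetric]) auto
  also have "\<dots> = density lborel (\<lambda>t. ennreal (pi * indicator {0..} t) * ennreal (exp (- t) / pi))"
    unfolding distr_lborel_cmod_sq by (subst density_density_eq) auto
  also have "\<dots> = exp1"
    by (intro density_cong)
      (auto simp: exponential_density_def ennreal_mult[symmetric] split: split_indicator)
  finally show ?thesis .
qed

lemma prob_space_exp1: "prob_space exp1"
  by (rule prob_space_exponential_density) simp

lemma prob_space_cgauss: "prob_space cgauss"
proof -
  have "prob_space (distr cgauss borel (\<lambda>z. (cmod z)\<^sup>2))"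
    by (simp add: distr_cgauss_cmod_sq prob_space_exp1)
  then show ?thesis by (rule prob_space_distrD[rotated]) simp
qed

lemma integral_cgauss_radial:
  fixes f :: "real \<Rightarrow> 'b::{banach,second_countable_topology}"
  assumes "f \<in> borel_measurable borel"
  shows "(\<integral>z. f ((cmod z)\<^sup>2) \<partial>cgauss) = (\<integral>t. f t \<partial>exp1)"
    and "integrable cgauss (\<lambda>z. f ((cmod z)\<^sup>2)) \<longleftrightarrow> integrable exp1 f"
  using assms
  by (simp_all add: distr_cgauss_cmod_sq[symmetric] integral_distr integrable_distr_eq)

lemma has_bochner_integral_exp1_power: "has_bochner_integral exp1 (\<lambda>t. t ^ k) (fact k)"
proof -
  interpret prob_space exp1 by (rule prob_space_exp1)
  have "distributed exp1 lborel (\<lambda>t. t) (erlang_density 0 1)"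
    unfolding distributed_def by (simp add: distr_id2)
  from has_bochner_integral_erlang_ith_moment[OF _ this, of k] show ?thesis by simp
qed

lemma cgauss_rotate:
  assumes u: "cmod u = 1"
  shows "distr cgauss borel ((*) u) = cgauss"
  unfolding cgauss_def
  by (rule distr_density_isometry) (auto simp: u norm_mult linear_conv_bounded_linear bounded_linear_mult_right)

lemma vec_lambda_measurable:
  fixes M :: "'n::finite \<Rightarrow> 'a::euclidean_space measure"
  assumes [measurable_cong]: "\<And>i. sets (M i) = sets borel"
  shows "vec_lambda \<in> measurable (Pi\<^sub>M UNIV M) borel"
proof (rule borel_measurable_euclidean_space[THEN iffD2], intro ballI)
  fix b :: "'a^'n" assume "b \<in> Basis"
  then obtain i u where b: "b = axis i u" by (auto simp: Basis_vec_def)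
  have "(\<lambda>x. inner (vec_lambda x) b) = (\<lambda>x. inner (x i) u)"
    by (auto simp: b inner_axis)
  then show "(\<lambda>x. inner (vec_lambda x) b) \<in> borel_measurable (Pi\<^sub>M UNIV M)"
    by simp
qed

lemma borel_measurable_vec_nth'[measurable (raw)]:
  fixes f :: "'a \<Rightarrow> 'b::euclidean_space^'n::finite"
  assumes "f \<in> borel_measurable M"
  shows "(\<lambda>x. f x $h i) \<in> borel_measurable M"
  using assms by (rule borel_measurable_continuous_on[rotated]) (intro continuous_intros)

lemma borel_measurable_cnj[measurable (raw)]:
  assumes "f \<in> borel_measurable M"
  shows "(\<lambda>x. cnj (f x)) \<in> borel_measurable M"
  using assms by (rule borel_measurable_continuous_on[rotated]) (intro continuous_intros)

lemma lborel_vec: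
  "distr (Pi\<^sub>M UNIV (\<lambda>_::'n::finite. lborel :: 'a::euclidean_space measure)) borel vec_lambda = lborel"
proof (rule lborel_eqI[symmetric])
  interpret product_sigma_finite "\<lambda>_::'n. lborel :: 'a measure" ..
  have [measurable]: "vec_lambda \<in> measurable (Pi\<^sub>M UNIV (\<lambda>_::'n. lborel :: 'a measure)) borel"
    by (rule vec_lambda_measurable) simp
  fix l u :: "'a^'n" assume lu: "\<And>b. b \<in> Basis \<Longrightarrow> l \<bullet> b \<le> u \<bullet> b"
  have le: "l $h i \<bullet> b \<le> u $h i \<bullet> b" if "b \<in> Basis" for i b
    using lu[of "axis i b"] that by (auto simp: inner_axis Basis_vec_def)
  have "vec_lambda -` box l u \<inter> space (Pi\<^sub>M UNIV (\<lambda>_::'n. lborel :: 'a measure)) = Pi\<^sub>E UNIV (\<lambda>i. box (l $h i) (u $h i))"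
    by (auto simp: mem_box Basis_vec_def inner_axis space_PiM PiE_def Pi_iff)
  then have "emeasure (distr (Pi\<^sub>M UNIV (\<lambda>_::'n. lborel)) borel vec_lambda) (box l u)
      = emeasure (Pi\<^sub>M UNIV (\<lambda>_::'n. lborel)) (Pi\<^sub>E UNIV (\<lambda>i. box (l $h i) (u $h i)))"
    by (subst emeasure_distr) auto
  also have "\<dots> = (\<Prod>i\<in>UNIV. emeasure lborel (box (l $h i) (u $h i)))"
    by (rule emeasure_PiM) auto
  also have "\<dots> = (\<Prod>i\<in>UNIV. ennreal (\<Prod>b\<in>Basis. (u $h i - l $h i) \<bullet> b))"
    by (intro prod.cong refl emeasure_lborel_box le)
  also have "\<dots> = ennreal (\<Prod>i\<in>UNIV. \<Prod>b\<in>Basis. (u $h i - l $h i) \<bullet> b)"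
    by (intro prod_ennreal prod_nonneg) (auto simp: inner_diff_left le)
  also have "(\<Prod>i\<in>UNIV. \<Prod>b\<in>Basis. (u $h i - l $h i) \<bullet> b) = (\<Prod>b\<in>Basis. (u - l) \<bullet> b)"
  proof -
    have "(\<Prod>b\<in>Basis. (u - l) \<bullet> b) = (\<Prod>b\<in>(\<Union>i. (axis i) ` Basis). (u - l) \<bullet> b)"
      by (intro prod.cong) (auto simp: Basis_vec_def)
    also have "\<dots> = (\<Prod>i\<in>UNIV. \<Prod>b\<in>axis i ` Basis. (u - l) \<bullet> b)"
      by (intro prod.UNION_disjoint) (auto simp: axis_eq_axis)
    also have "\<dots> = (\<Prod>i\<in>UNIV. \<Prod>b\<in>Basis. (u $h i - l $h i) \<bullet> b)"
      by (intro prod.cong refl, subst prod.reindex) (auto simp: inj_on_def axis_eq_axis inner_axis)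
    finally show ?thesis by simp
  qed
  finally show "emeasure (distr (Pi\<^sub>M UNIV (\<lambda>_::'n. lborel)) borel vec_lambda) (box l u) = ennreal (\<Prod>b\<in>Basis. (u - l) \<bullet> b)" .
qed simp

definition gauss :: "(complex^'n::finite) measure" where
  "gauss = distr (Pi\<^sub>M UNIV (\<lambda>_. cgauss)) borel vec_lambda"

lemma sets_gauss[simp, measurable_cong]: "sets gauss = sets borel"
  and space_gauss[simp]: "space gauss = UNIV"
  by (simp_all add: gauss_def)

interpretation cgauss: prob_space cgauss by (rule prob_space_cgauss)

interpretation cgauss_prod: product_sigma_finite "\<lambda>_::'n. cgauss" by unfold_locales

lemma vec_lambda_cgauss[measurable]: "vec_lambda \<in> measurable (Pi\<^sub>M UNIV (\<lambda>_::'n::finite. cgauss)) borel"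
  by (rule vec_lambda_measurable) simp

lemma prob_space_gauss: "prob_space (gauss :: (complex^'n::finite) measure)"
  unfolding gauss_def by (rule prob_space.prob_space_distr) (auto intro: prob_space_PiM prob_space_cgauss)

interpretation gauss: prob_space "gauss :: (complex^'n::finite) measure" by (rule prob_space_gauss)

text \<open>The two descriptions serve different ends: the product form evaluates integrals of
  coordinatewise products, while the density depends on the norm alone and so shows invariance under
  isometries.\<close>

lemma gauss_eq_density:
  "(gauss :: (complex^'n::finite) measure) = density lborel (\<lambda>x. ennreal (exp (- (norm x)\<^sup>2) / pi ^ CARD('n)))"
proof -
  interpret L: product_sigma_finite "\<lambda>_::'n. lborel :: complex measure" ..
  let ?d = "\<lambda>z. ennreal (exp (- (cmod z)\<^sup>2) / pi)"
  let ?P = "Pi\<^sub>M UNIV (\<lambda>_::'n. lborel :: complex measure)"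
  have [measurable]: "vec_lambda \<in> measurable ?P borel"
    by (rule vec_lambda_measurable) simp
  have "density ?P (\<lambda>x. \<Prod>i\<in>UNIV. ?d (x i)) = Pi\<^sub>M UNIV (\<lambda>_::'n. cgauss)"
  proof (rule cgauss_prod.PiM_eqI)
    show "sets (density ?P (\<lambda>x. \<Prod>i\<in>UNIV. ?d (x i))) = sets (Pi\<^sub>M UNIV (\<lambda>_::'n. cgauss))"
      by (simp cong: sets_PiM_cong)
    fix A :: "'n \<Rightarrow> complex set" assume "\<And>i. i \<in> UNIV \<Longrightarrow> A i \<in> sets cgauss"
    then have A[measurable]: "A i \<in> sets borel" for i by simp
    have "emeasure (density ?P (\<lambda>x. \<Prod>i\<in>UNIV. ?d (x i))) (Pi\<^sub>E UNIV A)
        = (\<integral>\<^sup>+x. (\<Prod>i\<in>UNIV. ?d (x i)) * indicator (Pi\<^sub>E UNIV A) x \<partial>?P)"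
      by (rule emeasure_density) (auto intro!: sets_PiM_I_finite)
    also have "\<dots> = (\<integral>\<^sup>+x. (\<Prod>i\<in>UNIV. ?d (x i) * indicator (A i) (x i)) \<partial>?P)"
    proof (rule nn_integral_cong)
      fix x :: "'n \<Rightarrow> complex"
      have "indicator (Pi\<^sub>E UNIV A) x = (\<Prod>i\<in>UNIV. indicator (A i) (x i) :: ennreal)"
        by (auto simp: indicator_def PiE_def Pi_def prod.neutral intro!: prod_zero[symmetric])
      then show "(\<Prod>i\<in>UNIV. ?d (x i)) * indicator (Pi\<^sub>E UNIV A) x = (\<Prod>i\<in>UNIV. ?d (x i) * indicator (A i) (x i))"
        by (simp add: prod.distrib)
    qed
    also have "\<dots> = (\<Prod>i\<in>UNIV. \<integral>\<^sup>+z. ?d z * indicator (A i) z \<partial>lborel)"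
      by (rule L.product_nn_integral_prod) auto
    also have "\<dots> = (\<Prod>i\<in>UNIV. emeasure cgauss (A i))"
      by (simp add: cgauss_def emeasure_density)
    finally show "emeasure (density ?P (\<lambda>x. \<Prod>i\<in>UNIV. ?d (x i))) (Pi\<^sub>E UNIV A) = (\<Prod>i\<in>UNIV. emeasure cgauss (A i))" .
  qed simp
  then have "(gauss :: (complex^'n) measure) = distr (density ?P (\<lambda>x. \<Prod>i\<in>UNIV. ?d (x i))) borel vec_lambda"
    by (simp add: gauss_def)
  also have "density ?P (\<lambda>x. \<Prod>i\<in>UNIV. ?d (x i)) = density ?P (\<lambda>x. (\<lambda>v. \<Prod>i\<in>UNIV. ?d (v $h i)) (vec_lambda x))"
    by simp
  also have "distr \<dots> borel vec_lambda = density (distr ?P borel vec_lambda) (\<lambda>v. \<Prod>i\<in>UNIV. ?d (v $h i))"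
    by (rule density_distr[symmetric]) auto
  also have "\<dots> = density lborel (\<lambda>v::complex^'n. \<Prod>i\<in>UNIV. ?d (v $h i))"
    by (simp add: lborel_vec)
  also have "(\<lambda>v::complex^'n. \<Prod>i\<in>UNIV. ?d (v $h i)) = (\<lambda>x. ennreal (exp (- (norm x)\<^sup>2) / pi ^ CARD('n)))"
  proof
    fix v :: "complex^'n"
    have "(norm v)\<^sup>2 = (\<Sum>i\<in>UNIV. (cmod (v $h i))\<^sup>2)"
      by (simp add: norm_vec_def L2_set_def sum_nonneg)
    then show "(\<Prod>i\<in>UNIV. ?d (v $h i)) = ennreal (exp (- (norm v)\<^sup>2) / pi ^ CARD('n))"
      by (simp add: prod_ennreal prod_dividef exp_sum[symmetric] sum_negf)
  qed
  finally show ?thesis .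
qed

lemma distr_gauss_isometry:
  fixes U :: "complex^'n::finite \<Rightarrow> complex^'n"
  assumes "linear U" "\<And>x. norm (U x) = norm x"
  shows "distr gauss borel U = gauss"
  unfolding gauss_eq_density by (rule distr_density_isometry) (use assms in auto)

lemma
  fixes f :: "'n::finite \<Rightarrow> complex \<Rightarrow> 'b::{real_normed_field,banach,second_countable_topology}"
  assumes "\<And>l. integrable cgauss (f l)"
  shows integrable_gauss_prod: "integrable gauss (\<lambda>x. \<Prod>l\<in>UNIV. f l (x $h l))"
    and integral_gauss_prod: "(\<integral>x. (\<Prod>l\<in>UNIV. f l (x $h l)) \<partial>gauss) = (\<Prod>l\<in>UNIV. \<integral>z. f l z \<partial>cgauss)"
proof -
  have [measurable]: "f l \<in> borel_measurable borel" for l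
    using borel_measurable_integrable[OF assms[of l]] by simp
  show "integrable gauss (\<lambda>x. \<Prod>l\<in>UNIV. f l (x $h l))"
    unfolding gauss_def using cgauss_prod.product_integrable_prod[of UNIV f] assms
    by (simp add: integrable_distr_eq)
  show "(\<integral>x. (\<Prod>l\<in>UNIV. f l (x $h l)) \<partial>gauss) = (\<Prod>l\<in>UNIV. \<integral>z. f l z \<partial>cgauss)"
    unfolding gauss_def using cgauss_prod.product_integral_prod[of UNIV f] assms
    by (simp add: integral_distr)
qed

section \<open>Hermite polynomials\<close>

text \<open>The complex Hermite polynomials of bidegree \<open>(p, q)\<close>, used for \<open>q \<le> 1\<close> only.\<close>

definition herm :: "nat \<Rightarrow> nat \<Rightarrow> complex \<Rightarrow> complex" where
  "herm p q z = (if q = 0 then z ^ p else z ^ p * cnj z - of_nat p * z ^ (p - 1))"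

section \<open>Functions of polynomial growth\<close>

definition slow :: "(complex \<Rightarrow> complex) \<Rightarrow> bool" where
  "slow F \<longleftrightarrow> F \<in> borel_measurable borel \<and> (\<exists>C k. \<forall>z. norm (F z) \<le> C * (1 + cmod z) ^ k)"

lemma slowI: "F \<in> borel_measurable borel \<Longrightarrow> (\<And>z. norm (F z) \<le> C * (1 + cmod z) ^ k) \<Longrightarrow> slow F"
  by (auto simp: slow_def)

lemma slow_mult: assumes "slow F" "slow G" shows "slow (\<lambda>z. F z * G z)"
proof -
  obtain C k D m where *: "\<And>z. norm (F z) \<le> C * (1 + cmod z) ^ k" "\<And>z. norm (G z) \<le> D * (1 + cmod z) ^ m"
    using assms by (auto simp: slow_def)
  have [measurable]: "F \<in> borel_measurable borel" "G \<in> borel_measurable borel"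
    using assms by (auto simp: slow_def)
  show ?thesis
  proof (rule slowI)
    fix z
    have "norm (F z * G z) \<le> (C * (1 + cmod z) ^ k) * (D * (1 + cmod z) ^ m)"
      unfolding norm_mult by (intro mult_mono *) (use *(1)[of z] norm_ge_zero[of "F z"] in linarith, simp)
    then show "norm (F z * G z) \<le> (C * D) * (1 + cmod z) ^ (k + m)"
      by (simp add: power_add ac_simps)
  qed simp
qed

lemma slow_bounded:
  assumes "F \<in> borel_measurable borel" "\<And>z. norm (F z) \<le> B" shows "slow F"
  by (rule slowI[of _ B 0]) (use assms in auto)

lemma slow_const: "slow (\<lambda>_. c)"
  by (rule slow_bounded) auto

lemma slow_id: "slow (\<lambda>z. z)"
  by (rule slowI[of _ 1 1]) auto

lemma slow_cnj: "slow F \<Longrightarrow> slow (\<lambda>z. cnj (F z))"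
  by (auto simp: slow_def intro: borel_measurable_cnj)

lemma slow_add: assumes "slow F" "slow G" shows "slow (\<lambda>z. F z + G z)"
proof -
  obtain C k D m where *: "\<And>z. norm (F z) \<le> C * (1 + cmod z) ^ k" "\<And>z. norm (G z) \<le> D * (1 + cmod z) ^ m"
    using assms by (auto simp: slow_def)
  have [measurable]: "F \<in> borel_measurable borel" "G \<in> borel_measurable borel"
    using assms by (auto simp: slow_def)
  have CD: "0 \<le> C" "0 \<le> D"
    using order_trans[OF norm_ge_zero *(1)[of 0]] order_trans[OF norm_ge_zero *(2)[of 0]] by simp_all
  show ?thesis
  proof (rule slowI)
    fix z
    have "norm (F z + G z) \<le> C * (1 + cmod z) ^ k + D * (1 + cmod z) ^ m"
      using norm_triangle_ineq[of "F z" "G z"] *[of z] by linarith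
    also have "\<dots> \<le> C * (1 + cmod z) ^ (k + m) + D * (1 + cmod z) ^ (k + m)"
      by (intro add_mono mult_left_mono power_increasing CD) auto
    finally show "norm (F z + G z) \<le> (C + D) * (1 + cmod z) ^ (k + m)"
      by (simp add: algebra_simps)
  qed simp
qed

lemma slow_power: "slow F \<Longrightarrow> slow (\<lambda>z. F z ^ n)"
  by (induction n) (auto simp: slow_const intro: slow_mult)

lemma slow_diff: "slow F \<Longrightarrow> slow G \<Longrightarrow> slow (\<lambda>z. F z - G z)"
  using slow_add[of F "\<lambda>z. (- 1) * G z"] slow_mult[OF slow_const, of G "- 1"] by simp

lemma slow_herm: "slow (herm p q)"
  by (cases "q = 0") (auto simp: herm_def[abs_def] intro!: slow_diff slow_mult slow_power slow_cnj slow_id slow_const)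

lemmas slow_intros = slow_mult slow_const slow_id slow_cnj slow_herm slow_power slow_add slow_diff

lemma integrable_exp1_power: "integrable exp1 (\<lambda>t. t ^ k)"
  and integral_exp1_power: "(\<integral>t. t ^ k \<partial>exp1) = fact k"
  using has_bochner_integral_exp1_power[of k] by (auto simp: has_bochner_integral_iff)

lemma slow_integrable: assumes "slow F" shows "integrable cgauss F"
proof -
  obtain C k where *: "\<And>z. norm (F z) \<le> C * (1 + cmod z) ^ k"
    using assms by (auto simp: slow_def)
  have [measurable]: "F \<in> borel_measurable borel"
    using assms by (auto simp: slow_def)
  have C: "0 \<le> C" using order_trans[OF norm_ge_zero *[of 0]] by simp
  show ?thesis
  proof (rule Bochner_Integration.integrable_bound)
    have "integrable exp1 (\<lambda>t. \<Sum>j\<le>k. of_nat (k choose j) * t ^ j)"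
      by (intro Bochner_Integration.integrable_sum integrable_mult_right integrable_exp1_power)
    then have "integrable exp1 (\<lambda>t. C * (2 ^ k * (t + 1) ^ k))"
      by (intro integrable_mult_right) (simp add: binomial_ring)
    then show "integrable cgauss (\<lambda>z. C * (2 ^ k * ((cmod z)\<^sup>2 + 1) ^ k))"
      by (subst integral_cgauss_radial(2)) auto
    show "AE z in cgauss. norm (F z) \<le> norm (C * (2 ^ k * ((cmod z)\<^sup>2 + 1) ^ k))"
    proof (intro AE_I2)
      fix z
      \<comment> \<open>Odd powers of the modulus are replaced by a polynomial in its square, whose
        exponential moments are factorials.\<close>
      have "1 + cmod z \<le> 2 * ((cmod z)\<^sup>2 + 1)"
        using zero_le_power2[of "cmod z - 1"] zero_le_power2[of "cmod z"] norm_ge_zero[of z]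
        unfolding power2_diff power_one mult_1_right distrib_left by linarith
      then have "(1 + cmod z) ^ k \<le> (2 * ((cmod z)\<^sup>2 + 1)) ^ k"
        by (intro power_mono) auto
      then have "C * (1 + cmod z) ^ k \<le> C * (2 ^ k * ((cmod z)\<^sup>2 + 1) ^ k)"
        unfolding power_mult_distrib using C by (rule mult_left_mono)
      with *[of z] show "norm (F z) \<le> norm (C * (2 ^ k * ((cmod z)\<^sup>2 + 1) ^ k))"
        using C by simp
    qed
  qed simp
qed

text \<open>The rotation by \<open>\<tau>\<close>, chosen with \<open>(a - b) * \<tau> = pi\<close>,
  preserves the measure and multiplies the integrand by -1.\<close>

lemma integral_cgauss_charge:
  assumes ab: "a \<noteq> b"
  shows "(\<integral>z. z ^ a * cnj z ^ b \<partial>cgauss) = 0"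
proof -
  let ?I = "\<integral>z. z ^ a * cnj z ^ b \<partial>cgauss"
  define \<tau> where "\<tau> = pi / (real a - real b)"
  have "?I = (\<integral>z. z ^ a * cnj z ^ b \<partial>distr cgauss borel ((*) (cis \<tau>)))"
    by (simp add: cgauss_rotate)
  also have "\<dots> = (\<integral>z. (cis \<tau> * z) ^ a * cnj (cis \<tau> * z) ^ b \<partial>cgauss)"
    by (rule integral_distr) auto
  also have "\<dots> = (\<integral>z. (cis \<tau> ^ a * cnj (cis \<tau>) ^ b) * (z ^ a * cnj z ^ b) \<partial>cgauss)"
    by (intro Bochner_Integration.integral_cong refl) (simp add: power_mult_distrib)
  also have "\<dots> = (cis \<tau> ^ a * cnj (cis \<tau>) ^ b) * ?I"
    by (rule integral_mult_right_zero)
  also have "cis \<tau> ^ a * cnj (cis \<tau>) ^ b = cis (real a * \<tau> + real b * (- \<tau>))"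
    by (simp only: cis_cnj Complex.DeMoivre cis_mult)
  also have "real a * \<tau> + real b * (- \<tau>) = (real a - real b) * \<tau>"
    by (simp add: left_diff_distrib)
  also have "\<dots> = pi"
    using ab by (simp add: \<tau>_def)
  finally have "?I = - ?I" by simp
  then show ?thesis by (metis add.inverse_inverse eq_neg_iff_add_eq_0 mult_2 mult_eq_0_iff zero_neq_numeral)
qed

lemma slow_monomial: "slow (\<lambda>z. c * (z ^ a * cnj z ^ b))"
  by (intro slow_intros)

lemma integral_cgauss_monomial: "(\<integral>z. z ^ a * cnj z ^ b \<partial>cgauss) = (if a = b then fact a else 0)"
proof (cases "a = b")
  case True
  have "(\<integral>z. z ^ a * cnj z ^ a \<partial>cgauss) = (\<integral>z. complex_of_real (((cmod z)\<^sup>2) ^ a) \<partial>cgauss)"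
    unfolding of_real_power[of "(cmod _)\<^sup>2"] complex_norm_square power_mult_distrib ..
  also have "\<dots> = complex_of_real (\<integral>z. ((cmod z)\<^sup>2) ^ a \<partial>cgauss)"
    by (rule integral_complex_of_real)
  also have "(\<integral>z. ((cmod z)\<^sup>2) ^ a \<partial>cgauss) = fact a"
    using integral_cgauss_radial(1)[of "\<lambda>t. t ^ a"] by (simp add: integral_exp1_power)
  finally show ?thesis using True by simp
qed (simp add: integral_cgauss_charge)

text \<open>Three monomials suffice: for \<open>q \<le> 1\<close> a product of two Hermite
  polynomials has at most four terms, and when there are four the two mixed ones are multiples of
  the same monomial.\<close>

lemma integral_cgauss_3:
  "(\<integral>z. c1 * (z ^ a1 * cnj z ^ b1) + c2 * (z ^ a2 * cnj z ^ b2) + c3 * (z ^ a3 * cnj z ^ b3) \<partial>cgauss)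
    = c1 * (if a1 = b1 then fact a1 else 0) + c2 * (if a2 = b2 then fact a2 else 0) + c3 * (if a3 = b3 then fact a3 else 0)"
  by (subst Bochner_Integration.integral_add Bochner_Integration.integral_mult_right_zero
      | intro slow_integrable slow_add slow_monomial | simp only: integral_cgauss_monomial)+

lemma of_nat_mult_power_pred: "of_nat p * z ^ (p - 1) * z = of_nat p * z ^ p" for z :: complex
  by (cases p) auto

lemma herm_orthogonal:
  assumes "q \<le> 1" "q' \<le> 1"
  shows "(\<integral>z. herm p q z * cnj (herm p' q' z) \<partial>cgauss) = (if p = p' \<and> q = q' then fact p else 0)"
proof -
  consider "q = 0" "q' = 0" | "q = 0" "q' = 1" | "q = 1" "q' = 0" | "q = 1" "q' = 1"
    using assms by linarith
  then show ?thesis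
  proof cases
    case 1
    then show ?thesis by (simp add: herm_def integral_cgauss_monomial)
  next
    case 2
    have "herm p q z * cnj (herm p' q' z) = 1 * (z ^ (p + 1) * cnj z ^ p') + (- of_nat p') * (z ^ p * cnj z ^ (p' - 1)) + 0 * (z ^ 0 * cnj z ^ 0)" for z
      using 2 by (simp add: herm_def algebra_simps)
    then show ?thesis using 2
      by (simp only: integral_cgauss_3) (cases p', auto simp: algebra_simps)
  next
    case 3
    have "herm p q z * cnj (herm p' q' z) = 1 * (z ^ p * cnj z ^ (p' + 1)) + (- of_nat p) * (z ^ (p - 1) * cnj z ^ p') + 0 * (z ^ 0 * cnj z ^ 0)" for z
      using 3 by (simp add: herm_def algebra_simps)
    then show ?thesis using 3
      by (simp only: integral_cgauss_3) (cases p, auto simp: algebra_simps)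
  next
    case 4
    have "herm p q z * cnj (herm p' q' z) = 1 * (z ^ (p + 1) * cnj z ^ (p' + 1)) + (- (of_nat p + of_nat p')) * (z ^ p * cnj z ^ p')
        + (of_nat p * of_nat p') * (z ^ (p - 1) * cnj z ^ (p' - 1))" for z
    proof -
      have "herm p q z * cnj (herm p' q' z) = z ^ (p + 1) * cnj z ^ (p' + 1) - (of_nat p' * cnj z ^ (p' - 1) * cnj z) * z ^ p
         - (of_nat p * z ^ (p - 1) * z) * cnj z ^ p' + (of_nat p * of_nat p') * (z ^ (p - 1) * cnj z ^ (p' - 1))"
        using 4 by (simp add: herm_def algebra_simps)
      then show ?thesis unfolding of_nat_mult_power_pred by (simp add: algebra_simps)
    qed
    then show ?thesis using 4
      by (simp only: integral_cgauss_3) (cases p; cases p'; auto simp: algebra_simps)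
  qed
qed

text \<open>Conjugation exchanges the two degrees of a Hermite polynomial, so this is orthogonality
  of the bidegrees (p, q) and (q', p'). The conjugate may have a second degree above 1, outside the
  range of \<open>herm\<close>, hence the direct computation.\<close>

lemma herm_orthogonal':
  assumes "q \<le> 1" "q' \<le> 1" "\<not> (p' = q \<and> q' = p)"
  shows "(\<integral>z. herm p q z * herm p' q' z \<partial>cgauss) = 0"
proof -
  consider "q = 0" "q' = 0" | "q = 0" "q' = 1" | "q = 1" "q' = 0" | "q = 1" "q' = 1"
    using assms by linarith
  then show ?thesis
  proof cases
    case 1
    then have "herm p q z * herm p' q' z = z ^ (p + p') * cnj z ^ 0" for z
      by (simp add: herm_def power_add)
    then show ?thesis using 1 assms(3) by (simp only: integral_cgauss_monomial) auto
  next
    case 2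
    have "herm p q z * herm p' q' z = 1 * (z ^ (p + p') * cnj z ^ 1) + (- of_nat p') * (z ^ (p + (p' - 1)) * cnj z ^ 0) + 0 * (z ^ 0 * cnj z ^ 0)" for z
      using 2 by (simp add: herm_def algebra_simps power_add)
    then show ?thesis using 2 assms(3)
      by (simp only: integral_cgauss_3) (cases p', auto simp: algebra_simps)
  next
    case 3
    have "herm p q z * herm p' q' z = 1 * (z ^ (p + p') * cnj z ^ 1) + (- of_nat p) * (z ^ (p - 1 + p') * cnj z ^ 0) + 0 * (z ^ 0 * cnj z ^ 0)" for z
      using 3 by (simp add: herm_def algebra_simps power_add)
    then show ?thesis using 3 assms(3)
      by (simp only: integral_cgauss_3) (cases p, auto simp: algebra_simps)
  next
    case 4
    have "herm p q z * herm p' q' z = 1 * (z ^ (p + p') * cnj z ^ 2) + (- (of_nat p + of_nat p')) * (z ^ (p + p' - 1) * cnj z ^ 1)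
        + (of_nat p * of_nat p') * (z ^ (p - 1 + (p' - 1)) * cnj z ^ 0)" for z
    proof -
      have "herm p q z * herm p' q' z = z ^ (p + p') * cnj z ^ 2 - (of_nat p' * (z ^ p * z ^ (p' - 1)) + of_nat p * (z ^ (p - 1) * z ^ p')) * cnj z
         + (of_nat p * of_nat p') * (z ^ (p - 1) * z ^ (p' - 1))"
        using 4 by (simp add: herm_def algebra_simps power_add power2_eq_square)
      also have "of_nat p' * (z ^ p * z ^ (p' - 1)) = of_nat p' * z ^ (p + p' - 1)"
        by (cases p') (auto simp: power_add)
      also have "of_nat p * (z ^ (p - 1) * z ^ p') = of_nat p * z ^ (p + p' - 1)"
        by (cases p) (auto simp: power_add)
      finally show ?thesis by (simp add: algebra_simps power_add)
    qed
    then have "(\<integral>z. herm p q z * herm p' q' z \<partial>cgauss) = (if p + p' = 2 then fact (p + p') else 0)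
        + (- (of_nat p + of_nat p')) * (if p + p' - 1 = 1 then fact (p + p' - 1) else 0)
        + of_nat p * of_nat p' * (if p - 1 + (p' - 1) = 0 then fact (p - 1 + (p' - 1)) else 0)"
      by (simp only: integral_cgauss_3) simp
    also have "\<dots> = 0"
    proof (cases "p + p' = 2")
      case True
      \<comment> \<open>Monomials survive only in total degree 2. The pair (1, 1) is excluded by
        hypothesis, and in the other two cases the terms are 2! - 2 * 1! = 0.\<close>
      then consider "p = 0" "p' = 2" | "p = 2" "p' = 0" | "p = 1" "p' = 1" by linarith
      then show ?thesis by cases (use 4 assms(3) in auto)
    next
      case False
      then have "p + p' - 1 \<noteq> 1" by linarith
      moreover have "of_nat p * of_nat p' * (if p - 1 + (p' - 1) = 0 then fact (p - 1 + (p' - 1)) else 0 :: complex) = 0"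
        using False by (cases p; cases p') auto
      ultimately show ?thesis using False by simp
    qed
    finally show ?thesis .
  qed
qed

text \<open>A triple \<open>(i, j, k)\<close> stands for the monomial \<open>x\<^sub>i x\<^sub>j cnj x\<^sub>k\<close>. Through the symmetry
  \<open>sw\<close> a basis function with \<open>i \<noteq> j\<close> is counted twice, and for \<open>i = j\<close> its squared norm is 2;
  this is why sums over all triples are halved below.\<close>

fun hp :: "'n \<times> 'n \<times> 'n \<Rightarrow> 'n \<Rightarrow> nat" where
  "hp (i, j, k) l = of_bool (i = l) + of_bool (j = l)"

fun hq :: "'n \<times> 'n \<times> 'n \<Rightarrow> 'n \<Rightarrow> nat" where
  "hq (i, j, k) l = of_bool (k = l)"

fun sw :: "'n \<times> 'n \<times> 'n \<Rightarrow> 'n \<times> 'n \<times> 'n" where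
  "sw (i, j, k) = (j, i, k)"

lemma hq_le_1: "hq I l \<le> 1"
  by (cases I) auto

lemma hp_sw: "hp (sw I) = hp I" and hq_sw: "hq (sw I) = hq I" and sw_sw[simp]: "sw (sw I) = I"
  by (cases I; auto simp: fun_eq_iff)+

lemma sum_hp: "(\<Sum>l\<in>UNIV. hp I l) = 2" and sum_hq: "(\<Sum>l\<in>UNIV. hq I l) = 1" for I :: "'n::finite \<times> 'n \<times> 'n"
  by (cases I; simp add: sum.distrib of_bool_def)+

lemma hp_hq_eq_iff: "hp I = hp J \<and> hq I = hq J \<longleftrightarrow> I = J \<or> I = sw J"
proof
  obtain i j k i' j' k' where IJ: "I = (i, j, k)" "J = (i', j', k')"
    by (metis prod_cases3)
  assume "hp I = hp J \<and> hq I = hq J"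
  then have "hp I l = hp J l" "hq I l = hq J l" for l by simp_all
  then have a: "of_bool (i = l) + of_bool (j = l) = (of_bool (i' = l) + of_bool (j' = l) :: nat)"
    and b: "of_bool (k = l) = (of_bool (k' = l) :: nat)" for l
    unfolding IJ hp.simps hq.simps by blast+
  have k: "k = k'" using b[of k] by (simp split: if_splits add: of_bool_def)
  have "i' = i \<or> j' = i" using a[of i] by (auto simp: of_bool_def split: if_splits)
  then show "I = J \<or> I = sw J"
  proof
    assume i: "i' = i"
    then have "j = j'" using a[of j] by (simp add: of_bool_def split: if_splits)
    then show ?thesis using i k by (simp add: IJ)
  next
    assume i: "j' = i"
    then have "j = i'" using a[of j] by (simp add: of_bool_def split: if_splits)
    then show ?thesis using i k by (simp add: IJ)
  qed
qed (auto simp: hp_sw hq_sw)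

text \<open>The squared norm of \<open>h3 I\<close>, put in the shape of the general inner product
  in \<open>integral_h3_cnj\<close>, so that \<open>J = I\<close> and \<open>J = sw I\<close> can be
  treated together there.\<close>

lemma prod_fact_hp: "(\<Prod>l\<in>UNIV. fact (hp I l)) = (of_bool (I = I) + of_bool (I = sw I) :: complex)"
  for I :: "'n::finite \<times> 'n \<times> 'n"
proof -
  obtain i j k where I: "I = (i, j, k)" by (metis prod_cases3)
  show ?thesis
  proof (cases "i = j")
    case True
    have "(\<Prod>l\<in>UNIV. fact (hp I l)) = (\<Prod>l\<in>UNIV. if l = i then 2 else 1 :: complex)"
      by (intro prod.cong) (auto simp: I True of_bool_def fact_2)
    then show ?thesis using True by (simp add: I)
  next
    case False
    have "(\<Prod>l\<in>UNIV. fact (hp I l)) = (\<Prod>l\<in>(UNIV::'n set). 1 :: complex)"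
      by (intro prod.cong) (use False in \<open>auto simp: I of_bool_def\<close>)
    then show ?thesis using False by (auto simp: I)
  qed
qed

text \<open>The Wick power of the cubic monomial. The product over coordinates reduces orthogonality
  to one variable; \<open>h3_eq\<close> supplies the expanded form, from which the kernel is
  computed.\<close>

definition h3 :: "'n \<times> 'n \<times> 'n \<Rightarrow> complex^'n::finite \<Rightarrow> complex" where
  "h3 I x = (\<Prod>l\<in>UNIV. herm (hp I l) (hq I l) (x $h l))"

lemma h3_eq: "h3 (i, j, k) x = x $h i * x $h j * cnj (x $h k) - of_bool (j = k) * x $h i - of_bool (i = k) * x $h j"
proof -
  have "h3 (i, j, k) x = herm (hp (i, j, k) k) (hq (i, j, k) k) (x $h k) * (\<Prod>l\<in>UNIV - {k}. herm (hp (i, j, k) l) (hq (i, j, k) l) (x $h l))"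
    unfolding h3_def by (rule prod.remove) auto
  also have "(\<Prod>l\<in>UNIV - {k}. herm (hp (i, j, k) l) (hq (i, j, k) l) (x $h l))
      = (\<Prod>l\<in>UNIV - {k}. (if l = i then x $h l else 1) * (if l = j then x $h l else 1))"
    by (intro prod.cong) (auto simp: herm_def power2_eq_square)
  also have "\<dots> = (if i = k then 1 else x $h i) * (if j = k then 1 else x $h j)"
    by (subst prod.distrib) (simp add: prod.delta)
  finally show ?thesis
    by (auto simp: herm_def algebra_simps power2_eq_square)
qed

lemma h3_measurable[measurable]: "h3 I \<in> borel_measurable borel"
proof -
  obtain i j k where "I = (i, j, k)" by (metis prod_cases3)
  moreover have "h3 (i, j, k) = (\<lambda>x. x $h i * x $h j * cnj (x $h k) - of_bool (j = k) * x $h i - of_bool (i = k) * x $h j)"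
    by (rule ext) (rule h3_eq)
  ultimately show ?thesis by simp
qed

section \<open>Inner products weighted by a function of one coordinate\<close>

definition pair_factor :: "(complex \<Rightarrow> complex) \<Rightarrow> 'n \<Rightarrow> ('n \<Rightarrow> complex \<Rightarrow> complex) \<Rightarrow> 'n \<Rightarrow> complex \<Rightarrow> complex" where
  "pair_factor \<psi> o1 F l z = (if l = o1 then \<psi> z else 1) * F l z"

lemma prod_pair_factor:
  "(\<Prod>l\<in>UNIV. pair_factor \<psi> o1 F l (x $h l)) = \<psi> (x $h o1) * (\<Prod>l\<in>UNIV. F l (x $h l))" for o1 :: "'n::finite"
  by (simp add: pair_factor_def prod.distrib prod.delta)

lemma
  fixes o1 :: "'n::finite"
  assumes \<psi>: "\<psi> \<in> borel_measurable borel" "\<And>z. cmod (\<psi> z) \<le> B" and F: "\<And>l. slow (F l)"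
  shows integrable_weighted_prod: "integrable gauss (\<lambda>x. \<psi> (x $h o1) * (\<Prod>l\<in>UNIV. F l (x $h l)))"
    and integral_weighted_prod: "(\<integral>x. \<psi> (x $h o1) * (\<Prod>l\<in>UNIV. F l (x $h l)) \<partial>gauss)
      = (\<integral>z. \<psi> z * F o1 z \<partial>cgauss) * (\<Prod>l\<in>UNIV - {o1}. \<integral>z. F l z \<partial>cgauss)"
proof -
  have s: "slow (pair_factor \<psi> o1 F l)" for l
    unfolding pair_factor_def[abs_def] using slow_bounded[OF \<psi>] F[of l]
    by (cases "l = o1") (simp_all add: slow_mult)
  note i = slow_integrable[OF s]
  show "integrable gauss (\<lambda>x. \<psi> (x $h o1) * (\<Prod>l\<in>UNIV. F l (x $h l)))"
    using integrable_gauss_prod[of "pair_factor \<psi> o1 F", OF i] by (simp add: prod_pair_factor)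
  have "(\<integral>x. \<psi> (x $h o1) * (\<Prod>l\<in>UNIV. F l (x $h l)) \<partial>gauss) = (\<Prod>l\<in>UNIV. \<integral>z. pair_factor \<psi> o1 F l z \<partial>cgauss)"
    using integral_gauss_prod[of "pair_factor \<psi> o1 F", OF i] by (simp add: prod_pair_factor)
  also have "\<dots> = (\<integral>z. pair_factor \<psi> o1 F o1 z \<partial>cgauss) * (\<Prod>l\<in>UNIV - {o1}. \<integral>z. pair_factor \<psi> o1 F l z \<partial>cgauss)"
    by (rule prod.remove) auto
  also have "(\<Prod>l\<in>UNIV - {o1}. \<integral>z. pair_factor \<psi> o1 F l z \<partial>cgauss) = (\<Prod>l\<in>UNIV - {o1}. \<integral>z. F l z \<partial>cgauss)"
    by (intro prod.cong refl) (simp add: pair_factor_def)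
  finally show "(\<integral>x. \<psi> (x $h o1) * (\<Prod>l\<in>UNIV. F l (x $h l)) \<partial>gauss)
      = (\<integral>z. \<psi> z * F o1 z \<partial>cgauss) * (\<Prod>l\<in>UNIV - {o1}. \<integral>z. F l z \<partial>cgauss)"
    by (simp add: pair_factor_def)
qed

text \<open>In the Hermite basis, multiplication by a function of one coordinate is diagonal between
  functions of total bidegree \<open>(2, 1)\<close>: the other coordinates fix the exponents at that coordinate.\<close>

definition lam :: "(complex \<Rightarrow> complex) \<Rightarrow> nat \<Rightarrow> nat \<Rightarrow> complex" where
  "lam \<psi> p q = (\<integral>z. \<psi> z * (herm p q z * cnj (herm p q z)) \<partial>cgauss) / fact p"

lemma h3_times_cnj: "h3 I x * cnj (h3 J x) = (\<Prod>l\<in>UNIV. herm (hp I l) (hq I l) (x $h l) * cnj (herm (hp J l) (hq J l) (x $h l)))"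
  by (simp add: h3_def prod.distrib)

lemma h3_times: "h3 I x * h3 J x = (\<Prod>l\<in>UNIV. herm (hp I l) (hq I l) (x $h l) * herm (hp J l) (hq J l) (x $h l))"
  by (simp add: h3_def prod.distrib)

lemma eq_off_point:
  fixes f g :: "'n::finite \<Rightarrow> nat"
  assumes "(\<Sum>l\<in>UNIV. f l) = (\<Sum>l\<in>UNIV. g l)" "\<And>l. l \<noteq> o1 \<Longrightarrow> f l = g l"
  shows "f = g"
proof
  fix l
  have "f o1 + (\<Sum>l\<in>UNIV - {o1}. f l) = g o1 + (\<Sum>l\<in>UNIV - {o1}. g l)"
    using assms(1) by (simp add: sum.remove[of UNIV o1])
  moreover have "(\<Sum>l\<in>UNIV - {o1}. f l) = (\<Sum>l\<in>UNIV - {o1}. g l)"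
    by (intro sum.cong) (use assms(2) in auto)
  ultimately show "f l = g l" using assms(2)[of l] by (cases "l = o1") auto
qed

context
  fixes \<psi> :: "complex \<Rightarrow> complex" and B :: real and o1 :: "'n::finite"
  assumes \<psi>: "\<psi> \<in> borel_measurable borel" "\<And>z. cmod (\<psi> z) \<le> B"
begin

lemma integrable_h3_cnj: "integrable gauss (\<lambda>x. \<psi> (x $h o1) * (h3 I x * cnj (h3 J x)))"
  unfolding h3_times_cnj by (rule integrable_weighted_prod[OF \<psi>]) (intro slow_intros)

lemma integrable_h3_h3: "integrable gauss (\<lambda>x. \<psi> (x $h o1) * (h3 I x * h3 J x))"
  unfolding h3_times by (rule integrable_weighted_prod[OF \<psi>]) (intro slow_intros)

lemma integral_h3_cnj:
  "(\<integral>x. \<psi> (x $h o1) * (h3 I x * cnj (h3 J x)) \<partial>gauss)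
    = (of_bool (I = J) + of_bool (I = sw J)) * lam \<psi> (hp I o1) (hq I o1)"
proof -
  let ?r = "\<lambda>l. \<integral>z. herm (hp I l) (hq I l) z * cnj (herm (hp J l) (hq J l) z) \<partial>cgauss"
  have r: "?r l = (if hp I l = hp J l \<and> hq I l = hq J l then fact (hp I l) else 0)" for l
    by (rule herm_orthogonal) (rule hq_le_1)+
  have eq: "(\<integral>x. \<psi> (x $h o1) * (h3 I x * cnj (h3 J x)) \<partial>gauss)
      = (\<integral>z. \<psi> z * (herm (hp I o1) (hq I o1) z * cnj (herm (hp J o1) (hq J o1) z)) \<partial>cgauss) * (\<Prod>l\<in>UNIV - {o1}. ?r l)"
    unfolding h3_times_cnj by (rule integral_weighted_prod[OF \<psi>]) (intro slow_intros)
  show ?thesis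
  proof (cases "I = J \<or> I = sw J")
    case True
    then have pq: "hp I = hp J" "hq I = hq J" by (auto simp: hp_hq_eq_iff[symmetric])
    have b: "of_bool (I = J) + of_bool (I = sw J) = (of_bool (I = I) + of_bool (I = sw I) :: complex)"
      using True by (cases "I = J") auto
    have "fact (hp I o1) * (\<Prod>l\<in>UNIV - {o1}. fact (hp I l)) = (\<Prod>l\<in>UNIV. fact (hp I l) :: complex)"
      by (rule prod.remove[symmetric]) auto
    then have "(\<Prod>l\<in>UNIV - {o1}. ?r l) = (of_bool (I = I) + of_bool (I = sw I)) / fact (hp I o1)"
      unfolding r prod_fact_hp by (simp add: pq field_simps)
    then show ?thesis unfolding eq b lam_def by (simp add: pq)
  next
    case False
    then have "\<not> (hp I = hp J \<and> hq I = hq J)" by (simp add: hp_hq_eq_iff)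
    then obtain l where "l \<noteq> o1" "\<not> (hp I l = hp J l \<and> hq I l = hq J l)"
      using eq_off_point[of "hp I" "hp J" o1] eq_off_point[of "hq I" "hq J" o1]
      by (auto simp: sum_hp sum_hq)
    then have "(\<Prod>l\<in>UNIV - {o1}. ?r l) = 0"
      by (intro prod_zero) (auto simp: r)
    then show ?thesis unfolding eq using False by simp
  qed
qed

text \<open>A degree count: the holomorphic degree 2 of \<open>J\<close> lies entirely off
  \<open>o1\<close>, but \<open>I\<close> has antiholomorphic degree only 1 to balance it. Some
  coordinate other than \<open>o1\<close> is then unbalanced, and its factor vanishes whatever the
  weight is.\<close>

lemma integral_h3_h3:
  assumes J: "hp J o1 = 0"
  shows "(\<integral>x. \<psi> (x $h o1) * (h3 I x * h3 J x) \<partial>gauss) = 0"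
proof -
  let ?r = "\<lambda>l. \<integral>z. herm (hp I l) (hq I l) z * herm (hp J l) (hq J l) z \<partial>cgauss"
  have eq: "(\<integral>x. \<psi> (x $h o1) * (h3 I x * h3 J x) \<partial>gauss)
      = (\<integral>z. \<psi> z * (herm (hp I o1) (hq I o1) z * herm (hp J o1) (hq J o1) z) \<partial>cgauss) * (\<Prod>l\<in>UNIV - {o1}. ?r l)"
    unfolding h3_times by (rule integral_weighted_prod[OF \<psi>]) (intro slow_intros)
  have "\<exists>l\<in>UNIV - {o1}. \<not> (hp J l = hq I l \<and> hq J l = hp I l)"
  proof (rule ccontr)
    assume "\<not> ?thesis"
    then have "(\<Sum>l\<in>UNIV - {o1}. hp J l) = (\<Sum>l\<in>UNIV - {o1}. hq I l)"
      by (intro sum.cong) auto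
    moreover have "(\<Sum>l\<in>UNIV - {o1}. hp J l) = 2"
      using sum_hp[of J] J by (simp add: sum.remove[of UNIV o1])
    moreover have "(\<Sum>l\<in>UNIV - {o1}. hq I l) \<le> 1"
      using sum_hq[of I] by (simp add: sum.remove[of UNIV o1])
    ultimately show False by simp
  qed
  then obtain l where l: "l \<noteq> o1" "\<not> (hp J l = hq I l \<and> hq J l = hp I l)" by blast
  have "?r l = 0" by (rule herm_orthogonal'[OF hq_le_1 hq_le_1 l(2)])
  then have "(\<Prod>l\<in>UNIV - {o1}. ?r l) = 0"
    using l(1) by (intro prod_zero) auto
  then show ?thesis unfolding eq by simp
qed

text \<open>For fixed \<open>I\<close> only \<open>J = I\<close> and \<open>J = sw I\<close>
  contribute, equally by the symmetry of \<open>b\<close>. When the two coincide the squared norm is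
  2, so the factor 2 is uniform.\<close>

lemma
  assumes b: "\<And>I. b (sw I) = b I"
  shows integrable_quad: "integrable gauss (\<lambda>x. \<psi> (x $h o1) * ((\<Sum>I\<in>UNIV. a I * h3 I x) * cnj (\<Sum>J\<in>UNIV. b J * h3 J x)))"
    and integral_quad: "(\<integral>x. \<psi> (x $h o1) * ((\<Sum>I\<in>UNIV. a I * h3 I x) * cnj (\<Sum>J\<in>UNIV. b J * h3 J x)) \<partial>gauss)
      = 2 * (\<Sum>I\<in>UNIV. a I * cnj (b I) * lam \<psi> (hp I o1) (hq I o1))"
proof -
  have e: "\<psi> (x $h o1) * ((\<Sum>I\<in>UNIV. a I * h3 I x) * cnj (\<Sum>J\<in>UNIV. b J * h3 J x))
      = (\<Sum>I\<in>UNIV. \<Sum>J\<in>UNIV. (a I * cnj (b J)) * (\<psi> (x $h o1) * (h3 I x * cnj (h3 J x))))" for x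
    by (unfold cnj_sum sum_product, unfold sum_distrib_left, intro sum.cong refl, simp only: complex_cnj_mult mult_ac)
  show "integrable gauss (\<lambda>x. \<psi> (x $h o1) * ((\<Sum>I\<in>UNIV. a I * h3 I x) * cnj (\<Sum>J\<in>UNIV. b J * h3 J x)))"
    unfolding e by (intro Bochner_Integration.integrable_sum integrable_mult_right integrable_h3_cnj)
  have "(\<integral>x. \<psi> (x $h o1) * ((\<Sum>I\<in>UNIV. a I * h3 I x) * cnj (\<Sum>J\<in>UNIV. b J * h3 J x)) \<partial>gauss)
      = (\<Sum>I\<in>UNIV. \<Sum>J\<in>UNIV. (a I * cnj (b J)) * ((of_bool (I = J) + of_bool (I = sw J)) * lam \<psi> (hp I o1) (hq I o1)))"
    unfolding e integral_h3_cnj[symmetric]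
    by (simp add: integrable_h3_cnj)
  also have "\<dots> = (\<Sum>I\<in>UNIV. 2 * (a I * cnj (b I) * lam \<psi> (hp I o1) (hq I o1)))"
  proof (rule sum.cong)
    fix I :: "'n \<times> 'n \<times> 'n"
    have *: "of_bool (I = sw J) = (of_bool (J = sw I) :: complex)" for J by auto
    show "(\<Sum>J\<in>UNIV. (a I * cnj (b J)) * ((of_bool (I = J) + of_bool (I = sw J)) * lam \<psi> (hp I o1) (hq I o1)))
       = 2 * (a I * cnj (b I) * lam \<psi> (hp I o1) (hq I o1))"
      unfolding * by (simp add: distrib_left distrib_right sum.distrib of_bool_def b if_distrib[of "\<lambda>x. x * _"] if_distrib[of "\<lambda>x. _ * x"] cong: if_cong)
  qed simp
  finally show "(\<integral>x. \<psi> (x $h o1) * ((\<Sum>I\<in>UNIV. a I * h3 I x) * cnj (\<Sum>J\<in>UNIV. b J * h3 J x)) \<partial>gauss)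
      = 2 * (\<Sum>I\<in>UNIV. a I * cnj (b I) * lam \<psi> (hp I o1) (hq I o1))"
    by (simp add: sum_distrib_left)
qed

lemma
  assumes b: "\<And>I. hp I o1 \<noteq> 0 \<Longrightarrow> b I = 0"
  shows integrable_quad': "integrable gauss (\<lambda>x. \<psi> (x $h o1) * ((\<Sum>I\<in>UNIV. a I * h3 I x) * (\<Sum>J\<in>UNIV. b J * h3 J x)))"
    and integral_quad': "(\<integral>x. \<psi> (x $h o1) * ((\<Sum>I\<in>UNIV. a I * h3 I x) * (\<Sum>J\<in>UNIV. b J * h3 J x)) \<partial>gauss) = 0"
proof -
  have e: "\<psi> (x $h o1) * ((\<Sum>I\<in>UNIV. a I * h3 I x) * (\<Sum>J\<in>UNIV. b J * h3 J x))
      = (\<Sum>I\<in>UNIV. \<Sum>J\<in>UNIV. (a I * b J) * (\<psi> (x $h o1) * (h3 I x * h3 J x)))" for x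
    by (unfold cnj_sum sum_product, unfold sum_distrib_left, intro sum.cong refl, simp only: complex_cnj_mult mult_ac)
  show "integrable gauss (\<lambda>x. \<psi> (x $h o1) * ((\<Sum>I\<in>UNIV. a I * h3 I x) * (\<Sum>J\<in>UNIV. b J * h3 J x)))"
    unfolding e by (intro Bochner_Integration.integrable_sum integrable_mult_right integrable_h3_h3)
  have z: "(a I * b J) * (\<integral>x. \<psi> (x $h o1) * (h3 I x * h3 J x) \<partial>gauss) = 0" for I J
    using b[of J] integral_h3_h3[of J I] by (cases "hp J o1 = 0") auto
  have "(\<integral>x. \<psi> (x $h o1) * ((\<Sum>I\<in>UNIV. a I * h3 I x) * (\<Sum>J\<in>UNIV. b J * h3 J x)) \<partial>gauss)
      = (\<Sum>I\<in>UNIV. \<Sum>J\<in>UNIV. (a I * b J) * (\<integral>x. \<psi> (x $h o1) * (h3 I x * h3 J x) \<partial>gauss))"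
    unfolding e by (simp add: integrable_h3_h3)
  then show "(\<integral>x. \<psi> (x $h o1) * ((\<Sum>I\<in>UNIV. a I * h3 I x) * (\<Sum>J\<in>UNIV. b J * h3 J x)) \<partial>gauss) = 0"
    by (simp only: z sum.neutral_const)
qed

end

text \<open>The squared modulus of \<open>herm p q z\<close> as a function of t = |z|^2; see
  \<open>herm_norm_sq\<close>.\<close>

definition hn :: "nat \<Rightarrow> nat \<Rightarrow> real \<Rightarrow> real" where
  "hn p q t = (if q = 0 then t ^ p else if p = 0 then t else t ^ (p - 1) * (t - of_nat p)\<^sup>2)"

lemma herm_norm_sq: "q \<le> 1 \<Longrightarrow> herm p q z * cnj (herm p q z) = of_real (hn p q ((cmod z)\<^sup>2))"
proof -
  assume "q \<le> 1"
  define t where "t = complex_of_real ((cmod z)\<^sup>2)"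
  have t: "z * cnj z = t" unfolding t_def by (rule complex_norm_square[symmetric])
  have tp: "z ^ k * cnj z ^ k = t ^ k" for k by (simp add: power_mult_distrib[symmetric] t)
  show ?thesis
  proof (cases "q = 0")
    case True
    then show ?thesis by (simp add: herm_def hn_def tp t_def)
  next
    case q: False
    show ?thesis
    proof (cases p)
      case 0
      then show ?thesis using q t by (simp add: herm_def hn_def t_def mult.commute)
    next
      case (Suc m)
      have "herm p q z = z ^ m * (t - of_nat p)"
        using q by (simp add: herm_def Suc t[symmetric] algebra_simps)
      then have "herm p q z * cnj (herm p q z) = (z ^ m * cnj z ^ m) * ((t - of_nat p) * cnj (t - of_nat p))"
        by simp
      also have "cnj (t - of_nat p) = t - of_nat p" by (simp add: t_def)
      finally show ?thesis using q Suc by (simp add: tp hn_def t_def power2_eq_square)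
    qed
  qed
qed

lemma lam_radial:
  assumes "v \<in> borel_measurable borel" "q \<le> 1"
  shows "lam (\<lambda>z. complex_of_real (v ((cmod z)\<^sup>2))) p q = complex_of_real ((\<integral>t. v t * hn p q t \<partial>exp1) / fact p)"
proof -
  have [measurable]: "v \<in> borel_measurable borel" "hn p q \<in> borel_measurable borel"
    using assms(1) by (auto simp: hn_def[abs_def])
  have "(\<integral>z. complex_of_real (v ((cmod z)\<^sup>2)) * (herm p q z * cnj (herm p q z)) \<partial>cgauss)
      = (\<integral>z. complex_of_real (v ((cmod z)\<^sup>2) * hn p q ((cmod z)\<^sup>2)) \<partial>cgauss)"
    by (simp add: herm_norm_sq[OF assms(2)])
  also have "\<dots> = complex_of_real (\<integral>z. v ((cmod z)\<^sup>2) * hn p q ((cmod z)\<^sup>2) \<partial>cgauss)"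
    by (rule integral_complex_of_real)
  also have "(\<integral>z. v ((cmod z)\<^sup>2) * hn p q ((cmod z)\<^sup>2) \<partial>cgauss) = (\<integral>t. v t * hn p q t \<partial>exp1)"
    by (rule integral_cgauss_radial(1)[of "\<lambda>t. v t * hn p q t"]) simp
  finally show ?thesis by (simp add: lam_def)
qed

section \<open>The bound on scalar functions\<close>

definition coef :: "(complex^'n::finite \<Rightarrow> complex) \<Rightarrow> 'n \<times> 'n \<times> 'n \<Rightarrow> complex" where
  "coef f I = (\<integral>x. f x * cnj (h3 I x) \<partial>gauss)"

definition lin :: "(complex^'n::finite \<Rightarrow> complex) \<Rightarrow> 'n \<Rightarrow> complex" where
  "lin f l = (\<integral>x. f x * cnj (x $h l) \<partial>gauss)"

text \<open>The phase of a complex number. The value 1 at zero keeps the modulus equal to one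
  everywhere.\<close>

definition uph :: "complex \<Rightarrow> complex" where
  "uph z = (if z = 0 then 1 else z / of_real (cmod z))"

lemma uph_measurable[measurable]: "uph \<in> borel_measurable borel"
  unfolding uph_def[abs_def] by simp

lemma cmod_uph[simp]: "cmod (uph z) = 1"
  by (simp add: uph_def norm_divide)

lemma uph_times_cmod: "of_real (cmod z) * uph z = z"
  by (simp add: uph_def)

lemma integrable_gauss_coord:
  fixes F :: "complex \<Rightarrow> 'b::{real_normed_field,banach,second_countable_topology}" and o1 :: "'n::finite"
  assumes F: "integrable cgauss F"
  shows "integrable gauss (\<lambda>x. F (x $h o1))" "(\<integral>x. F (x $h o1) \<partial>gauss) = (\<integral>z. F z \<partial>cgauss)"
proof -
  have i: "integrable cgauss (if l = o1 then F else (\<lambda>_. 1))" for l using F by simp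
  have e: "(\<Prod>l\<in>UNIV. (if l = o1 then F else (\<lambda>_. 1)) (x $h l)) = F (x $h o1)" for x :: "complex^'n"
    by (simp add: prod.delta if_distrib[of "\<lambda>f. f _"] cong: if_cong)
  show "integrable gauss (\<lambda>x. F (x $h o1))"
    using integrable_gauss_prod[of "\<lambda>l. if l = o1 then F else (\<lambda>_. 1)", OF i] unfolding e .
  have "(\<integral>x. F (x $h o1) \<partial>gauss) = (\<Prod>l\<in>UNIV. \<integral>z. (if l = o1 then F else (\<lambda>_. 1)) z \<partial>cgauss)"
    using integral_gauss_prod[of "\<lambda>l. if l = o1 then F else (\<lambda>_. 1)", OF i] unfolding e .
  also have "\<dots> = (\<Prod>l\<in>UNIV. if l = o1 then \<integral>z. F z \<partial>cgauss else 1)"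
    by (intro prod.cong refl) (simp add: cgauss.prob_space[simplified])
  finally show "(\<integral>x. F (x $h o1) \<partial>gauss) = (\<integral>z. F z \<partial>cgauss)"
    by (simp add: prod.delta)
qed

lemma integrable_h3: "integrable gauss (h3 I)"
  unfolding h3_def[abs_def] by (rule integrable_gauss_prod) (intro slow_integrable slow_intros)

lemma integrable_coord: "integrable gauss (\<lambda>x. x $h l)"
  by (rule integrable_gauss_coord(1)) (intro slow_integrable slow_intros)

lemma integrable_bounded_mult_cnj:
  fixes f h :: "complex^'n::finite \<Rightarrow> complex"
  assumes "f \<in> borel_measurable borel" "\<And>x. cmod (f x) \<le> B" and h: "integrable gauss h"
  shows "integrable gauss (\<lambda>x. f x * cnj (h x))"
proof (rule Bochner_Integration.integrable_bound)
  have [measurable]: "h \<in> borel_measurable borel" using borel_measurable_integrable[OF h] by simp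
  note assms(1)[measurable]
  show "(\<lambda>x. f x * cnj (h x)) \<in> borel_measurable gauss" by simp
  show "integrable gauss (\<lambda>x. B * norm (h x))" using h by simp
  show "AE x in gauss. norm (f x * cnj (h x)) \<le> norm (B * norm (h x))"
  proof (intro AE_I2)
    fix x
    have "0 \<le> B" using order_trans[OF norm_ge_zero assms(2)[of x]] .
    then show "norm (f x * cnj (h x)) \<le> norm (B * norm (h x))"
      using assms(2)[of x] by (simp add: norm_mult mult_right_mono)
  qed
qed

lemmas integrable_coef = integrable_bounded_mult_cnj[OF _ _ integrable_h3]
lemmas integrable_lin = integrable_bounded_mult_cnj[OF _ _ integrable_coord]

lemma h3_sw: "h3 (sw I) = h3 I"
  by (simp add: h3_def[abs_def] hp_sw hq_sw)

lemma coef_sw: "coef f (sw I) = coef f I"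
  by (simp add: coef_def h3_sw)

lemma Re_times_cnj: "Re (u * cnj v) = Re u * Re v + Im u * Im v"
  by simp

lemma weighted_AM_GM:
  fixes a b v d :: real assumes "0 < v" "0 < d"
  shows "a * b \<le> (1 / (2 * d)) * (a\<^sup>2 / v) + (d / 2) * (v * b\<^sup>2)"
proof -
  have "0 \<le> (a - d * v * b)\<^sup>2 / (2 * d * v)" using assms by simp
  also have "\<dots> = (1 / (2 * d)) * (a\<^sup>2 / v) + (d / 2) * (v * b\<^sup>2) - a * b"
    using assms by (simp add: power2_eq_square field_simps)
  finally show ?thesis by simp
qed

text \<open>Test \<open>q\<close> against its own cubic part \<open>G\<close> and split into the components along and across the phase
  of the distinguished coordinate. The part \<open>G0\<close> of \<open>G\<close> free of that coordinate only sees the average of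
  the two weights, because the products \<open>G * G0\<close> and \<open>G0 * G0\<close>, taken without conjugation, have weighted integral zero.\<close>

lemma cubic_part_bound:
  fixes q :: "complex^'n::finite \<Rightarrow> complex" and o1 :: 'n and vx vy :: "real \<Rightarrow> real"
  assumes q: "q \<in> borel_measurable borel" "\<And>x. cmod (q x) \<le> Bq"
    and v[measurable]: "vx \<in> borel_measurable borel" "vy \<in> borel_measurable borel"
    and pos: "0 < \<epsilon>" "0 < d"
    and bounds: "\<And>t. \<epsilon> \<le> vx t" "\<And>t. vx t \<le> vy t" "\<And>t. vy t \<le> B"
    and cond: "\<And>p r. p \<le> 2 \<Longrightarrow> r \<le> 1 \<Longrightarrow> p \<noteq> 0 \<or> r \<noteq> 0 \<Longrightarrow> d * ((\<integral>t. vy t * hn p r t \<partial>exp1) / fact p) \<le> 1"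
    and cond0: "d * (\<integral>t. (vx t + vy t) / 2 \<partial>exp1) \<le> 1"
  shows "d * ((\<Sum>I\<in>UNIV. (cmod (coef q I))\<^sup>2) / 2)
    \<le> (\<integral>x. (Re (q x * cnj (uph (x $h o1))))\<^sup>2 / vx ((cmod (x $h o1))\<^sup>2) + (Im (q x * cnj (uph (x $h o1))))\<^sup>2 / vy ((cmod (x $h o1))\<^sup>2) \<partial>gauss)"
proof -
  note q(1)[measurable]
  define c where "c = coef q"
  have csw: "c (sw I) = c I" for I by (simp add: c_def coef_sw)
  define b where "b I = (if hp I o1 = 0 \<and> hq I o1 = 0 then c I / 2 else 0)" for I
  have bsw: "b (sw I) = b I" for I by (simp add: b_def csw hp_sw hq_sw)
  have c2sw: "c (sw I) / 2 = c I / 2" for I by (simp add: csw)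
  have b0: "hp I o1 \<noteq> 0 \<Longrightarrow> b I = 0" for I by (simp add: b_def)
  define G where "G x = (\<Sum>I\<in>UNIV. (c I / 2) * h3 I x)" for x
  define G0 where "G0 x = (\<Sum>I\<in>UNIV. b I * h3 I x)" for x
  define g2 where "g2 = (\<Sum>I\<in>UNIV. (cmod (c I))\<^sup>2) / 2"
  define t where "t x = (cmod (x $h o1))\<^sup>2" for x :: "complex^'n"
  define e where "e x = uph (x $h o1)" for x :: "complex^'n"
  define u where "u s = vy s - vx s" for s
  have [measurable]: "u \<in> borel_measurable borel" "t \<in> borel_measurable borel" "e \<in> borel_measurable borel"
    "G \<in> borel_measurable borel" "G0 \<in> borel_measurable borel"
    by (simp_all add: u_def[abs_def] t_def[abs_def] e_def[abs_def] G_def[abs_def] G0_def[abs_def])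
  have u: "0 \<le> u s" "u s \<le> B" for s
    using bounds(1)[of s] bounds(2)[of s] bounds(3)[of s] pos by (auto simp: u_def)
  have vpos: "0 < vx s" "0 < vy s" for s
    using bounds(1)[of s] bounds(2)[of s] pos by auto
  have qG: "integrable gauss (\<lambda>x. q x * cnj (G x))" "(\<integral>x. q x * cnj (G x) \<partial>gauss) = of_real g2"
  proof -
    have e: "q x * cnj (G x) = (\<Sum>I\<in>UNIV. (cnj (c I) / 2) * (q x * cnj (h3 I x)))" for x
      unfolding G_def cnj_sum sum_distrib_left by (intro sum.cong refl) simp
    note i = integrable_coef[OF q]
    show "integrable gauss (\<lambda>x. q x * cnj (G x))"
      unfolding e by (intro Bochner_Integration.integrable_sum integrable_mult_right i)
    have "(\<integral>x. q x * cnj (G x) \<partial>gauss) = (\<Sum>I\<in>UNIV. (cnj (c I) / 2) * c I)"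
      unfolding e by (simp add: i c_def coef_def[of q])
    also have "\<dots> = of_real g2"
      unfolding g2_def of_real_sum of_real_divide sum_divide_distrib complex_norm_square
      by (intro sum.cong refl) (simp add: mult.commute)
    finally show "(\<integral>x. q x * cnj (G x) \<partial>gauss) = of_real g2" .
  qed
  define \<psi>1 where "\<psi>1 z = complex_of_real (vy ((cmod z)\<^sup>2))" for z
  define \<psi>2 where "\<psi>2 z = complex_of_real (u ((cmod z)\<^sup>2))" for z
  \<comment> \<open>The squared phase makes \<open>\<psi>2\<close> and \<open>\<psi>3\<close>
    combine through Re(A cnj B) + Re(A B) = 2 Re A Re B, with A and B the values of \<open>G\<close>
    and \<open>G0\<close> rotated by the phase of the distinguished coordinate.\<close>
  define \<psi>3 where "\<psi>3 z = complex_of_real (u ((cmod z)\<^sup>2)) * (cnj (uph z))\<^sup>2" for z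
  have m1: "\<psi>1 \<in> borel_measurable borel" and m2: "\<psi>2 \<in> borel_measurable borel" and m3: "\<psi>3 \<in> borel_measurable borel"
    by (simp_all add: \<psi>1_def[abs_def] \<psi>2_def[abs_def] \<psi>3_def[abs_def])
  have B1: "cmod (\<psi>1 z) \<le> B" for z using vpos(2) bounds(3) by (simp add: \<psi>1_def less_imp_le)
  have B2: "cmod (\<psi>2 z) \<le> B" for z using u by (simp add: \<psi>2_def)
  have B3: "cmod (\<psi>3 z) \<le> B" for z using u by (simp add: \<psi>3_def norm_mult norm_power)
  define X1 where "X1 x = \<psi>1 (x $h o1) * (G x * cnj (G x))" for x
  define X2 where "X2 x = \<psi>2 (x $h o1) * (G x * cnj (G0 x))" for x
  define X3 where "X3 x = \<psi>3 (x $h o1) * (G x * G0 x)" for x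
  define X4 where "X4 x = \<psi>2 (x $h o1) * (G0 x * cnj (G0 x))" for x
  define X5 where "X5 x = \<psi>3 (x $h o1) * (G0 x * G0 x)" for x
  have X1: "integrable gauss X1" "integral\<^sup>L gauss X1 = 2 * (\<Sum>I\<in>UNIV. (c I / 2) * cnj (c I / 2) * lam \<psi>1 (hp I o1) (hq I o1))"
    unfolding X1_def G_def by (rule integrable_quad[where b="\<lambda>I. c I / 2", OF m1 B1 c2sw], rule integral_quad[where b="\<lambda>I. c I / 2", OF m1 B1 c2sw])
  have X2: "integrable gauss X2" "integral\<^sup>L gauss X2 = 2 * (\<Sum>I\<in>UNIV. (c I / 2) * cnj (b I) * lam \<psi>2 (hp I o1) (hq I o1))"
    unfolding X2_def G_def G0_def by (rule integrable_quad[where b=b, OF m2 B2 bsw], rule integral_quad[where b=b, OF m2 B2 bsw])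
  have X3: "integrable gauss X3" "integral\<^sup>L gauss X3 = 0"
    unfolding X3_def G_def G0_def by (rule integrable_quad'[where b=b, OF m3 B3 b0], assumption, rule integral_quad'[where b=b, OF m3 B3 b0], assumption)
  have X4: "integrable gauss X4" "integral\<^sup>L gauss X4 = 2 * (\<Sum>I\<in>UNIV. b I * cnj (b I) * lam \<psi>2 (hp I o1) (hq I o1))"
    unfolding X4_def G0_def by (rule integrable_quad[where b=b, OF m2 B2 bsw], rule integral_quad[where b=b, OF m2 B2 bsw])
  have X5: "integrable gauss X5" "integral\<^sup>L gauss X5 = 0"
    unfolding X5_def G0_def by (rule integrable_quad'[where b=b, OF m3 B3 b0], assumption, rule integral_quad'[where b=b, OF m3 B3 b0], assumption)
  \<comment> \<open>With \<open>Gx\<close>, \<open>Gy\<close>, \<open>Hx\<close> as in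
    \<open>pt\<close> below, vx Gx^2 + vy Gy^2 = vy |G|^2 - u Gx^2, and - u Gx^2 <= - 2 u Gx Hx + u
    Hx^2. The resulting upper bound is the real part of \<open>X\<close>. Its integral is diagonal
    in the coefficients, and those free of the coordinate \<open>o1\<close> carry the mean of (vx +
    vy) / 2 instead of the mean of vy.\<close>
  define X where "X x = X1 x - X2 x - X3 x + (X4 x + X5 x) / 2" for x
  have Xint: "integrable gauss X"
    unfolding X_def using X1(1) X2(1) X3(1) X4(1) X5(1) by simp
  have Xval: "Re (integral\<^sup>L gauss X) \<le> g2 / d"
  proof -
    have l1: "lam \<psi>1 (hp I o1) (hq I o1) = of_real ((\<integral>s. vy s * hn (hp I o1) (hq I o1) s \<partial>exp1) / fact (hp I o1))" for I
      unfolding \<psi>1_def[abs_def] by (rule lam_radial) (auto simp: hq_le_1[simplified])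
    have l2: "lam \<psi>2 0 0 = of_real (\<integral>s. u s \<partial>exp1)"
      unfolding \<psi>2_def[abs_def] by (subst lam_radial) (auto simp: hn_def)
    have "integral\<^sup>L gauss X = integral\<^sup>L gauss X1 - integral\<^sup>L gauss X2 - integral\<^sup>L gauss X3 + (integral\<^sup>L gauss X4 + integral\<^sup>L gauss X5) / 2"
      unfolding X_def using X1(1) X2(1) X3(1) X4(1) X5(1) by simp
    also have "\<dots> = (\<Sum>I\<in>UNIV. 2 * ((c I / 2) * cnj (c I / 2) * lam \<psi>1 (hp I o1) (hq I o1))
        - 2 * ((c I / 2) * cnj (b I) * lam \<psi>2 (hp I o1) (hq I o1)) + b I * cnj (b I) * lam \<psi>2 (hp I o1) (hq I o1))"
      unfolding X1(2) X2(2) X3(2) X4(2) X5(2)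
      by (simp only: sum.distrib sum_subtractf sum_distrib_left[symmetric]) simp
    also have "\<dots> = (\<Sum>I\<in>UNIV. of_real ((cmod (c I))\<^sup>2 / 2) * (lam \<psi>1 (hp I o1) (hq I o1)
        - (if hp I o1 = 0 \<and> hq I o1 = 0 then lam \<psi>2 0 0 / 2 else 0)))"
    proof (intro sum.cong refl)
      fix I
      have n: "of_real ((cmod (c I))\<^sup>2 / 2) = c I * cnj (c I) / 2"
        by (simp only: of_real_divide complex_norm_square of_real_numeral)
      show "2 * ((c I / 2) * cnj (c I / 2) * lam \<psi>1 (hp I o1) (hq I o1))
        - 2 * ((c I / 2) * cnj (b I) * lam \<psi>2 (hp I o1) (hq I o1)) + b I * cnj (b I) * lam \<psi>2 (hp I o1) (hq I o1)
        = of_real ((cmod (c I))\<^sup>2 / 2) * (lam \<psi>1 (hp I o1) (hq I o1)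
        - (if hp I o1 = 0 \<and> hq I o1 = 0 then lam \<psi>2 0 0 / 2 else 0))"
        unfolding n by (simp add: b_def algebra_simps)
    qed
    also have "Re \<dots> = (\<Sum>I\<in>UNIV. ((cmod (c I))\<^sup>2 / 2) * ((\<integral>s. vy s * hn (hp I o1) (hq I o1) s \<partial>exp1) / fact (hp I o1)
        - (if hp I o1 = 0 \<and> hq I o1 = 0 then (\<integral>s. u s \<partial>exp1) / 2 else 0)))"
      unfolding l1 l2 Re_sum by (intro sum.cong refl) (simp add: Re_divide_of_nat del: of_real_divide of_real_power)
    also have "\<dots> \<le> (\<Sum>I\<in>UNIV. ((cmod (c I))\<^sup>2 / 2) * (1 / d))"
    proof (intro sum_mono mult_left_mono)
      fix I :: "'n \<times> 'n \<times> 'n"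
      have hple: "hp I o1 \<le> 2" by (cases I) auto
      show "(\<integral>s. vy s * hn (hp I o1) (hq I o1) s \<partial>exp1) / fact (hp I o1)
        - (if hp I o1 = 0 \<and> hq I o1 = 0 then (\<integral>s. u s \<partial>exp1) / 2 else 0) \<le> 1 / d"
      proof (cases "hp I o1 = 0 \<and> hq I o1 = 0")
        case False
        then show ?thesis using cond[OF hple hq_le_1[of I o1]] pos(2) by (auto simp: field_simps)
      next
        case True
        interpret E: prob_space exp1 by (rule prob_space_exp1)
        have i: "integrable exp1 vx" "integrable exp1 vy"
          by (rule E.integrable_const_bound[of _ B]; use vpos bounds in \<open>auto intro!: AE_I2 simp: less_imp_le order_trans[OF bounds(2) bounds(3)]\<close>)+
        have "(\<integral>s. vy s * hn (hp I o1) (hq I o1) s \<partial>exp1) / fact (hp I o1) - (\<integral>s. u s \<partial>exp1) / 2 = (\<integral>s. (vx s + vy s) / 2 \<partial>exp1)"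
          using True i by (simp add: hn_def u_def add_divide_distrib diff_divide_distrib)
        moreover have "(\<integral>s. (vx s + vy s) / 2 \<partial>exp1) \<le> 1 / d"
          unfolding pos_le_divide_eq[OF pos(2)] using cond0 by (simp only: mult.commute)
        ultimately show ?thesis unfolding if_P[OF True] by (simp only:)
      qed
    qed simp
    also have "\<dots> = g2 / d" by (simp add: g2_def sum_divide_distrib)
    finally show ?thesis .
  qed
  define Q where "Q x = (Re (q x * cnj (e x)))\<^sup>2 / vx (t x) + (Im (q x * cnj (e x)))\<^sup>2 / vy (t x)" for x
  have Qint: "integrable gauss Q"
  proof (rule gauss.integrable_const_bound[of _ "2 * (Bq\<^sup>2 / \<epsilon>)"], intro AE_I2)
    fix x
    have n: "cmod (q x * cnj (e x)) \<le> Bq" using q(2) by (simp add: norm_mult e_def)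
    have r: "(Re (q x * cnj (e x)))\<^sup>2 \<le> Bq\<^sup>2" "(Im (q x * cnj (e x)))\<^sup>2 \<le> Bq\<^sup>2"
      using order_trans[OF abs_Re_le_cmod n] order_trans[OF abs_Im_le_cmod n]
      by (metis abs_ge_zero power2_abs power_mono)+
    have "(Re (q x * cnj (e x)))\<^sup>2 / vx (t x) \<le> Bq\<^sup>2 / \<epsilon>"
      by (rule frac_le) (use r bounds(1) pos vpos in auto)
    moreover have "(Im (q x * cnj (e x)))\<^sup>2 / vy (t x) \<le> Bq\<^sup>2 / \<epsilon>"
      by (rule frac_le) (use r order_trans[OF bounds(1) bounds(2)] pos vpos in auto)
    moreover have "0 \<le> Q x" unfolding Q_def using vpos[of "t x"] by simp
    ultimately show "norm (Q x) \<le> 2 * (Bq\<^sup>2 / \<epsilon>)" by (simp add: Q_def)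
  qed (simp add: Q_def[abs_def])
  have pt: "Re (q x * cnj (G x)) \<le> (1 / (2 * d)) * Q x + (d / 2) * Re (X x)" for x
  proof -
    define Gx where "Gx = Re (G x * cnj (e x))"
    define Gy where "Gy = Im (G x * cnj (e x))"
    define Hx where "Hx = Re (G0 x * cnj (e x))"
    have ee: "cnj (e x) * e x = 1"
      using complex_norm_square[of "e x"] by (simp add: e_def mult.commute)
    have "(q x * cnj (e x)) * cnj (G x * cnj (e x)) = q x * cnj (G x) * (cnj (e x) * e x)"
      by (simp add: algebra_simps)
    then have "q x * cnj (G x) = (q x * cnj (e x)) * cnj (G x * cnj (e x))"
      unfolding ee by simp
    then have "Re (q x * cnj (G x)) = Re (q x * cnj (e x)) * Gx + Im (q x * cnj (e x)) * Gy"
      by (simp only: Gx_def Gy_def Re_times_cnj)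
    also have "\<dots> \<le> ((1 / (2 * d)) * ((Re (q x * cnj (e x)))\<^sup>2 / vx (t x)) + (d / 2) * (vx (t x) * Gx\<^sup>2))
       + ((1 / (2 * d)) * ((Im (q x * cnj (e x)))\<^sup>2 / vy (t x)) + (d / 2) * (vy (t x) * Gy\<^sup>2))"
      by (intro add_mono weighted_AM_GM vpos pos)
    also have "\<dots> = (1 / (2 * d)) * Q x + (d / 2) * (vx (t x) * Gx\<^sup>2 + vy (t x) * Gy\<^sup>2)"
      by (simp add: Q_def algebra_simps)
    also have "vx (t x) * Gx\<^sup>2 + vy (t x) * Gy\<^sup>2 \<le> Re (X x)"
    proof -
      have r1: "Re (X1 x) = vy (t x) * (Gx\<^sup>2 + Gy\<^sup>2)"
      proof -
        have "Gx\<^sup>2 + Gy\<^sup>2 = (cmod (G x * cnj (e x)))\<^sup>2" by (simp only: Gx_def Gy_def cmod_power2)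
        also have "\<dots> = (cmod (G x))\<^sup>2" by (simp add: norm_mult e_def)
        finally have "of_real (Gx\<^sup>2 + Gy\<^sup>2) = G x * cnj (G x)" by (simp only: complex_norm_square)
        then have "X1 x = of_real (vy (t x) * (Gx\<^sup>2 + Gy\<^sup>2))"
          by (simp only: X1_def \<psi>1_def t_def of_real_mult)
        then show ?thesis by (simp only: Re_complex_of_real)
      qed
      have r23: "Re (X2 x) + Re (X3 x) = 2 * u (t x) * (Gx * Hx)"
      proof -
        have "X2 x + X3 x = of_real (u (t x)) * (G x * (cnj (e x) * e x) * cnj (G0 x) + (G x * cnj (e x)) * (G0 x * cnj (e x)))"
          unfolding ee by (simp add: X2_def X3_def \<psi>2_def \<psi>3_def t_def e_def power2_eq_square algebra_simps)
        also have "G x * (cnj (e x) * e x) * cnj (G0 x) + (G x * cnj (e x)) * (G0 x * cnj (e x))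
           = (G x * cnj (e x)) * (cnj (G0 x * cnj (e x)) + G0 x * cnj (e x))"
          by (simp add: algebra_simps)
        also have "cnj (G0 x * cnj (e x)) + G0 x * cnj (e x) = of_real (2 * Hx)"
          by (simp add: Hx_def complex_eq_iff)
        finally have "X2 x + X3 x = of_real (u (t x)) * ((G x * cnj (e x)) * of_real (2 * Hx))" .
        then have "Re (X2 x + X3 x) = u (t x) * (Gx * (2 * Hx))" by (simp add: Gx_def)
        then show ?thesis by simp
      qed
      have r45: "Re (X4 x) + Re (X5 x) = 2 * u (t x) * (Hx * Hx)"
      proof -
        have "X4 x + X5 x = of_real (u (t x)) * (G0 x * (cnj (e x) * e x) * cnj (G0 x) + (G0 x * cnj (e x)) * (G0 x * cnj (e x)))"
          unfolding ee by (simp add: X4_def X5_def \<psi>2_def \<psi>3_def t_def e_def power2_eq_square algebra_simps)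
        also have "G0 x * (cnj (e x) * e x) * cnj (G0 x) + (G0 x * cnj (e x)) * (G0 x * cnj (e x))
           = (G0 x * cnj (e x)) * (cnj (G0 x * cnj (e x)) + G0 x * cnj (e x))"
          by (simp add: algebra_simps)
        also have "cnj (G0 x * cnj (e x)) + G0 x * cnj (e x) = of_real (2 * Hx)"
          by (simp add: Hx_def complex_eq_iff)
        finally have "X4 x + X5 x = of_real (u (t x)) * ((G0 x * cnj (e x)) * of_real (2 * Hx))" .
        then have "Re (X4 x + X5 x) = u (t x) * (Hx * (2 * Hx))" by (simp add: Hx_def)
        then show ?thesis by simp
      qed
      have "Re (X x) = vy (t x) * (Gx\<^sup>2 + Gy\<^sup>2) - 2 * u (t x) * (Gx * Hx) + u (t x) * (Hx * Hx)"
        using r1 r23 r45 by (simp add: X_def)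
      also have "\<dots> = vx (t x) * Gx\<^sup>2 + vy (t x) * Gy\<^sup>2 + u (t x) * (Gx - Hx)\<^sup>2"
        by (simp add: u_def power2_eq_square algebra_simps)
      finally show ?thesis using u(1)[of "t x"] by simp
    qed
    finally show ?thesis using pos by simp
  qed
  have "g2 = Re (\<integral>x. q x * cnj (G x) \<partial>gauss)" by (simp add: qG(2))
  also have "\<dots> = (\<integral>x. Re (q x * cnj (G x)) \<partial>gauss)"
    using integral_Re[OF qG(1)] by simp
  also have "\<dots> \<le> (\<integral>x. (1 / (2 * d)) * Q x + (d / 2) * Re (X x) \<partial>gauss)"
  proof (rule integral_mono)
    show "integrable gauss (\<lambda>x. Re (q x * cnj (G x)))" by (rule integrable_Re[OF qG(1)])
    show "integrable gauss (\<lambda>x. (1 / (2 * d)) * Q x + (d / 2) * Re (X x))"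
      using Qint integrable_Re[OF Xint] by simp
  qed (rule pt)
  also have "\<dots> = (1 / (2 * d)) * (\<integral>x. Q x \<partial>gauss) + (d / 2) * Re (integral\<^sup>L gauss X)"
    using Qint Xint integral_Re[OF Xint] by simp
  also have "\<dots> \<le> (1 / (2 * d)) * (\<integral>x. Q x \<partial>gauss) + (d / 2) * (g2 / d)"
    using Xval pos by (intro add_left_mono mult_left_mono) auto
  \<comment> \<open>Since \<open>Xval\<close> bounds the quadratic form of the cubic part by
    \<open>g2 / d\<close>, half of \<open>g2\<close> reappears on the right and is absorbed.\<close>
  finally have "g2 \<le> (1 / (2 * d)) * (\<integral>x. Q x \<partial>gauss) + g2 / 2" using pos by simp
  then have "d * g2 \<le> (\<integral>x. Q x \<partial>gauss)" using pos by (simp add: field_simps)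
  then show ?thesis by (simp add: g2_def c_def Q_def[abs_def] t_def e_def)
qed

text \<open>Rotated by \<open>e\<close>, let p = a + i b and q = c + i s. Unimodularity of f and g
  means a^2 + b^2 + c^2 + s^2 = 1 and a c = - b s, whence a^2 = (a^2 + b^2) (a^2 + s^2). AM-GM with
  weights \<open>w\<close> and k = A^2 / (4 w), whose product is A^2 / 4, then bounds A a. After
  substituting the first constraint, c^2 appears with coefficient w + k, so this is the room
  available for \<open>wx\<close>.\<close>

lemma pair_inequality:
  fixes f g e :: complex and A w wx :: real
  assumes f: "cmod f = 1" and g: "cmod g = 1" and e: "cmod e = 1" and w: "0 < w" and wx: "wx \<le> w + A\<^sup>2 / (4 * w)"
  shows "A * Re ((f + g) / 2 * cnj e) + wx * (Re ((f - g) / 2 * cnj e))\<^sup>2 + w * (Im ((f - g) / 2 * cnj e))\<^sup>2 \<le> w + A\<^sup>2 / (4 * w)"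
proof -
  define F where "F = f * cnj e"
  define H where "H = g * cnj e"
  have F: "(Re F)\<^sup>2 + (Im F)\<^sup>2 = 1" and H: "(Re H)\<^sup>2 + (Im H)\<^sup>2 = 1"
    using f g e cmod_power2[of F] cmod_power2[of H] by (simp_all add: F_def[THEN arg_cong[of _ _ cmod]] H_def[THEN arg_cong[of _ _ cmod]] norm_mult)
  define a b c s where "a = (Re F + Re H) / 2" and "b = (Im F + Im H) / 2" and "c = (Re F - Re H) / 2" and "s = (Im F - Im H) / 2"
  have 1: "a\<^sup>2 + b\<^sup>2 + c\<^sup>2 + s\<^sup>2 = 1"
    using F H unfolding a_def b_def c_def s_def by (simp add: power2_eq_square field_simps)
  have 2: "a * c = - (b * s)"
    using F H unfolding a_def b_def c_def s_def by (simp add: power2_eq_square field_simps)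
  define k where "k = A\<^sup>2 / (4 * w)"
  have k: "0 \<le> k" using w by (simp add: k_def)
  have wk: "4 * w * k = A\<^sup>2" using w by (simp add: k_def)
  have key: "a\<^sup>2 = (a\<^sup>2 + b\<^sup>2) * (a\<^sup>2 + s\<^sup>2)"
  proof -
    have "(a\<^sup>2 + b\<^sup>2) * (a\<^sup>2 + s\<^sup>2) = a\<^sup>2 * (a\<^sup>2 + b\<^sup>2 + s\<^sup>2) + (b * s)\<^sup>2"
      by (simp add: power2_eq_square algebra_simps)
    also have "(b * s)\<^sup>2 = (a * c)\<^sup>2" by (simp add: 2)
    also have "a\<^sup>2 * (a\<^sup>2 + b\<^sup>2 + s\<^sup>2) + (a * c)\<^sup>2 = a\<^sup>2 * (a\<^sup>2 + b\<^sup>2 + c\<^sup>2 + s\<^sup>2)"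
      by (simp add: power2_eq_square algebra_simps)
    finally show ?thesis using 1 by simp
  qed
  have "A * a \<le> w * (a\<^sup>2 + b\<^sup>2) + k * (a\<^sup>2 + s\<^sup>2)" (is "_ \<le> ?T")
  proof -
    have T: "0 \<le> ?T" using w k by simp
    have "(A * a)\<^sup>2 = (4 * w * k) * ((a\<^sup>2 + b\<^sup>2) * (a\<^sup>2 + s\<^sup>2))"
      by (simp only: power_mult_distrib wk flip: key)
    also have "\<dots> = ?T\<^sup>2 - (w * (a\<^sup>2 + b\<^sup>2) - k * (a\<^sup>2 + s\<^sup>2))\<^sup>2"
      by (simp add: power2_eq_square algebra_simps)
    also have "\<dots> \<le> ?T\<^sup>2" by simp
    finally show ?thesis using T by (rule power2_le_imp_le)
  qed
  also have "\<dots> \<le> w * (1 - c\<^sup>2 - s\<^sup>2) + k * (1 - c\<^sup>2)"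
  proof -
    have "a\<^sup>2 + s\<^sup>2 \<le> 1 - c\<^sup>2" using 1 zero_le_power2[of b] by linarith
    then have "k * (a\<^sup>2 + s\<^sup>2) \<le> k * (1 - c\<^sup>2)" using k by (rule mult_left_mono)
    moreover have "w * (a\<^sup>2 + b\<^sup>2) = w * (1 - c\<^sup>2 - s\<^sup>2)"
      using 1 by (intro arg_cong[of _ _ "(*) w"]) linarith
    ultimately show ?thesis by linarith
  qed
  finally have *: "A * a + (w + k) * c\<^sup>2 + w * s\<^sup>2 \<le> w + k" by (simp add: algebra_simps)
  have "wx * c\<^sup>2 \<le> (w + k) * c\<^sup>2" using wx by (intro mult_right_mono) (auto simp: k_def)
  with * have "A * a + wx * c\<^sup>2 + w * s\<^sup>2 \<le> w + k" by simp
  moreover have "(f + g) / 2 * cnj e = (F + H) / 2" "(f - g) / 2 * cnj e = (F - H) / 2"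
    by (simp_all add: F_def H_def field_simps)
  ultimately show ?thesis by (simp add: a_def c_def s_def k_def)
qed

text \<open>The form of the operator \<open>P\<^sub>1 - d P\<^sub>3\<close>.\<close>

definition Bf :: "real \<Rightarrow> (complex^'n::finite \<Rightarrow> complex) \<Rightarrow> (complex^'n \<Rightarrow> complex) \<Rightarrow> complex" where
  "Bf d f g = (\<Sum>l\<in>UNIV. lin f l * cnj (lin g l)) - of_real d * ((\<Sum>I\<in>UNIV. coef f I * cnj (coef g I)) / 2)"

definition unimodular :: "(complex^'n::finite \<Rightarrow> complex) \<Rightarrow> bool" where
  "unimodular f \<longleftrightarrow> f \<in> borel_measurable borel \<and> (\<forall>x. cmod (f x) = 1)"

lemma unimodularD: assumes "unimodular f"
  shows "f \<in> borel_measurable borel" "cmod (f x) = 1" "cmod (f x) \<le> 1"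
  using assms by (auto simp: unimodular_def)

lemma Re_polarization: "Re ((u + v) * cnj (u - v)) = (cmod u)\<^sup>2 - (cmod v)\<^sup>2"
  unfolding cmod_power2 by (simp add: power2_eq_square algebra_simps)

lemma Re_of_real_times: "Re (of_real s * u) = s * Re u"
  by simp

text \<open>The parameters \<open>\<beta>\<close> and \<open>c\<close> linearize \<open>a\<^sup>2\<close> and \<open>- d\<bar>P\<^sub>3 p\<bar>\<^sup>2\<close> in the
  direction of \<open>x\<^sub>1\<close> and of the Hermite polynomial of index \<open>(1, 1, 1)\<close>.\<close>

lemma certificate_bound:
  fixes f g :: "complex^'n::finite \<Rightarrow> complex" and o1 :: 'n and w \<omega> :: "real \<Rightarrow> real"
  assumes f: "unimodular f" and g: "unimodular g"
    and lin: "\<And>l. lin f l + lin g l = (if l = o1 then 2 * complex_of_real a else 0)"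
    and w[measurable]: "w \<in> borel_measurable borel" "\<omega> \<in> borel_measurable borel"
    and pos: "0 < \<epsilon>" "0 < d"
    and bounds: "\<And>t. \<epsilon> \<le> w t" "\<And>t. w t \<le> \<omega> t" "\<And>t. \<omega> t \<le> B"
    and \<omega>: "\<And>t. 0 \<le> t \<Longrightarrow> \<omega> t \<le> w t + t * (\<beta> + c * (t - 2))\<^sup>2 / w t"
    and cond: "\<And>p r. p \<le> 2 \<Longrightarrow> r \<le> 1 \<Longrightarrow> p \<noteq> 0 \<or> r \<noteq> 0 \<Longrightarrow> d * ((\<integral>t. 1 / w t * hn p r t \<partial>exp1) / fact p) \<le> 1"
    and cond0: "d * (\<integral>t. (1 / \<omega> t + 1 / w t) / 2 \<partial>exp1) \<le> 1"
  shows "Re (Bf d f g) \<le> (a - \<beta>)\<^sup>2 - \<beta>\<^sup>2 + 2 * c\<^sup>2 / d + (\<integral>t. w t + t * (\<beta> + c * (t - 2))\<^sup>2 / w t \<partial>exp1)"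
proof -
  note [measurable] = unimodularD(1)[OF f] unimodularD(1)[OF g]
  define p where "p x = (f x + g x) / 2" for x
  define q where "q x = (f x - g x) / 2" for x
  have [measurable]: "p \<in> borel_measurable borel" "q \<in> borel_measurable borel"
    by (simp_all add: p_def[abs_def] q_def[abs_def])
  have p1: "cmod (p x) \<le> 1" and q1: "cmod (q x) \<le> 1" for x
    using norm_triangle_ineq[of "f x" "g x"] norm_triangle_ineq4[of "f x" "g x"] unimodularD(2)[OF f, of x] unimodularD(2)[OF g, of x]
    by (simp_all add: p_def q_def norm_divide)
  have wpos: "0 < w t" "0 < \<omega> t" for t using bounds(1)[of t] bounds(2)[of t] pos by auto
  note fi = integrable_coef[OF unimodularD(1)[OF f] unimodularD(3)[OF f]] integrable_lin[OF unimodularD(1)[OF f] unimodularD(3)[OF f]]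
  note gi = integrable_coef[OF unimodularD(1)[OF g] unimodularD(3)[OF g]] integrable_lin[OF unimodularD(1)[OF g] unimodularD(3)[OF g]]
  have cp: "coef p I = (coef f I + coef g I) / 2" and cq: "coef q I = (coef f I - coef g I) / 2" for I
    using fi(1)[of I] gi(1)[of I] by (simp_all add: coef_def p_def q_def distrib_right left_diff_distrib)
  have lp: "lin p l = (if l = o1 then complex_of_real a else 0)" for l
  proof -
    have "lin p l = (lin f l + lin g l) / 2"
      using fi(2)[of l] gi(2)[of l] by (simp add: lin_def p_def distrib_right)
    then show ?thesis unfolding lin by (cases "l = o1") simp_all
  qed
  have lq: "lin q l = (lin f l - lin g l) / 2" for l
    using fi(2)[of l] gi(2)[of l] by (simp add: lin_def q_def left_diff_distrib)
  have lp': "lin p l = (lin f l + lin g l) / 2" for l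
    using fi(2)[of l] gi(2)[of l] by (simp add: lin_def p_def distrib_right)
  have lf: "lin f l = lin p l + lin q l" and lg: "lin g l = lin p l - lin q l" for l
    unfolding lp' lq by (simp_all add: field_simps)
  have cf: "coef f I = coef p I + coef q I" and cg: "coef g I = coef p I - coef q I" for I
    unfolding cp cq by (simp_all add: field_simps)
  define z where "z x = x $h o1" for x :: "complex^'n"
  define t where "t x = (cmod (z x))\<^sup>2" for x :: "complex^'n"
  define e where "e x = uph (z x)" for x :: "complex^'n"
  have [measurable]: "z \<in> borel_measurable borel" "t \<in> borel_measurable borel" "e \<in> borel_measurable borel"
    by (simp_all add: z_def[abs_def] t_def[abs_def] e_def[abs_def])
  define Sp where "Sp = (\<Sum>I\<in>UNIV. (cmod (coef p I))\<^sup>2) / 2"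
  define Sq where "Sq = (\<Sum>I\<in>UNIV. (cmod (coef q I))\<^sup>2) / 2"
  have split: "Re (Bf d f g) = (\<Sum>l\<in>UNIV. (cmod (lin p l))\<^sup>2) - (\<Sum>l\<in>UNIV. (cmod (lin q l))\<^sup>2) - d * Sp + d * Sq"
  proof -
    have "Re (\<Sum>l\<in>UNIV. lin f l * cnj (lin g l)) = (\<Sum>l\<in>UNIV. (cmod (lin p l))\<^sup>2) - (\<Sum>l\<in>UNIV. (cmod (lin q l))\<^sup>2)"
      unfolding lf lg Re_sum Re_polarization sum_subtractf ..
    moreover have "Re (\<Sum>I\<in>UNIV. coef f I * cnj (coef g I)) = 2 * Sp - 2 * Sq"
      unfolding cf cg Re_sum Re_polarization sum_subtractf by (simp add: Sp_def Sq_def)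
    moreover have "Re (A - of_real d * (C / 2)) = Re A - d * (Re C / 2)" for A C :: complex by simp
    ultimately show ?thesis unfolding Bf_def by (simp only:) (simp add: field_simps)
  qed
  have "(\<Sum>l\<in>UNIV. (cmod (lin p l))\<^sup>2) = (\<Sum>l\<in>UNIV. if l = o1 then a\<^sup>2 else 0)"
    by (intro sum.cong) (auto simp: lp)
  then have sl: "(\<Sum>l\<in>UNIV. (cmod (lin p l))\<^sup>2) = a\<^sup>2" by simp
  have pi_int: "integrable gauss (\<lambda>x. p x * cnj (z x))" unfolding z_def by (rule integrable_lin[of _ 1]) (simp_all add: p1)
  have a: "a = (\<integral>x. Re (p x * cnj (z x)) \<partial>gauss)"
    using integral_Re[OF pi_int] lp[of o1] unfolding lin_def z_def by (simp del: times_complex.sel)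
  define J where "J = (o1, o1, o1)"
  have h3J: "h3 J x = of_real (t x - 2) * z x" for x
    using complex_norm_square[of "z x"] by (simp add: J_def h3_eq t_def z_def algebra_simps)
  have pJ_int: "integrable gauss (\<lambda>x. p x * cnj (h3 J x))" by (rule integrable_coef[of _ 1]) (simp_all add: p1)
  define y where "y = (\<integral>x. (t x - 2) * Re (p x * cnj (z x)) \<partial>gauss)"
  have reJ: "Re (p x * cnj (h3 J x)) = (t x - 2) * Re (p x * cnj (z x))" for x
    by (simp add: h3J algebra_simps)
  have y: "Re (coef p J) = y"
    using integral_Re[OF pJ_int] unfolding coef_def reJ y_def by (rule sym)
  have yint: "integrable gauss (\<lambda>x. (t x - 2) * Re (p x * cnj (z x)))"
    using integrable_Re[OF pJ_int] by (simp only: reJ)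
  have Sp: "y\<^sup>2 / 2 \<le> Sp"
  proof -
    have "y\<^sup>2 \<le> (cmod (coef p J))\<^sup>2" unfolding y[symmetric] cmod_power2 by simp
    also have "\<dots> \<le> (\<Sum>I\<in>UNIV. (cmod (coef p I))\<^sup>2)"
      by (rule member_le_sum) auto
    finally show ?thesis by (simp add: Sp_def)
  qed
  \<comment> \<open>The tangent to the concave function - d y^2 / 2 at y = - 2 c / d. Of the cubic
    part of \<open>p\<close> only the component along \<open>J\<close> is kept.\<close>
  have "0 \<le> (d / 2) * (y + 2 * c / d)\<^sup>2" using pos by simp
  also have "\<dots> = d * (y\<^sup>2 / 2) + 2 * c * y + 2 * c\<^sup>2 / d"
    using pos by (simp add: power2_eq_square field_simps)
  also have "\<dots> \<le> d * Sp + 2 * c * y + 2 * c\<^sup>2 / d"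
    using Sp pos by (intro add_right_mono mult_left_mono) auto
  finally have ySp: "- (d * Sp) \<le> 2 * c * y + 2 * c\<^sup>2 / d" by simp
  \<comment> \<open>\<open>cubic_part_bound\<close> is used with vx = 1 / \<omega> and vy = 1 / w,
    so \<open>\<omega>\<close> weighs the component of \<open>q\<close> along the phase and
    \<open>w\<close> the one across it.\<close>
  define Q where "Q x = (Re (q x * cnj (e x)))\<^sup>2 / (1 / \<omega> (t x)) + (Im (q x * cnj (e x)))\<^sup>2 / (1 / w (t x))" for x
  have dSq: "d * Sq \<le> (\<integral>x. Q x \<partial>gauss)"
    unfolding Sq_def Q_def e_def t_def z_def
  proof (rule cubic_part_bound[where \<epsilon> = "1 / B" and B = "1 / \<epsilon>" and Bq = 1])
    show "0 < 1 / B" using wpos(2)[of 0] bounds(3)[of 0] by simp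
    show "1 / B \<le> 1 / \<omega> s" for s using wpos(2)[of s] bounds(3)[of s] by (simp add: frac_le)
    show "1 / \<omega> s \<le> 1 / w s" for s using wpos[of s] bounds(2)[of s] by (simp add: frac_le)
    show "1 / w s \<le> 1 / \<epsilon>" for s using pos bounds(1)[of s] by (simp add: frac_le)
  qed (use q1 pos cond cond0 in auto)
  define m where "m s = w s + s * (\<beta> + c * (s - 2))\<^sup>2 / w s" for s
  have mmeas[measurable]: "m \<in> borel_measurable borel" by (simp add: m_def[abs_def])
  have pt: "2 * \<beta> * Re (p x * cnj (z x)) + 2 * c * ((t x - 2) * Re (p x * cnj (z x))) + Q x \<le> m (t x)" for x
  proof -
    \<comment> \<open>Both linear functionals of \<open>p\<close> are multiples of the same real
      part: z is |z| times its phase, and the cubic polynomial of index \<open>J\<close> is (t - 2)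
      z. \<open>A\<close> is the total coefficient.\<close>
    define A where "A = 2 * cmod (z x) * (\<beta> + c * (t x - 2))"
    have "p x * cnj (z x) = of_real (cmod (z x)) * (p x * cnj (e x))"
      using uph_times_cmod[of "z x"] unfolding e_def by (metis complex_cnj_complex_of_real complex_cnj_mult mult.left_commute)
    then have r: "Re (p x * cnj (z x)) = cmod (z x) * Re (p x * cnj (e x))" by (simp only: Re_of_real_times)
    have A2: "A\<^sup>2 / (4 * w (t x)) = t x * (\<beta> + c * (t x - 2))\<^sup>2 / w (t x)"
      by (simp add: A_def t_def power_mult_distrib)
    have wt: "\<omega> (t x) \<le> w (t x) + A\<^sup>2 / (4 * w (t x))"
      unfolding A2 by (rule \<omega>) (simp add: t_def)
    have "cmod (e x) = 1" by (simp add: e_def)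
    from pair_inequality[OF unimodularD(2)[OF f] unimodularD(2)[OF g] this wpos(1) wt]
    have "A * Re (p x * cnj (e x)) + \<omega> (t x) * (Re (q x * cnj (e x)))\<^sup>2 + w (t x) * (Im (q x * cnj (e x)))\<^sup>2 \<le> m (t x)"
      unfolding A2 m_def p_def q_def .
    then have *: "A * Re (p x * cnj (e x)) + Q x \<le> m (t x)"
      by (simp only: Q_def divide_divide_eq_right div_by_1 mult.commute add.assoc)
    have "2 * \<beta> * (s * R) + 2 * c * ((T - 2) * (s * R)) = (2 * s * (\<beta> + c * (T - 2))) * R" for s R T :: real
      by (simp add: algebra_simps)
    from this[of "cmod (z x)" "Re (p x * cnj (e x))" "t x"] * show ?thesis
      unfolding r A_def by linarith
  qed
  have mint: "integrable exp1 m"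
  proof (rule Bochner_Integration.integrable_bound)
    interpret E: prob_space exp1 by (rule prob_space_exp1)
    let ?k = "\<beta> - 2 * c"
    show "integrable exp1 (\<lambda>s. B + (?k\<^sup>2 * s ^ 1 + 2 * ?k * c * s ^ 2 + c\<^sup>2 * s ^ 3) / \<epsilon>)"
      by (intro Bochner_Integration.integrable_add integrable_mult_right integrable_divide E.integrable_const integrable_exp1_power)
    show "m \<in> borel_measurable exp1" by simp
    have "AE s in exp1. 0 \<le> s"
      by (subst AE_density) (auto simp: exponential_density_def)
    then show "AE s in exp1. norm (m s) \<le> norm (B + (?k\<^sup>2 * s ^ 1 + 2 * ?k * c * s ^ 2 + c\<^sup>2 * s ^ 3) / \<epsilon>)"
    proof eventually_elim
      case (elim s)
      have e: "?k\<^sup>2 * s ^ 1 + 2 * ?k * c * s ^ 2 + c\<^sup>2 * s ^ 3 = s * (\<beta> + c * (s - 2))\<^sup>2"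
        by (simp add: power2_eq_square power3_eq_cube algebra_simps)
      have "s * (\<beta> + c * (s - 2))\<^sup>2 / w s \<le> s * (\<beta> + c * (s - 2))\<^sup>2 / \<epsilon>"
        using elim bounds(1)[of s] pos by (intro divide_left_mono) (auto intro: mult_pos_pos less_le_trans)
      moreover have "w s \<le> B" using bounds(2)[of s] bounds(3)[of s] by simp
      moreover have "0 \<le> m s" unfolding m_def using elim wpos(1)[of s] by simp
      ultimately show ?case unfolding e by (simp add: m_def)
    qed
  qed
  have mint': "integrable cgauss (\<lambda>u. m ((cmod u)\<^sup>2))" using integral_cgauss_radial(2)[OF mmeas] mint by simp
  have mt: "integrable gauss (\<lambda>x. m (t x))" "(\<integral>x. m (t x) \<partial>gauss) = (\<integral>s. m s \<partial>exp1)"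
    unfolding t_def z_def using integrable_gauss_coord[OF mint', of o1] integral_cgauss_radial(1)[OF mmeas] by simp_all
  have Qint: "integrable gauss Q"
  proof (rule gauss.integrable_const_bound[of _ "2 * B"], intro AE_I2)
    fix x
    have n: "cmod (q x * cnj (e x)) \<le> 1" using q1 by (simp add: norm_mult e_def)
    have r: "(Re (q x * cnj (e x)))\<^sup>2 \<le> 1" "(Im (q x * cnj (e x)))\<^sup>2 \<le> 1"
      using order_trans[OF abs_Re_le_cmod n] order_trans[OF abs_Im_le_cmod n] by (simp_all add: abs_square_le_1)
    have "(Re (q x * cnj (e x)))\<^sup>2 * \<omega> (t x) \<le> 1 * B"
      by (intro mult_mono r bounds) (use wpos(2)[of "t x"] in auto)
    moreover have "(Im (q x * cnj (e x)))\<^sup>2 * w (t x) \<le> 1 * B"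
      by (intro mult_mono r order_trans[OF bounds(2) bounds(3)]) (use wpos(1)[of "t x"] in auto)
    moreover have "0 \<le> Q x" unfolding Q_def using wpos[of "t x"] by simp
    moreover have "Q x = (Re (q x * cnj (e x)))\<^sup>2 * \<omega> (t x) + (Im (q x * cnj (e x)))\<^sup>2 * w (t x)"
      by (simp only: Q_def divide_divide_eq_right div_by_1)
    ultimately show "norm (Q x) \<le> 2 * B" unfolding real_norm_def by linarith
  qed (simp add: Q_def[abs_def])
  have "2 * \<beta> * a + 2 * c * y + (\<integral>x. Q x \<partial>gauss)
      = (\<integral>x. 2 * \<beta> * Re (p x * cnj (z x)) + 2 * c * ((t x - 2) * Re (p x * cnj (z x))) + Q x \<partial>gauss)"
    unfolding a y_def using integrable_Re[OF pi_int] yint Qint by (simp del: times_complex.sel)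
  also have "\<dots> \<le> (\<integral>x. m (t x) \<partial>gauss)"
    by (rule integral_mono)
      (use integrable_Re[OF pi_int] yint Qint mt(1) pt in \<open>simp_all del: times_complex.sel\<close>)
  finally have main: "2 * \<beta> * a + 2 * c * y + (\<integral>x. Q x \<partial>gauss) \<le> (\<integral>s. m s \<partial>exp1)" by (simp add: mt(2))
  \<comment> \<open>The contribution - |P_1 q|^2 is discarded here.\<close>
  have "Re (Bf d f g) \<le> a\<^sup>2 - d * Sp + d * Sq"
    unfolding split sl by (simp add: sum_nonneg)
  also have "\<dots> \<le> a\<^sup>2 + 2 * c * y + 2 * c\<^sup>2 / d + (\<integral>x. Q x \<partial>gauss)"
    using ySp dSq by simp
  also have "\<dots> \<le> a\<^sup>2 + 2 * c\<^sup>2 / d + (\<integral>s. m s \<partial>exp1) - 2 * \<beta> * a"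
    using main by simp
  also have "\<dots> = (a - \<beta>)\<^sup>2 - \<beta>\<^sup>2 + 2 * c\<^sup>2 / d + (\<integral>s. m s \<partial>exp1)"
    by (simp add: power2_eq_square algebra_simps)
  finally show ?thesis by (simp add: m_def)
qed

section \<open>Unitary invariance\<close>

definition ip :: "complex^'n::finite \<Rightarrow> complex^'n \<Rightarrow> complex" where
  "ip x y = (\<Sum>l\<in>UNIV. cnj (x $h l) * y $h l)"

text \<open>The integral kernel of P_1 - d P_3. Invariance of the form follows because the kernel
  depends on inner products only.\<close>

definition ker :: "real \<Rightarrow> complex^'n::finite \<Rightarrow> complex^'n \<Rightarrow> complex" where
  "ker d x y = ip x y - of_real d * ((\<Sum>I\<in>UNIV. cnj (h3 I x) * h3 I y) / 2)"

lemma ip_self: "ip x x = of_real ((norm x)\<^sup>2)"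
proof -
  have "(norm x)\<^sup>2 = (\<Sum>l\<in>UNIV. (cmod (x $h l))\<^sup>2)"
    by (simp add: norm_vec_def L2_set_def sum_nonneg)
  then show ?thesis
    unfolding ip_def by (simp only: of_real_sum complex_norm_square mult.commute)
qed

lemma sum_triple: "(\<Sum>I\<in>UNIV. F I) = (\<Sum>i\<in>UNIV. \<Sum>j\<in>UNIV. \<Sum>k\<in>UNIV. F (i, j, k))"
  for F :: "'n::finite \<times> 'n \<times> 'n \<Rightarrow> complex"
  unfolding UNIV_Times_UNIV[symmetric] sum.cartesian_product' ..

text \<open>The reproducing kernel of the cubic chaos, up to the factor 2. Only inner products
  remain after summing over all triples, which yields unitary invariance without transforming the
  Hermite basis.\<close>

lemma sum_h3_h3:
  fixes x y :: "complex^'n::finite"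
  shows "(\<Sum>I\<in>UNIV. cnj (h3 I x) * h3 I y)
    = (ip x y)\<^sup>2 * ip y x - 2 * (ip x x + ip y y) * ip x y + of_nat (2 * CARD('n) + 2) * ip x y"
proof -
  let ?s = "ip x y"
  have inner: "(\<Sum>k\<in>UNIV. cnj (h3 (i, j, k) x) * h3 (i, j, k) y)
    = (cnj (x $h i) * y $h i) * (cnj (x $h j) * y $h j) * ip y x
      - (cnj (x $h i) * y $h i) * (cnj (x $h j) * x $h j) - (cnj (x $h i) * x $h i) * (cnj (x $h j) * y $h j)
      - (cnj (x $h i) * y $h i) * (cnj (y $h j) * y $h j) - (cnj (y $h i) * y $h i) * (cnj (x $h j) * y $h j)
      + cnj (x $h i) * y $h i + cnj (x $h j) * y $h j
      + (if j = i then 2 * (cnj (x $h j) * y $h j) else 0)" (is "_ = ?R") for i j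
  proof -
    \<comment> \<open>The case distinctions collect the corrections in \<open>h3_eq\<close>. The
      last one is the cross product of the two corrections, present only for i = j = k.\<close>
    have "(\<Sum>k\<in>UNIV. cnj (h3 (i, j, k) x) * h3 (i, j, k) y)
      = (\<Sum>k\<in>UNIV. ((cnj (x $h i) * y $h i) * (cnj (x $h j) * y $h j)) * (cnj (y $h k) * x $h k)
        + (if k = j then - ((cnj (x $h i) * y $h i) * (cnj (x $h j) * x $h j)) - (cnj (x $h i) * y $h i) * (cnj (y $h j) * y $h j) + cnj (x $h i) * y $h i else 0)
        + (if k = i then - ((cnj (x $h i) * x $h i) * (cnj (x $h j) * y $h j)) - (cnj (y $h i) * y $h i) * (cnj (x $h j) * y $h j) + cnj (x $h j) * y $h j else 0)
        + (if k = i then (if j = i then 2 * (cnj (x $h j) * y $h j) else 0) else 0))"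
      by (intro sum.cong refl) (auto simp: h3_eq algebra_simps)
    also have "\<dots> = ?R"
      by (simp add: sum.distrib ip_def sum_distrib_left[symmetric])
    finally show ?thesis .
  qed
  have "(\<Sum>I\<in>UNIV. cnj (h3 I x) * h3 I y) = (\<Sum>i\<in>UNIV. \<Sum>j\<in>UNIV.
      (cnj (x $h i) * y $h i) * (cnj (x $h j) * y $h j) * ip y x
      - (cnj (x $h i) * y $h i) * (cnj (x $h j) * x $h j) - (cnj (x $h i) * x $h i) * (cnj (x $h j) * y $h j)
      - (cnj (x $h i) * y $h i) * (cnj (y $h j) * y $h j) - (cnj (y $h i) * y $h i) * (cnj (x $h j) * y $h j)
      + cnj (x $h i) * y $h i + cnj (x $h j) * y $h j
      + (if j = i then 2 * (cnj (x $h j) * y $h j) else 0))"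
    unfolding sum_triple inner ..
  also have "\<dots> = ?s * ?s * ip y x - ?s * ip x x - ip x x * ?s - ?s * ip y y - ip y y * ?s
      + of_nat CARD('n) * ?s + of_nat CARD('n) * ?s + 2 * ?s"
    by (simp only: sum.distrib sum_subtractf sum_distrib_left[symmetric] sum_distrib_right[symmetric] ip_def[symmetric])
      (simp add: ip_def[symmetric] sum_distrib_left[symmetric], simp add: ip_def sum_distrib_left mult_ac)
  finally show ?thesis by (simp add: power2_eq_square algebra_simps)
qed

lemma ker_isometry:
  fixes U :: "complex^'n::finite \<Rightarrow> complex^'n"
  assumes "\<And>x y. ip (U x) (U y) = ip x y"
  shows "ker d (U x) (U y) = ker d x y"
  by (simp add: ker_def sum_h3_h3 assms)

lemma ip_isometry_norm:
  fixes U :: "complex^'n::finite \<Rightarrow> complex^'n"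
  assumes "\<And>x y. ip (U x) (U y) = ip x y"
  shows "norm (U x) = norm x"
proof -
  have "complex_of_real ((norm (U x))\<^sup>2) = complex_of_real ((norm x)\<^sup>2)"
    using assms[of x x] by (simp only: ip_self)
  then have "(norm (U x))\<^sup>2 = (norm x)\<^sup>2" by (simp only: of_real_eq_iff)
  then show ?thesis by simp
qed

text \<open>As an iterated integral the form can be transformed one variable at a time; the second
  claim supplies measurability for the outer change of variables.\<close>

lemma Bf_ker:
  assumes f: "unimodular f" and g: "unimodular g"
  shows "Bf d f g = (\<integral>x. f x * (\<integral>y. cnj (g y) * ker d x y \<partial>gauss) \<partial>gauss)"
    and "(\<lambda>x. \<integral>y. cnj (g y) * ker d x y \<partial>gauss) \<in> borel_measurable borel"
proof -
  note fi = integrable_coef[OF unimodularD(1)[OF f] unimodularD(3)[OF f]] integrable_lin[OF unimodularD(1)[OF f] unimodularD(3)[OF f]]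
  note gi = integrable_coef[OF unimodularD(1)[OF g] unimodularD(3)[OF g]] integrable_lin[OF unimodularD(1)[OF g] unimodularD(3)[OF g]]
  have gi': "integrable gauss (\<lambda>y. cnj (g y) * h3 I y)" "integrable gauss (\<lambda>y. cnj (g y) * y $h l)" for I l
    using integrable_cnj[OF gi(1)[of I]] integrable_cnj[OF gi(2)[of l]] by simp_all
  have gv: "(\<integral>y. cnj (g y) * h3 I y \<partial>gauss) = cnj (coef g I)" "(\<integral>y. cnj (g y) * y $h l \<partial>gauss) = cnj (lin g l)" for I l
  proof -
    have c: "cnj (\<integral>x. F x \<partial>gauss) = (\<integral>x. cnj (F x) \<partial>gauss)" for F :: "complex^'n \<Rightarrow> complex" by simp
    show "(\<integral>y. cnj (g y) * h3 I y \<partial>gauss) = cnj (coef g I)" "(\<integral>y. cnj (g y) * y $h l \<partial>gauss) = cnj (lin g l)"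
      by (simp_all only: coef_def lin_def c complex_cnj_mult complex_cnj_cnj)
  qed
  have inner: "(\<integral>y. cnj (g y) * ker d x y \<partial>gauss)
      = (\<Sum>l\<in>UNIV. cnj (lin g l) * cnj (x $h l)) - of_real d * ((\<Sum>I\<in>UNIV. cnj (coef g I) * cnj (h3 I x)) / 2)" for x
  proof -
    have "cnj (g y) * ker d x y = (\<Sum>l\<in>UNIV. cnj (x $h l) * (cnj (g y) * y $h l))
       - (\<Sum>I\<in>UNIV. (of_real d / 2 * cnj (h3 I x)) * (cnj (g y) * h3 I y))" for y
      by (simp add: ker_def ip_def sum_distrib_left sum_divide_distrib right_diff_distrib mult_ac)
    then have "(\<integral>y. cnj (g y) * ker d x y \<partial>gauss) = (\<Sum>l\<in>UNIV. cnj (x $h l) * cnj (lin g l)) - (\<Sum>I\<in>UNIV. (of_real d / 2 * cnj (h3 I x)) * cnj (coef g I))"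
      by (simp add: gi' gv)
    then show ?thesis by (simp add: sum_distrib_left sum_divide_distrib mult_ac)
  qed
  show "(\<lambda>x. \<integral>y. cnj (g y) * ker d x y \<partial>gauss) \<in> borel_measurable borel"
    unfolding inner by simp
  have "f x * (\<integral>y. cnj (g y) * ker d x y \<partial>gauss) = (\<Sum>l\<in>UNIV. cnj (lin g l) * (f x * cnj (x $h l)))
      - (\<Sum>I\<in>UNIV. (of_real d / 2 * cnj (coef g I)) * (f x * cnj (h3 I x)))" for x
    unfolding inner by (simp add: sum_distrib_left sum_divide_distrib right_diff_distrib mult_ac)
  then have "(\<integral>x. f x * (\<integral>y. cnj (g y) * ker d x y \<partial>gauss) \<partial>gauss)
     = (\<Sum>l\<in>UNIV. cnj (lin g l) * lin f l) - (\<Sum>I\<in>UNIV. (of_real d / 2 * cnj (coef g I)) * coef f I)"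
    by (simp add: fi lin_def[of f] coef_def[of f])
  then show "Bf d f g = (\<integral>x. f x * (\<integral>y. cnj (g y) * ker d x y \<partial>gauss) \<partial>gauss)"
    by (simp add: Bf_def sum_distrib_left sum_divide_distrib mult_ac)
qed

lemma unimodular_compose:
  assumes "unimodular f" "U \<in> borel_measurable borel" shows "unimodular (\<lambda>x. f (U x))"
  using assms by (auto simp: unimodular_def intro: measurable_compose)

lemma linear_borel_measurable: "linear U \<Longrightarrow> U \<in> borel_measurable borel"
  for U :: "'a::euclidean_space \<Rightarrow> 'b::euclidean_space"
  by (intro borel_measurable_continuous_onI linear_continuous_on) (simp add: linear_conv_bounded_linear)

lemma integral_gauss_isometry:
  fixes F :: "complex^'n::finite \<Rightarrow> complex" and U :: "complex^'n \<Rightarrow> complex^'n"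
  assumes U: "linear U" "\<And>x y. ip (U x) (U y) = ip x y" and [measurable]: "F \<in> borel_measurable borel"
  shows "(\<integral>x. F (U x) \<partial>gauss) = (\<integral>x. F x \<partial>gauss)"
proof -
  have [measurable]: "U \<in> borel_measurable borel" by (rule linear_borel_measurable[OF U(1)])
  have "(\<integral>x. F x \<partial>gauss) = (\<integral>x. F x \<partial>distr gauss borel U)"
    by (simp only: distr_gauss_isometry[OF U(1) ip_isometry_norm[OF U(2)]])
  also have "\<dots> = (\<integral>x. F (U x) \<partial>gauss)" by (rule integral_distr) simp_all
  finally show ?thesis by simp
qed

lemma Bf_isometry:
  fixes U :: "complex^'n::finite \<Rightarrow> complex^'n"
  assumes U: "linear U" "\<And>x y. ip (U x) (U y) = ip x y" and f: "unimodular f" and g: "unimodular g"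
  shows "Bf d (\<lambda>x. f (U x)) (\<lambda>x. g (U x)) = Bf d f g"
proof -
  have mU[measurable]: "U \<in> borel_measurable borel" by (rule linear_borel_measurable[OF U(1)])
  note [measurable] = unimodularD(1)[OF f] unimodularD(1)[OF g]
  define \<Phi> where "\<Phi> x = (\<integral>y. cnj (g y) * ker d x y \<partial>gauss)" for x
  have [measurable]: "\<Phi> \<in> borel_measurable borel"
    unfolding \<Phi>_def[abs_def] by (rule Bf_ker(2)[OF f g])
  have km: "(\<lambda>y. cnj (g y) * ker d x y) \<in> borel_measurable borel" for x
    by (simp add: ker_def ip_def)
  have "Bf d (\<lambda>x. f (U x)) (\<lambda>x. g (U x)) = (\<integral>x. f (U x) * (\<integral>y. cnj (g (U y)) * ker d (U x) (U y) \<partial>gauss) \<partial>gauss)"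
    unfolding ker_isometry[OF U(2)] by (rule Bf_ker(1)) (use f g mU in \<open>auto intro: unimodular_compose\<close>)
  also have "\<dots> = (\<integral>x. f (U x) * \<Phi> (U x) \<partial>gauss)"
    unfolding \<Phi>_def by (simp only: integral_gauss_isometry[OF U km])
  also have "\<dots> = (\<integral>x. f x * \<Phi> x \<partial>gauss)"
    by (rule integral_gauss_isometry[OF U, of "\<lambda>x. f x * \<Phi> x"]) simp
  also have "\<dots> = Bf d f g" unfolding \<Phi>_def by (rule Bf_ker(1)[OF f g, symmetric])
  finally show ?thesis .
qed

section \<open>Householder reflections and the choice of a direction\<close>

lemma ip_add_right: "ip v (x + y) = ip v x + ip v y"
  by (simp add: ip_def distrib_left sum.distrib)

lemma ip_scaleR_right: "ip v (r *\<^sub>R x) = of_real r * ip v x"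
  unfolding ip_def sum_distrib_left by (intro sum.cong refl) (simp add: scaleR_conv_of_real[where 'a=complex])

text \<open>The Householder reflection in the complex hyperplane orthogonal to \<open>v\<close>. For
  \<open>v = 0\<close> division by zero makes it the identity.\<close>

definition reflect :: "complex^'n::finite \<Rightarrow> complex^'n \<Rightarrow> complex^'n" where
  "reflect v y = (\<chi> l. y $h l - 2 / ip v v * ip v y * v $h l)"

lemma reflect_nth: "reflect v y $h l = y $h l - 2 / ip v v * ip v y * v $h l"
  by (simp add: reflect_def)

lemma reflect_linear: "linear (reflect v)" for v :: "complex^'n::finite"
proof (rule linearI)
  fix x y :: "complex^'n" and r :: real
  show "reflect v (x + y) = reflect v x + reflect v y"
    unfolding vec_eq_iff by (simp add: reflect_nth ip_add_right distrib_left distrib_right add_divide_distrib)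
  have "(r *\<^sub>R x) $h l - \<kappa> * (of_real r * i) * c = r *\<^sub>R (x $h l - \<kappa> * i * c)" for l \<kappa> i c
    by (simp add: scaleR_conv_of_real[where 'a=complex] right_diff_distrib)
  then show "reflect v (r *\<^sub>R x) = r *\<^sub>R reflect v x"
    unfolding vec_eq_iff vector_scaleR_component reflect_nth ip_scaleR_right by blast
qed

lemma ip_cnj: "cnj (ip x y) = ip y x"
  by (simp add: ip_def mult.commute)

lemma reflect_ip: "ip (reflect v x) (reflect v y) = ip x y"
proof -
  define \<kappa> where "\<kappa> = 2 / ip v v"
  have r: "reflect v y $h l = y $h l - \<kappa> * ip v y * v $h l" for y l
    unfolding \<kappa>_def by (rule reflect_nth)
  have \<kappa>: "cnj \<kappa> = \<kappa>" by (simp add: \<kappa>_def ip_cnj)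
  have k2: "\<kappa> * \<kappa> * ip v v = 2 * \<kappa>" by (cases "ip v v = 0") (simp_all add: \<kappa>_def)
  have "ip (reflect v x) (reflect v y) = (\<Sum>l\<in>UNIV. cnj (x $h l) * y $h l - (\<kappa> * ip v y) * (cnj (x $h l) * v $h l)
      - (\<kappa> * ip x v) * (cnj (v $h l) * y $h l) + (\<kappa> * \<kappa> * ip x v * ip v y) * (cnj (v $h l) * v $h l))"
    unfolding ip_def[of "reflect v x" "reflect v y"]
    by (intro sum.cong refl) (simp add: r \<kappa> ip_cnj algebra_simps)
  also have "\<dots> = ip x y - (\<kappa> * ip v y) * ip x v - (\<kappa> * ip x v) * ip v y + (\<kappa> * \<kappa> * ip x v * ip v y) * ip v v"
    by (simp only: sum.distrib sum_subtractf sum_distrib_left[symmetric] ip_def[symmetric])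
  also have "\<dots> = ip x y - 2 * \<kappa> * ip v y * ip x v + (\<kappa> * \<kappa> * ip v v) * ip x v * ip v y"
    by (simp add: algebra_simps)
  also have "\<dots> = ip x y" unfolding k2 by simp
  finally show ?thesis .
qed

lemma reflect_reflect: "reflect v (reflect v y) = y"
proof -
  define \<kappa> where "\<kappa> = 2 / ip v v"
  have r: "reflect v y $h l = y $h l - \<kappa> * ip v y * v $h l" for y l
    unfolding \<kappa>_def by (rule reflect_nth)
  have k1: "\<kappa> * ip v v * v $h l = 2 * v $h l" for l
    by (cases "v = 0") (simp_all add: \<kappa>_def ip_self)
  have "ip v (reflect v y) = (\<Sum>l\<in>UNIV. cnj (v $h l) * y $h l - (\<kappa> * ip v y) * (cnj (v $h l) * v $h l))"
    unfolding ip_def[of v "reflect v y"] by (intro sum.cong refl) (simp add: r algebra_simps)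
  also have "\<dots> = ip v y - (\<kappa> * ip v y) * ip v v"
    by (simp only: sum_subtractf sum_distrib_left[symmetric] ip_def[symmetric])
  finally have i: "ip v (reflect v y) = ip v y - (\<kappa> * ip v y) * ip v v" .
  have "reflect v (reflect v y) $h l = y $h l" for l
  proof -
    have "reflect v (reflect v y) $h l = y $h l - \<kappa> * ip v y * v $h l - \<kappa> * (ip v y - (\<kappa> * ip v y) * ip v v) * v $h l"
      unfolding i[symmetric] by (simp add: r)
    also have "\<dots> = y $h l - \<kappa> * ip v y * (2 * v $h l - \<kappa> * ip v v * v $h l)"
      by (simp add: algebra_simps)
    finally show ?thesis unfolding k1 by simp
  qed
  then show ?thesis by (simp add: vec_eq_iff)
qed

lemma lin_reflect:
  fixes f :: "complex^'n::finite \<Rightarrow> complex"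
  assumes f: "unimodular f"
  shows "lin (\<lambda>x. f (reflect v x)) l = lin f l - 2 / ip v v * (\<Sum>m\<in>UNIV. v $h m * lin f m) * cnj (v $h l)"
proof -
  note [measurable] = unimodularD(1)[OF f]
  have [measurable]: "reflect v \<in> borel_measurable borel" by (rule linear_borel_measurable[OF reflect_linear])
  note fi = integrable_lin[OF unimodularD(1)[OF f] unimodularD(3)[OF f]]
  define \<kappa> where "\<kappa> = 2 / ip v v"
  have r: "reflect v y $h l = y $h l - \<kappa> * ip v y * v $h l" for y l
    unfolding \<kappa>_def by (rule reflect_nth)
  have \<kappa>: "cnj \<kappa> = \<kappa>" by (simp add: \<kappa>_def ip_cnj)
  have "lin (\<lambda>x. f (reflect v x)) l = (\<integral>x. (\<lambda>y. f y * cnj (reflect v y $h l)) (reflect v x) \<partial>gauss)"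
    by (simp add: lin_def reflect_reflect)
  also have "\<dots> = (\<integral>y. f y * cnj (reflect v y $h l) \<partial>gauss)"
    by (rule integral_gauss_isometry[OF reflect_linear reflect_ip]) simp
  also have "\<dots> = (\<integral>y. f y * cnj (y $h l) - (\<Sum>m\<in>UNIV. (\<kappa> * cnj (v $h l) * v $h m) * (f y * cnj (y $h m))) \<partial>gauss)"
    by (intro Bochner_Integration.integral_cong refl)
      (simp add: r \<kappa> ip_cnj ip_def[of _ v] sum_distrib_left sum_distrib_right right_diff_distrib mult_ac)
  also have "\<dots> = lin f l - (\<Sum>m\<in>UNIV. (\<kappa> * cnj (v $h l) * v $h m) * lin f m)"
    by (simp add: fi lin_def)
  finally show ?thesis by (simp add: \<kappa>_def sum_distrib_left sum_distrib_right mult_ac)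
qed

text \<open>A Householder reflection carries one vector to another of equal norm only if their inner
  product is real. The target is therefore given the phase \<open>u\<close> of the coordinate
  \<open>P $h o1\<close>; multiplying both functions by \<open>cnj u\<close> removes that phase
  again and leaves the form unchanged.\<close>

lemma normalize_direction:
  fixes f g :: "complex^'n::finite \<Rightarrow> complex" and o1 :: 'n
  assumes f: "unimodular f" and g: "unimodular g"
  obtains f' g' a where "unimodular f'" "unimodular g'" "Bf d f' g' = Bf d f g" "0 \<le> a"
    "\<And>l. lin f' l + lin g' l = (if l = o1 then 2 * complex_of_real a else 0)"
proof -
  define P :: "complex^'n" where "P = (\<chi> l. (lin f l + lin g l) / 2)"
  define a where "a = norm P"
  define u where "u = uph (P $h o1)"
  define \<eta> where "\<eta> = of_real a * u"
  \<comment> \<open>Conjugated because, by \<open>lin_reflect\<close>, composing with the reflection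
    in \<open>v\<close> reflects the vector of linear coefficients in the conjugate of
    \<open>v\<close>.\<close>
  define v :: "complex^'n" where "v = (\<chi> l. cnj (P $h l - (if l = o1 then \<eta> else 0)))"
  have uu: "cnj u * u = 1" using complex_norm_square[of u] by (simp add: u_def mult.commute)
  have \<eta>P: "cnj \<eta> * P $h o1 = of_real (a * cmod (P $h o1))"
  proof -
    have "cnj \<eta> * P $h o1 = of_real a * (cnj u * (of_real (cmod (P $h o1)) * u))"
      unfolding u_def uph_times_cmod by (simp add: \<eta>_def u_def)
    also have "\<dots> = of_real a * of_real (cmod (P $h o1)) * (cnj u * u)" by (simp add: mult_ac)
    finally show ?thesis unfolding uu by simp
  qed
  have PP: "(\<Sum>m\<in>UNIV. cnj (P $h m) * P $h m) = of_real (a\<^sup>2)"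
    using ip_self[of P] by (simp only: ip_def a_def)
  have vP: "(\<Sum>m\<in>UNIV. v $h m * P $h m) = of_real (a\<^sup>2 - a * cmod (P $h o1))"
  proof -
    have "(\<Sum>m\<in>UNIV. v $h m * P $h m) = (\<Sum>m\<in>UNIV. cnj (P $h m) * P $h m - (if m = o1 then cnj \<eta> * P $h o1 else 0))"
      by (intro sum.cong) (auto simp: v_def algebra_simps)
    also have "\<dots> = of_real (a\<^sup>2) - cnj \<eta> * P $h o1" unfolding sum_subtractf PP by simp
    finally show ?thesis unfolding \<eta>P by simp
  qed
  have vv: "ip v v = 2 * of_real (a\<^sup>2 - a * cmod (P $h o1))"
  proof -
    have "ip v v = (\<Sum>m\<in>UNIV. cnj (v $h m) * v $h m)"
      by (simp add: ip_def)
    also have "\<dots> = (\<Sum>m\<in>UNIV. cnj (P $h m) * P $h m + (if m = o1 then cnj \<eta> * \<eta> - cnj \<eta> * P $h o1 - cnj (cnj \<eta> * P $h o1) else 0))"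
      by (intro sum.cong) (auto simp: v_def algebra_simps)
    also have "\<dots> = of_real (a\<^sup>2) + (cnj \<eta> * \<eta> - cnj \<eta> * P $h o1 - cnj (cnj \<eta> * P $h o1))"
      unfolding sum.distrib PP by simp
    also have "cnj \<eta> * \<eta> = of_real (a\<^sup>2)"
    proof -
      have "cnj \<eta> * \<eta> = of_real (a * a) * (cnj u * u)" by (simp add: \<eta>_def mult_ac)
      then show ?thesis unfolding uu by (simp add: power2_eq_square)
    qed
    finally show ?thesis unfolding \<eta>P by simp
  qed
  have key: "P $h l - 2 / ip v v * (\<Sum>m\<in>UNIV. v $h m * P $h m) * cnj (v $h l) = (if l = o1 then \<eta> else 0)" for l
  proof (cases "v = 0")
    case True
    have "cnj (v $h l) = P $h l - (if l = o1 then \<eta> else 0)" by (simp add: v_def)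
    then show ?thesis using True by simp
  next
    case False
    then have n0: "ip v v \<noteq> 0" by (simp add: ip_self)
    have "2 / ip v v * (\<Sum>m\<in>UNIV. v $h m * P $h m) = ip v v / ip v v"
      unfolding vP vv by simp
    then have "2 / ip v v * (\<Sum>m\<in>UNIV. v $h m * P $h m) = 1"
      unfolding divide_self[OF n0] .
    then show ?thesis by (simp only: mult_1_left) (simp add: v_def)
  qed
  have mR[measurable]: "reflect v \<in> borel_measurable borel" by (rule linear_borel_measurable[OF reflect_linear])
  note fU = unimodular_compose[OF f mR] and gU = unimodular_compose[OF g mR]
  define f' where "f' x = cnj u * f (reflect v x)" for x
  define g' where "g' x = cnj u * g (reflect v x)" for x
  have uf: "unimodular f'" and ug: "unimodular g'"
    using fU gU by (auto simp: unimodular_def f'_def[abs_def] g'_def[abs_def] norm_mult u_def)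
  have lf: "lin f' l = cnj u * lin (\<lambda>x. f (reflect v x)) l" and lg: "lin g' l = cnj u * lin (\<lambda>x. g (reflect v x)) l" for l
    by (simp_all add: lin_def f'_def g'_def mult.assoc)
  have cf: "coef f' I = cnj u * coef (\<lambda>x. f (reflect v x)) I" and cg: "coef g' I = cnj u * coef (\<lambda>x. g (reflect v x)) I" for I
    by (simp_all add: coef_def f'_def g'_def mult.assoc)
  have uuu: "(cnj u * A) * cnj (cnj u * C) = A * cnj C" for A C
  proof -
    have "(cnj u * A) * cnj (cnj u * C) = (cnj u * u) * (A * cnj C)" by (simp add: mult_ac)
    then show ?thesis unfolding uu by simp
  qed
  have "Bf d f' g' = Bf d (\<lambda>x. f (reflect v x)) (\<lambda>x. g (reflect v x))"
    unfolding Bf_def lf lg cf cg uuu ..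
  also have "\<dots> = Bf d f g" by (rule Bf_isometry[OF reflect_linear reflect_ip f g])
  finally have B: "Bf d f' g' = Bf d f g" .
  have "lin f' l + lin g' l = (if l = o1 then 2 * complex_of_real a else 0)" for l
  proof -
    have "lin f' l + lin g' l = cnj u * ((lin f l + lin g l) - 2 / ip v v * (\<Sum>m\<in>UNIV. v $h m * (lin f m + lin g m)) * cnj (v $h l))"
      unfolding lf lg lin_reflect[OF f] lin_reflect[OF g] by (simp add: sum.distrib distrib_left distrib_right algebra_simps add_divide_distrib)
    also have "\<dots> = cnj u * (2 * (P $h l - 2 / ip v v * (\<Sum>m\<in>UNIV. v $h m * P $h m) * cnj (v $h l)))"
      by (simp add: P_def sum_distrib_left[symmetric] sum_divide_distrib[symmetric] algebra_simps)
    also have "\<dots> = (if l = o1 then 2 * (cnj u * u) * of_real a else 0)"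
      unfolding key by (simp add: \<eta>_def mult_ac)
    finally show ?thesis unfolding uu by simp
  qed
  then show ?thesis using that[OF uf ug B, of a] by (simp add: a_def)
qed

section \<open>Step function certificates\<close>

text \<open>The polynomial factor of the incomplete Gamma function: Gamma(k + 1, t) = e^(-t) times
  \<open>exp_tail_poly k t\<close>.\<close>

primrec exp_tail_poly :: "nat \<Rightarrow> real \<Rightarrow> real" where
  "exp_tail_poly 0 t = 1"
| "exp_tail_poly (Suc k) t = t ^ Suc k + real (Suc k) * exp_tail_poly k t"

lemma exp_tail_poly_deriv: "(exp_tail_poly k has_real_derivative exp_tail_poly k t - t ^ k) (at t)"
proof (induction k)
  case (Suc k)
  have "((\<lambda>t. t ^ Suc k + real (Suc k) * exp_tail_poly k t) has_real_derivative
      (real (Suc k) * t ^ k + real (Suc k) * (exp_tail_poly k t - t ^ k))) (at t)"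
    by (rule derivative_eq_intros Suc refl)+ simp
  then show ?case by (simp add: algebra_simps)
qed simp

lemma exp_tail_poly_tendsto: "((\<lambda>t. exp (- t) * exp_tail_poly k t) \<longlongrightarrow> 0) at_top"
proof (induction k)
  case 0
  show ?case by (simp add: filterlim_compose[OF exp_at_bot filterlim_uminus_at_bot_at_top])
next
  case (Suc k)
  have "((\<lambda>t. t ^ Suc k / exp t + real (Suc k) * (exp (- t) * exp_tail_poly k t)) \<longlongrightarrow> 0 + real (Suc k) * 0) at_top"
    by (intro tendsto_intros Suc tendsto_power_div_exp_0)
  then show ?case by (simp add: exp_minus field_simps)
qed

lemma has_bochner_integral_exp1_tail:
  assumes "0 \<le> \<tau>"
  shows "has_bochner_integral exp1 (\<lambda>t. t ^ k * indicator {\<tau>..} t) (exp (- \<tau>) * exp_tail_poly k \<tau>)"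
proof -
  define F where "F t = - (exp (- t) * exp_tail_poly k t)" for t
  have F: "DERIV F t :> t ^ k * exp (- t)" for t
    unfolding F_def by (rule derivative_eq_intros exp_tail_poly_deriv refl)+ (simp add: algebra_simps)
  have "(F \<longlongrightarrow> - 0) at_top"
    unfolding F_def by (intro tendsto_intros exp_tail_poly_tendsto)
  then have lim: "(F \<longlongrightarrow> 0) at_top" by simp
  have nn: "(\<integral>\<^sup>+t. ennreal (t ^ k * exp (- t)) * indicator {\<tau>..} t \<partial>lborel) = ennreal (0 - F \<tau>)"
    by (rule nn_integral_FTC_atLeast[where F=F]) (use assms F lim in auto)
  have pos: "0 \<le> - F \<tau>"
  proof -
    have "0 \<le> exp_tail_poly k \<tau>" using assms by (induction k) auto
    then show ?thesis by (simp add: F_def)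
  qed
  show ?thesis
  proof (rule has_bochner_integral_nn_integral)
    show "(\<lambda>t. t ^ k * indicator {\<tau>..} t) \<in> borel_measurable exp1" by simp
    show "AE t in exp1. 0 \<le> t ^ k * indicator {\<tau>..} t"
      using assms by (intro AE_I2) (auto split: split_indicator)
    show "0 \<le> exp (- \<tau>) * exp_tail_poly k \<tau>" using pos by (simp add: F_def)
    have "(\<integral>\<^sup>+t. ennreal (t ^ k * indicator {\<tau>..} t) \<partial>exp1)
        = (\<integral>\<^sup>+t. ennreal (exponential_density 1 t) * ennreal (t ^ k * indicator {\<tau>..} t) \<partial>lborel)"
      by (subst nn_integral_density) (auto simp: exponential_density_nonneg)
    also have "\<dots> = (\<integral>\<^sup>+t. ennreal (t ^ k * exp (- t)) * indicator {\<tau>..} t \<partial>lborel)"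
      using assms by (intro nn_integral_cong)
        (auto simp: exponential_density_def ennreal_mult[symmetric] mult.commute split: split_indicator)
    also have "\<dots> = ennreal (exp (- \<tau>) * exp_tail_poly k \<tau>)" unfolding nn by (simp add: F_def)
    finally show "(\<integral>\<^sup>+t. ennreal (t ^ k * indicator {\<tau>..} t) \<partial>exp1) = ennreal (exp (- \<tau>) * exp_tail_poly k \<tau>)" .
  qed
qed

text \<open>All breakpoints are multiples of 1/20, so every exponential in the certificates is a
  power of \<open>ex 1\<close>.\<close>

definition ex :: "nat \<Rightarrow> real" where
  "ex k = exp (- (real k / 20))"

text \<open>A pair \<open>(k, w)\<close> in a list is the value \<open>w\<close> taken from \<open>k/20\<close> up to the next breakpoint.\<close>

fun stp :: "(nat \<times> 'a) list \<Rightarrow> real \<Rightarrow> 'a" where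
  "stp [(k, w)] t = w"
| "stp ((k, w) # (k', w') # xs) t = (if t < real k' / 20 then w else stp ((k', w') # xs) t)"

text \<open>By \<open>ival_tail\<close>, the integral of \<open>\<phi> (stp xs t) * t ^ j\<close>
  against the exponential distribution from the first breakpoint on, written with differences of
  tails.\<close>

fun ival :: "('a \<Rightarrow> real) \<Rightarrow> nat \<Rightarrow> (nat \<times> 'a) list \<Rightarrow> real" where
  "ival \<phi> j [(k, w)] = \<phi> w * (ex k * exp_tail_poly j (real k / 20))"
| "ival \<phi> j ((k, w) # (k', w') # xs) = \<phi> w * (ex k * exp_tail_poly j (real k / 20) - ex k' * exp_tail_poly j (real k' / 20))
    + ival \<phi> j ((k', w') # xs)"

lemma stp_measurable: "xs \<noteq> [] \<Longrightarrow> (\<lambda>t. \<phi> (stp xs t) :: real) \<in> borel_measurable borel"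
proof (induction xs)
  case (Cons v ys)
  obtain k w where v: "v = (k, w)" by (cases v)
  show ?case
  proof (cases ys)
    case Nil
    then show ?thesis by (simp add: v)
  next
    case (Cons v' zs)
    obtain k' w' where v': "v' = (k', w')" by (cases v')
    have [measurable]: "(\<lambda>t. \<phi> (stp ((k', w') # zs) t)) \<in> borel_measurable borel"
      using Cons.IH local.Cons v' by simp
    show ?thesis by (simp add: v v' local.Cons if_distrib[of \<phi>])
  qed
qed simp

text \<open>Supplies the left end of the active piece, the point at which the pointwise condition of
  a certificate is tested.\<close>

lemma stp_mem:
  "sorted (map fst xs) \<Longrightarrow> xs \<noteq> [] \<Longrightarrow> real (fst (hd xs)) / 20 \<le> t \<Longrightarrow> \<exists>k. (k, stp xs t) \<in> set xs \<and> real k / 20 \<le> t"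
proof (induction xs t rule: stp.induct)
  case (2 k w k' w' xs t)
  show ?case
  proof (cases "t < real k' / 20")
    case True
    then show ?thesis using 2 by auto
  next
    case False
    have "\<exists>k. (k, stp ((k', w') # xs) t) \<in> set ((k', w') # xs) \<and> real k / 20 \<le> t"
      by (rule 2) (use False 2 in auto)
    then show ?thesis unfolding stp.simps if_not_P[OF False] by auto
  qed
qed auto

lemma stp_in: "xs \<noteq> [] \<Longrightarrow> stp xs t \<in> snd ` set xs"
  by (induction xs t rule: stp.induct) auto

lemma ival_tail:
  "sorted (map fst xs) \<Longrightarrow> xs \<noteq> [] \<Longrightarrow>
    has_bochner_integral exp1 (\<lambda>t. \<phi> (stp xs t) * t ^ j * indicator {real (fst (hd xs)) / 20..} t) (ival \<phi> j xs)"
proof (induction \<phi> j xs rule: ival.induct)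
  case (1 \<phi> j k w)
  show ?case
    using has_bochner_integral_mult_right[OF has_bochner_integral_exp1_tail[of "real k / 20" j], of "\<phi> w"]
    by (simp add: ex_def mult.assoc)
next
  case (2 \<phi> j k w k' w' xs)
  have IH: "has_bochner_integral exp1 (\<lambda>t. \<phi> (stp ((k', w') # xs) t) * t ^ j * indicator {real k' / 20..} t) (ival \<phi> j ((k', w') # xs))"
    using 2 by simp
  have le: "k \<le> k'" using 2 by simp
  have "has_bochner_integral exp1 (\<lambda>t. \<phi> w * (t ^ j * indicator {real k / 20..} t - t ^ j * indicator {real k' / 20..} t)
      + \<phi> (stp ((k', w') # xs) t) * t ^ j * indicator {real k' / 20..} t) (ival \<phi> j ((k, w) # (k', w') # xs))"
    unfolding ival.simps ex_def
    by (intro has_bochner_integral_add has_bochner_integral_mult_right has_bochner_integral_diff has_bochner_integral_exp1_tail IH) auto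
  moreover have "(\<lambda>t. \<phi> w * (t ^ j * indicator {real k / 20..} t - t ^ j * indicator {real k' / 20..} t)
      + \<phi> (stp ((k', w') # xs) t) * t ^ j * indicator {real k' / 20..} t)
      = (\<lambda>t. \<phi> (stp ((k, w) # (k', w') # xs) t) * t ^ j * indicator {real (fst (hd ((k, w) # (k', w') # xs))) / 20..} t)"
    using le by (auto simp: fun_eq_iff split: split_indicator)
  ultimately show ?case by simp
qed auto

lemma ival_integral:
  assumes "sorted (map fst xs)" "xs \<noteq> []" "fst (hd xs) = 0"
  shows "integrable exp1 (\<lambda>t. \<phi> (stp xs t) * t ^ j)" "(\<integral>t. \<phi> (stp xs t) * t ^ j \<partial>exp1) = ival \<phi> j xs"
proof -
  note [measurable] = stp_measurable[OF assms(2), of \<phi>]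
  have "AE t in exp1. 0 \<le> t" by (subst AE_density) (auto simp: exponential_density_def)
  then have ae: "AE t in exp1. \<phi> (stp xs t) * t ^ j * indicator {real (fst (hd xs)) / 20..} t = \<phi> (stp xs t) * t ^ j"
    by eventually_elim (simp add: assms(3))
  have "has_bochner_integral exp1 (\<lambda>t. \<phi> (stp xs t) * t ^ j) (ival \<phi> j xs)"
    using ival_tail[OF assms(1,2), of \<phi> j]
    by (rule has_bochner_integral_cong_AE[THEN iffD1, rotated 3]) (use ae in simp_all)
  then show "integrable exp1 (\<lambda>t. \<phi> (stp xs t) * t ^ j)" "(\<integral>t. \<phi> (stp xs t) * t ^ j \<partial>exp1) = ival \<phi> j xs"
    by (simp_all add: has_bochner_integral_iff)
qed

text \<open>Makes the hypotheses of \<open>certificate_bound\<close> finite. As \<open>c\<close> and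
  \<open>\<kappa>\<close> are nonnegative, t (\<kappa> + c t)^2 increases for t >= 0, so the upper
  bound on \<open>\<omega>\<close> is tested only at the left end of each piece. At the
  distinguished coordinate, \<open>c1\<close> covers the bidegrees (1, 0) and (0, 1),
  \<open>c2\<close> covers (2, 0), \<open>c3\<close> covers (1, 1), \<open>c4\<close> covers (2, 1),
  and \<open>c0\<close> is the averaged condition for (0, 0).\<close>

lemma list_certificate:
  fixes f g :: "complex^'n::finite \<Rightarrow> complex" and xs :: "(nat \<times> real \<times> real) list" and a c d \<beta> :: real
  defines "I \<equiv> \<lambda>j. ival (\<lambda>v. 1 / fst v) j xs" and "\<kappa> \<equiv> \<beta> - 2 * c"
  assumes f: "unimodular f" and g: "unimodular g"
    and lin: "\<And>l. lin f l + lin g l = (if l = o1 then 2 * complex_of_real a else 0)"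
    and xs: "sorted (map fst xs)" "xs \<noteq> []" "fst (hd xs) = 0"
    and d: "0 < d" and c: "0 \<le> c" "0 \<le> \<kappa>"
    and pieces: "\<forall>(k, w, \<omega>)\<in>set xs. 0 < w \<and> w \<le> \<omega> \<and> \<omega> * w \<le> w\<^sup>2 + real k / 20 * (\<kappa> + c * (real k / 20))\<^sup>2"
    and c0: "d * (I 0 + ival (\<lambda>v. 1 / snd v) 0 xs) \<le> 2"
    and c1: "d * I 1 \<le> 1" and c2: "d * I 2 \<le> 2"
    and c3: "d * (I 2 - 2 * I 1 + I 0) \<le> 1" and c4: "d * (I 3 - 4 * I 2 + 4 * I 1) \<le> 2"
  shows "Re (Bf d f g) \<le> (a - \<beta>)\<^sup>2 - \<beta>\<^sup>2 + 2 * c\<^sup>2 / d + (ival fst 0 xs + \<kappa>\<^sup>2 * I 1 + 2 * \<kappa> * c * I 2 + c\<^sup>2 * I 3)"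
proof -
  define w where "w t = fst (stp xs t)" for t
  define \<omega> where "\<omega> t = snd (stp xs t)" for t
  have [measurable]: "w \<in> borel_measurable borel" "\<omega> \<in> borel_measurable borel"
    unfolding w_def \<omega>_def by (rule stp_measurable[OF xs(2)])+
  define S where "S = snd ` set xs"
  have S: "finite S" "S \<noteq> {}" "stp xs t \<in> S" for t using xs(2) stp_in[OF xs(2)] by (auto simp: S_def)
  define \<epsilon> where "\<epsilon> = Min (fst ` S)"
  define B where "B = Max (snd ` S)"
  have Spos: "0 < fst v" "fst v \<le> snd v" if "v \<in> S" for v using that pieces by (auto simp: S_def)
  have \<epsilon>: "0 < \<epsilon>" "\<epsilon> \<le> w t" for t unfolding \<epsilon>_def w_def using S Spos by (auto simp: Min_gr_iff)
  have B: "\<omega> t \<le> B" for t unfolding B_def \<omega>_def using S by auto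
  have wo: "w t \<le> \<omega> t" "0 < w t" for t unfolding w_def \<omega>_def using Spos[OF S(3)] by auto
  have I: "integrable exp1 (\<lambda>t. 1 / w t * t ^ j)" "(\<integral>t. 1 / w t * t ^ j \<partial>exp1) = I j" for j
    unfolding w_def I_def using ival_integral[OF xs, of "\<lambda>v. 1 / fst v" j] by simp_all
  have W: "integrable exp1 w" "(\<integral>t. w t \<partial>exp1) = ival fst 0 xs"
    unfolding w_def using ival_integral[OF xs, of fst 0] by simp_all
  have O: "integrable exp1 (\<lambda>t. 1 / \<omega> t)" "(\<integral>t. 1 / \<omega> t \<partial>exp1) = ival (\<lambda>v. 1 / snd v) 0 xs"
    unfolding \<omega>_def using ival_integral[OF xs, of "\<lambda>v. 1 / snd v" 0] by simp_all
  have I0: "integrable exp1 (\<lambda>t. 1 / w t)" "(\<integral>t. 1 / w t \<partial>exp1) = I 0" using I[of 0] by simp_all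
  have "Re (Bf d f g) \<le> (a - \<beta>)\<^sup>2 - \<beta>\<^sup>2 + 2 * c\<^sup>2 / d + (\<integral>t. w t + t * (\<beta> + c * (t - 2))\<^sup>2 / w t \<partial>exp1)"
  proof (rule certificate_bound[OF f g lin, where \<omega> = \<omega> and \<epsilon> = \<epsilon> and B = B])
    fix t :: real assume t: "0 \<le> t"
    obtain k where k: "(k, stp xs t) \<in> set xs" "real k / 20 \<le> t"
      using stp_mem[OF xs(1,2), of t] t xs(3) by auto
    have "\<omega> t * w t \<le> (w t)\<^sup>2 + real k / 20 * (\<kappa> + c * (real k / 20))\<^sup>2"
      using bspec[OF pieces k(1)] by (auto simp: w_def \<omega>_def split: prod.splits)
    also have "real k / 20 * (\<kappa> + c * (real k / 20))\<^sup>2 \<le> t * (\<kappa> + c * t)\<^sup>2"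
      using k(2) c t by (intro mult_mono power_mono add_left_mono mult_left_mono) auto
    also have "\<kappa> + c * t = \<beta> + c * (t - 2)" by (simp add: \<kappa>_def algebra_simps)
    finally show "\<omega> t \<le> w t + t * (\<beta> + c * (t - 2))\<^sup>2 / w t"
      using wo(2)[of t] by (simp add: field_simps power2_eq_square)
  next
    fix p r :: nat assume "p \<le> 2" "r \<le> 1" "p \<noteq> 0 \<or> r \<noteq> 0"
    then consider "p = 1" "r = 0" | "p = 2" "r = 0" | "p = 0" "r = 1" | "p = 1" "r = 1" | "p = 2" "r = 1" by linarith
    then show "d * ((\<integral>t. 1 / w t * hn p r t \<partial>exp1) / fact p) \<le> 1"
    proof cases
      case 1 then show ?thesis using I(2)[of 1] c1 by (simp add: hn_def)
    next
      case 2 then show ?thesis using I(2)[of 2] c2 by (simp add: hn_def fact_2)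
    next
      case 3 then show ?thesis using I(2)[of 1] c1 by (simp add: hn_def)
    next
      case 4
      have "(\<integral>t. 1 / w t * hn p r t \<partial>exp1) = (\<integral>t. 1 / w t * t ^ 2 - 2 * (1 / w t * t ^ 1) + 1 / w t * t ^ 0 \<partial>exp1)"
        using 4 by (intro Bochner_Integration.integral_cong refl) (simp add: hn_def power2_eq_square algebra_simps)
      also have "\<dots> = I 2 - 2 * I 1 + I 0"
        by (subst Bochner_Integration.integral_add Bochner_Integration.integral_diff Bochner_Integration.integral_mult_right_zero
          | intro Bochner_Integration.integrable_diff integrable_mult_right I | simp only: I)+
      finally show ?thesis using c3 4 by simp
    next
      case 5
      have "(\<integral>t. 1 / w t * hn p r t \<partial>exp1) = (\<integral>t. 1 / w t * t ^ 3 - 4 * (1 / w t * t ^ 2) + 4 * (1 / w t * t ^ 1) \<partial>exp1)"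
        using 5 by (intro Bochner_Integration.integral_cong refl) (simp add: hn_def power2_eq_square power3_eq_cube algebra_simps)
      also have "\<dots> = I 3 - 4 * I 2 + 4 * I 1"
        by (subst Bochner_Integration.integral_add Bochner_Integration.integral_diff Bochner_Integration.integral_mult_right_zero
          | intro Bochner_Integration.integrable_diff integrable_mult_right I | simp only: I)+
      finally show ?thesis using c4 5 by (simp add: fact_2)
    qed
  next
    show "d * (\<integral>t. (1 / \<omega> t + 1 / w t) / 2 \<partial>exp1) \<le> 1"
      using O I0 c0 by (simp add: algebra_simps)
  qed (use \<epsilon> B wo d in auto)
  also have "(\<integral>t. w t + t * (\<beta> + c * (t - 2))\<^sup>2 / w t \<partial>exp1)
    = (\<integral>t. w t + (\<kappa>\<^sup>2 * (1 / w t * t ^ 1) + 2 * \<kappa> * c * (1 / w t * t ^ 2) + c\<^sup>2 * (1 / w t * t ^ 3)) \<partial>exp1)"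
    by (intro Bochner_Integration.integral_cong refl)
      (simp add: \<kappa>_def power2_eq_square power3_eq_cube algebra_simps add_divide_distrib diff_divide_distrib)
  also have "\<dots> = ival fst 0 xs + (\<kappa>\<^sup>2 * I 1 + 2 * \<kappa> * c * I 2 + c\<^sup>2 * I 3)"
    by (subst Bochner_Integration.integral_add Bochner_Integration.integral_mult_right_zero
      | intro Bochner_Integration.integrable_add integrable_mult_right I W | simp only: I W)+
  finally show ?thesis by simp
qed

text \<open>Unimodularity gives a <= E|z_1|, which is sqrt(pi) / 2 = 0.886... The AM-GM bound sqrt t
  <= w + t / (4 w) replaces this mean by an integral of step functions, so the same exponential
  enclosures serve here too.\<close>

lemma direction_le:
  fixes f g :: "complex^'n::finite \<Rightarrow> complex" and xs :: "(nat \<times> real) list"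
  assumes f: "unimodular f" and g: "unimodular g"
    and lin: "lin f o1 + lin g o1 = 2 * complex_of_real a"
    and xs: "sorted (map fst xs)" "xs \<noteq> []" "fst (hd xs) = 0" and pos: "\<forall>v\<in>snd ` set xs. 0 < v"
  shows "a \<le> ival id 0 xs + ival (\<lambda>v. 1 / v) 1 xs / 4"
proof -
  define w where "w t = stp xs t" for t
  have w: "0 < w t" for t unfolding w_def using stp_in[OF xs(2)] pos by blast
  have [measurable]: "w \<in> borel_measurable borel"
    unfolding w_def using stp_measurable[OF xs(2), of id] by simp
  define m where "m t = w t + (1 / 4) * (1 / w t * t ^ 1)" for t
  have [measurable]: "m \<in> borel_measurable borel" by (simp add: m_def[abs_def])
  have i: "integrable exp1 w" "(\<integral>t. w t \<partial>exp1) = ival id 0 xs" "integrable exp1 (\<lambda>t. 1 / w t * t ^ 1)"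
    "(\<integral>t. 1 / w t * t ^ 1 \<partial>exp1) = ival (\<lambda>v. 1 / v) 1 xs"
    unfolding w_def using ival_integral[OF xs, of id 0] ival_integral[OF xs, of "\<lambda>v. 1 / v" 1] by simp_all
  have i4: "integrable exp1 (\<lambda>t. (1 / 4) * (1 / w t * t ^ 1))"
    by (rule integrable_mult_right[OF i(3)])
  have m: "integrable exp1 m" "(\<integral>t. m t \<partial>exp1) = ival id 0 xs + ival (\<lambda>v. 1 / v) 1 xs / 4"
    unfolding m_def using Bochner_Integration.integrable_add[OF i(1) i4] apply assumption
    unfolding Bochner_Integration.integral_add[OF i(1) i4] integral_mult_right_zero i by simp
  have mi: "integrable cgauss (\<lambda>z. m ((cmod z)\<^sup>2))" using integral_cgauss_radial(2)[of m] m(1) by simp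
  note mg = integrable_gauss_coord[OF mi, of o1]
  define F where "F x = (f x * cnj (x $h o1) + g x * cnj (x $h o1)) / 2" for x
  have Fi: "integrable gauss F"
    unfolding F_def using integrable_lin[OF unimodularD(1)[OF f] unimodularD(3)[OF f], of o1]
      integrable_lin[OF unimodularD(1)[OF g] unimodularD(3)[OF g], of o1] by simp
  have "(\<integral>x. F x \<partial>gauss) = (lin f o1 + lin g o1) / 2"
    unfolding F_def lin_def using integrable_lin[OF unimodularD(1)[OF f] unimodularD(3)[OF f], of o1]
      integrable_lin[OF unimodularD(1)[OF g] unimodularD(3)[OF g], of o1] by simp
  then have "a = (\<integral>x. Re (F x) \<partial>gauss)" unfolding integral_Re[OF Fi] by (simp add: lin)
  also have "\<dots> \<le> (\<integral>x. m ((cmod (x $h o1))\<^sup>2) \<partial>gauss)"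
  proof (rule integral_mono[OF integrable_Re[OF Fi] mg(1)])
    fix x :: "complex^'n"
    let ?r = "cmod (x $h o1)"
    have "Re (F x) \<le> cmod (F x)" by (rule complex_Re_le_cmod)
    also have "cmod (F x) \<le> (cmod (f x * cnj (x $h o1)) + cmod (g x * cnj (x $h o1))) / 2"
      unfolding F_def norm_divide using norm_triangle_ineq[of "f x * cnj (x $h o1)" "g x * cnj (x $h o1)"] by simp
    also have "\<dots> = ?r" by (simp add: norm_mult unimodularD(2)[OF f] unimodularD(2)[OF g])
    also have "?r \<le> m (?r\<^sup>2)"
    proof -
      have "0 \<le> (2 * w (?r\<^sup>2) - ?r)\<^sup>2 / (4 * w (?r\<^sup>2))" using w[of "?r\<^sup>2"] by simp
      also have "\<dots> = m (?r\<^sup>2) - ?r"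
        using w[of "?r\<^sup>2"] by (simp add: m_def power2_eq_square field_simps)
      finally show ?thesis by simp
    qed
    finally show "Re (F x) \<le> m (?r\<^sup>2)" .
  qed
  also have "\<dots> = (\<integral>t. m t \<partial>exp1)" unfolding mg(2) using integral_cgauss_radial(1)[of m] by simp
  finally show ?thesis unfolding m(2) .
qed

section \<open>Rational enclosures of exp(-k/20)\<close>

lemma ex_one_bounds: "ex 1 \<in> {9512294245006/10^13..9512294245009/10^13}"
proof -
  obtain t where t: "\<bar>t\<bar> \<le> \<bar>- (1/20::real)\<bar>" "exp (- (1/20)) = (\<Sum>m<8. (- (1/20)) ^ m / fact m) + exp t / fact 8 * (- (1/20::real)) ^ 8"
    using Maclaurin_exp_le[of "- (1/20)" 8] by blast
  \<comment> \<open>A crude bound is enough: the remainder carries the factor (1/20)^8 / 8!, which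
    is below 10^(-15).\<close>
  have "exp t \<le> exp 1" using t(1) by simp
  then have "exp t \<le> 3" using exp_le by linarith
  then show ?thesis using t(2) exp_ge_zero[of t] unfolding ex_def
    by (simp add: fact_numeral eval_nat_numeral del: exp_ge_zero)
qed

lemma ex_add: "ex (a + b) = ex a * ex b"
  by (simp add: ex_def add_divide_distrib flip: exp_add)

text \<open>Drives an addition chain: each exponent below is a sum of two earlier ones, and the
  product of their enclosures is rounded outward to eleven decimals.\<close>

lemma ex_add_bounds:
  assumes "ex a \<in> {l1..u1}" "ex b \<in> {l2..u2}" "0 \<le> l1" "0 \<le> l2" "l \<le> l1 * l2" "u1 * u2 \<le> u" "k = a + b"
  shows "ex k \<in> {l..u}"
proof -
  have "l1 * l2 \<le> ex a * ex b" "ex a * ex b \<le> u1 * u2"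
    using assms(1-4) by (auto intro!: mult_mono simp: ex_def)
  then show ?thesis using assms(5,6) unfolding assms(7) ex_add by simp
qed

lemma ex_bounds_2: "ex 2 \<in> {90483741803/10^11..90483741804/10^11}"
  by (rule ex_add_bounds[OF ex_one_bounds ex_one_bounds]) simp_all

lemma ex_bounds_4: "ex 4 \<in> {81873075306/10^11..81873075309/10^11}"
  by (rule ex_add_bounds[OF ex_bounds_2 ex_bounds_2]) simp_all

lemma ex_bounds_6: "ex 6 \<in> {74081822066/10^11..74081822070/10^11}"
  by (rule ex_add_bounds[OF ex_bounds_4 ex_bounds_2]) simp_all

lemma ex_bounds_8: "ex 8 \<in> {67032004600/10^11..67032004606/10^11}"
  by (rule ex_add_bounds[OF ex_bounds_4 ex_bounds_4]) simp_all

lemma ex_bounds_10: "ex 10 \<in> {60653065967/10^11..60653065974/10^11}"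
  by (rule ex_add_bounds[OF ex_bounds_8 ex_bounds_2]) simp_all

lemma ex_bounds_11: "ex 11 \<in> {57694981033/10^11..57694981041/10^11}"
  by (rule ex_add_bounds[OF ex_bounds_10 ex_one_bounds]) simp_all

lemma ex_bounds_13: "ex 13 \<in> {52204577671/10^11..52204577680/10^11}"
  by (rule ex_add_bounds[OF ex_bounds_11 ex_bounds_2]) simp_all

lemma ex_bounds_14: "ex 14 \<in> {49658530374/10^11..49658530383/10^11}"
  by (rule ex_add_bounds[OF ex_bounds_13 ex_one_bounds]) simp_all

lemma ex_bounds_17: "ex 17 \<in> {42741493189/10^11..42741493199/10^11}"
  by (rule ex_add_bounds[OF ex_bounds_13 ex_bounds_4]) simp_all

lemma ex_bounds_19: "ex 19 \<in> {38674102339/10^11..38674102350/10^11}"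
  by (rule ex_add_bounds[OF ex_bounds_17 ex_bounds_2]) simp_all

lemma ex_bounds_21: "ex 21 \<in> {34993774905/10^11..34993774916/10^11}"
  by (rule ex_add_bounds[OF ex_bounds_19 ex_bounds_2]) simp_all

lemma ex_bounds_26: "ex 26 \<in> {27253179298/10^11..27253179308/10^11}"
  by (rule ex_add_bounds[OF ex_bounds_13 ex_bounds_13]) simp_all

lemma ex_bounds_32: "ex 32 \<in> {20189651794/10^11..20189651804/10^11}"
  by (rule ex_add_bounds[OF ex_bounds_26 ex_bounds_6]) simp_all

lemma ex_bounds_34: "ex 34 \<in> {18268352400/10^11..18268352410/10^11}"
  by (rule ex_add_bounds[OF ex_bounds_32 ex_bounds_2]) simp_all

lemma ex_bounds_40: "ex 40 \<in> {13533528319/10^11..13533528328/10^11}"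
  by (rule ex_add_bounds[OF ex_bounds_34 ex_bounds_6]) simp_all

lemma ex_bounds_50: "ex 50 \<in> {8208499858/10^11..8208499866/10^11}"
  by (rule ex_add_bounds[OF ex_bounds_40 ex_bounds_10]) simp_all

lemma ex_bounds_63: "ex 63 \<in> {4285212683/10^11..4285212689/10^11}"
  by (rule ex_add_bounds[OF ex_bounds_50 ex_bounds_13]) simp_all

lemma ex_bounds_82: "ex 82 \<in> {1657267538/10^11..1657267542/10^11}"
  by (rule ex_add_bounds[OF ex_bounds_63 ex_bounds_19]) simp_all

lemma ex_bounds_114: "ex 114 \<in> {334596545/10^11..334596547/10^11}"
  by (rule ex_add_bounds[OF ex_bounds_82 ex_bounds_32]) simp_all

lemmas ex_mem =
  ex_bounds_2 ex_bounds_4 ex_bounds_6 ex_bounds_8 ex_bounds_10 ex_bounds_11 ex_bounds_13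
  ex_bounds_14 ex_bounds_17 ex_bounds_19 ex_bounds_21 ex_bounds_26 ex_bounds_32 ex_bounds_34
  ex_bounds_40 ex_bounds_50 ex_bounds_63 ex_bounds_82 ex_bounds_114

lemmas ex_bounds = ex_mem[simplified, THEN conjunct1] ex_mem[simplified, THEN conjunct2]

lemma exp_tail_poly_eval:
  "exp_tail_poly (Suc 0) t = t + 1" "exp_tail_poly 2 t = t\<^sup>2 + 2 * t + 2" "exp_tail_poly 3 t = t ^ 3 + 3 * t\<^sup>2 + 6 * t + 6"
  by (simp_all add: numeral_2_eq_2 numeral_3_eq_3 algebra_simps)

lemma ex_0: "ex 0 = 1"
  by (simp add: ex_def)

text \<open>The lists below come from a numerical optimization, rounded to three decimals.\<close>

definition pieces_large :: "(nat \<times> real \<times> real) list" where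
  "pieces_large = [(0,213/1000,213/1000),(2,34/125,41/100),(4,169/500,71/125),(6,399/1000,703/1000),(8,117/250,413/500),
    (11,109/200,99/100),(14,619/1000,143/125),(17,351/500,1293/1000),(21,161/200,371/250),
    (26,93/100,429/250),(32,217/200,249/125),(40,643/500,2357/1000),(50,193/125,2817/1000),
    (63,953/500,429/125),(82,2479/1000,437/100),(114,1797/500,6079/1000)]"

text \<open>The enclosures are two-sided because the conditions for the bidegrees (1, 1) and (2, 1)
  contain moments with negative sign.\<close>

lemma pieces_large_values:
  shows "2059943/1000000 \<le> ival (\<lambda>v. 1 / fst v) 0 pieces_large"
    and "ival (\<lambda>v. 1 / fst v) 0 pieces_large \<le> 2059946/1000000"
    and "1140571/1000000 \<le> ival (\<lambda>v. 1 / fst v) (Suc 0) pieces_large"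
    and "ival (\<lambda>v. 1 / fst v) (Suc 0) pieces_large \<le> 1140574/1000000"
    and "1542631/1000000 \<le> ival (\<lambda>v. 1 / fst v) 2 pieces_large"
    and "ival (\<lambda>v. 1 / fst v) 2 pieces_large \<le> 1542634/1000000"
    and "3476621/1000000 \<le> ival (\<lambda>v. 1 / fst v) 3 pieces_large"
    and "ival (\<lambda>v. 1 / fst v) 3 pieces_large \<le> 3476624/1000000"
    and "ival (\<lambda>v. 1 / snd v) 0 pieces_large \<le> 1383333/1000000"
    and "ival fst 0 pieces_large \<le> 707037/1000000"
  unfolding pieces_large_def ival.simps exp_tail_poly_eval exp_tail_poly.simps(1) ex_0 fst_conv snd_conv
  by (simp_all add: power2_eq_square power3_eq_cube, simp_all only: add_divide_distrib diff_divide_distrib) (use ex_bounds in linarith)+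

text \<open>The vertex 83/100 is the midpoint of the range from 767/1000 to 893/1000 in which this
  bound is applied. With c = 114/1000 the tangent point - 2 c / d = -0.39... lies near - sqrt(pi) /
  4 = -0.44..., the cubic coefficient of the phase of z_1.\<close>

lemma Re_Bf_le_large:
  fixes f g :: "complex^'n::finite \<Rightarrow> complex"
  assumes f: "unimodular f" and g: "unimodular g"
    and lin: "\<And>l. lin f l + lin g l = (if l = o1 then 2 * complex_of_real a else 0)"
  shows "Re (Bf (58/100) f g) \<le> (a - 83/100)\<^sup>2 + 73325/100000"
proof -
  note v = pieces_large_values
  have "Re (Bf (58/100) f g) \<le> (a - 83/100)\<^sup>2 - (83/100)\<^sup>2 + 2 * (114/1000)\<^sup>2 / (58/100)
      + (ival fst 0 pieces_large + (83/100 - 2 * (114/1000))\<^sup>2 * ival (\<lambda>v. 1 / fst v) 1 pieces_large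
      + 2 * (83/100 - 2 * (114/1000)) * (114/1000) * ival (\<lambda>v. 1 / fst v) 2 pieces_large + (114/1000)\<^sup>2 * ival (\<lambda>v. 1 / fst v) 3 pieces_large)"
  proof (rule list_certificate[OF f g lin])
    show "\<forall>(k, w, \<omega>)\<in>set pieces_large. 0 < w \<and> w \<le> \<omega> \<and> \<omega> * w \<le> w\<^sup>2 + real k / 20 * ((83/100 - 2 * (114/1000)) + 114/1000 * (real k / 20))\<^sup>2"
      by (simp add: pieces_large_def power2_eq_square)
    show "sorted (map fst pieces_large)" "pieces_large \<noteq> []" "fst (hd pieces_large) = 0"
      by (simp_all add: pieces_large_def)
  qed (use v in simp_all)
  then show ?thesis using v by (simp add: power2_eq_square)
qed

definition pieces_mid :: "(nat \<times> real \<times> real) list" where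
  "pieces_mid = [(0,48/125,48/125),(4,411/1000,513/1000),(10,497/1000,361/500),(19,161/250,1007/1000),
    (34,447/500,1437/1000),(63,1403/1000,1117/500)]"

lemma pieces_mid_values:
  shows "1934402/1000000 \<le> ival (\<lambda>v. 1 / fst v) 0 pieces_mid"
    and "ival (\<lambda>v. 1 / fst v) 0 pieces_mid \<le> 1934405/1000000"
    and "1420336/1000000 \<le> ival (\<lambda>v. 1 / fst v) (Suc 0) pieces_mid"
    and "ival (\<lambda>v. 1 / fst v) (Suc 0) pieces_mid \<le> 1420339/1000000"
    and "2209125/1000000 \<le> ival (\<lambda>v. 1 / fst v) 2 pieces_mid"
    and "ival (\<lambda>v. 1 / fst v) 2 pieces_mid \<le> 2209128/1000000"
    and "5508787/1000000 \<le> ival (\<lambda>v. 1 / fst v) 3 pieces_mid"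
    and "ival (\<lambda>v. 1 / fst v) 3 pieces_mid \<le> 5508790/1000000"
    and "ival (\<lambda>v. 1 / snd v) 0 pieces_mid \<le> 1509249/1000000"
    and "ival fst 0 pieces_mid \<le> 582602/1000000"
  unfolding pieces_mid_def ival.simps exp_tail_poly_eval exp_tail_poly.simps(1) ex_0 fst_conv snd_conv
  by (simp_all add: power2_eq_square power3_eq_cube, simp_all only: add_divide_distrib diff_divide_distrib) (use ex_bounds in linarith)+

lemma Re_Bf_le_mid:
  fixes f g :: "complex^'n::finite \<Rightarrow> complex"
  assumes f: "unimodular f" and g: "unimodular g"
    and lin: "\<And>l. lin f l + lin g l = (if l = o1 then 2 * complex_of_real a else 0)"
  shows "Re (Bf (58/100) f g) \<le> (a - 55/100)\<^sup>2 + 6895/10000"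
proof -
  note v = pieces_mid_values
  have "Re (Bf (58/100) f g) \<le> (a - 55/100)\<^sup>2 - (55/100)\<^sup>2 + 2 * (51/1000)\<^sup>2 / (58/100)
      + (ival fst 0 pieces_mid + (55/100 - 2 * (51/1000))\<^sup>2 * ival (\<lambda>v. 1 / fst v) 1 pieces_mid
      + 2 * (55/100 - 2 * (51/1000)) * (51/1000) * ival (\<lambda>v. 1 / fst v) 2 pieces_mid + (51/1000)\<^sup>2 * ival (\<lambda>v. 1 / fst v) 3 pieces_mid)"
  proof (rule list_certificate[OF f g lin])
    show "\<forall>(k, w, \<omega>)\<in>set pieces_mid. 0 < w \<and> w \<le> \<omega> \<and> \<omega> * w \<le> w\<^sup>2 + real k / 20 * ((55/100 - 2 * (51/1000)) + 51/1000 * (real k / 20))\<^sup>2"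
      by (simp add: pieces_mid_def power2_eq_square)
    show "sorted (map fst pieces_mid)" "pieces_mid \<noteq> []" "fst (hd pieces_mid) = 0"
      by (simp_all add: pieces_mid_def)
  qed (use v in simp_all)
  then show ?thesis using v by (simp add: power2_eq_square)
qed

text \<open>A single piece with both weights equal to d, and no linearization: this is the plain
  estimate d |P_3 q|^2 <= d |q|^2 <= d.\<close>

lemma Re_Bf_le_small:
  fixes f g :: "complex^'n::finite \<Rightarrow> complex"
  assumes f: "unimodular f" and g: "unimodular g"
    and lin: "\<And>l. lin f l + lin g l = (if l = o1 then 2 * complex_of_real a else 0)"
  shows "Re (Bf (58/100) f g) \<le> (a - 0)\<^sup>2 + 58/100"
  using list_certificate[OF f g lin, of "[(0, 58/100, 58/100)]" "58/100" 0 0]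
  by (simp add: ex_0 exp_tail_poly_eval power2_eq_square)

text \<open>The values approximate sqrt t / 2, where the AM-GM inequality in
  \<open>direction_le\<close> is an equality.\<close>

definition direction_pieces :: "(nat \<times> real) list" where
  "direction_pieces = [(0,11/100),(2,11/50),(6,17/50),(13,12/25),(26,67/100),(50,47/50)]"

lemma direction_pieces_value: "ival id 0 direction_pieces + ival (\<lambda>v. 1 / v) (Suc 0) direction_pieces / 4 \<le> 893/1000"
  unfolding direction_pieces_def ival.simps exp_tail_poly_eval exp_tail_poly.simps(1) ex_0 id_apply
  by (simp, simp only: add_divide_distrib diff_divide_distrib) (use ex_bounds in linarith)

section \<open>The scalar bound over all ranges\<close>

lemma Re_Bf_bound:
  fixes f g :: "complex^'n::finite \<Rightarrow> complex"
  assumes "unimodular f" "unimodular g"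
  shows "Re (Bf (58/100) f g) \<le> 7375/10000"
proof -
  obtain f' g' a where fg: "unimodular f'" "unimodular g'" and B: "Bf (58/100) f' g' = Bf (58/100) f g" and a: "0 \<le> a"
    and lin: "\<And>l. lin f' l + lin g' l = (if l = (undefined :: 'n) then 2 * complex_of_real a else 0)"
    using normalize_direction[OF assms] by blast
  have le: "a \<le> 893/1000"
  proof -
    have "a \<le> ival id 0 direction_pieces + ival (\<lambda>v. 1 / v) 1 direction_pieces / 4"
      by (rule direction_le[OF fg]) (use lin[of undefined] in \<open>simp_all add: direction_pieces_def\<close>)
    then show ?thesis using direction_pieces_value unfolding One_nat_def by linarith
  qed
  \<comment> \<open>The three parabolas stay below 0.7375 on these ranges: 0.35^2 + 0.58 = 0.7025,
    0.218^2 + 0.6895 = 0.737024 and 0.064^2 + 0.73325 = 0.737346.\<close>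
  consider "a \<le> 35/100" | "35/100 \<le> a" "a \<le> 767/1000" | "767/1000 \<le> a" by linarith
  then have "Re (Bf (58/100) f' g') \<le> 7375/10000"
  proof cases
    case 1
    have "Re (Bf (58/100) f' g') \<le> (a - 0)\<^sup>2 + 58/100"
      by (rule Re_Bf_le_small[OF fg lin])
    moreover have "a\<^sup>2 \<le> (35/100)\<^sup>2" using 1 a by (rule power_mono)
    ultimately show ?thesis by (simp add: power2_eq_square)
  next
    case 2
    have "Re (Bf (58/100) f' g') \<le> (a - 55/100)\<^sup>2 + 6895/10000"
      by (rule Re_Bf_le_mid[OF fg lin])
    moreover have "(a - 55/100)\<^sup>2 \<le> (218/1000)\<^sup>2"
      using 2 by (intro abs_le_square_iff[THEN iffD1]) linarith
    ultimately show ?thesis by (simp add: power2_eq_square)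
  next
    case 3
    have "Re (Bf (58/100) f' g') \<le> (a - 83/100)\<^sup>2 + 73325/100000"
      by (rule Re_Bf_le_large[OF fg lin])
    moreover have "(a - 83/100)\<^sup>2 \<le> (64/1000)\<^sup>2"
      using 3 le by (intro abs_le_square_iff[THEN iffD1]) linarith
    ultimately show ?thesis by (simp add: power2_eq_square)
  qed
  then show ?thesis by (simp only: B)
qed

text \<open>Multiplying \<open>g\<close> by the phase of the value makes the value real and
  nonnegative, so the bound on real parts suffices.\<close>

lemma cmod_Bf_bound:
  fixes f g :: "complex^'n::finite \<Rightarrow> complex"
  assumes f: "unimodular f" and g: "unimodular g"
  shows "cmod (Bf (58/100) f g) \<le> 7375/10000"
proof -
  define u where "u = uph (Bf (58/100) f g)"
  have u: "cmod u = 1" by (simp add: u_def)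
  have ug: "unimodular (\<lambda>x. u * g x)" using g u by (auto simp: unimodular_def norm_mult)
  have "lin (\<lambda>x. u * g x) l = u * lin g l" "coef (\<lambda>x. u * g x) I = u * coef g I" for l I
    by (simp_all add: lin_def coef_def mult.assoc)
  then have "Bf (58/100) f (\<lambda>x. u * g x) = cnj u * Bf (58/100) f g"
    by (simp add: Bf_def sum_distrib_left right_diff_distrib mult_ac sum_divide_distrib)
  also have "\<dots> = of_real (cmod (Bf (58/100) f g)) * (cnj u * u)"
    using uph_times_cmod[of "Bf (58/100) f g"] unfolding u_def by (metis mult.left_commute)
  also have "cnj u * u = 1" using complex_norm_square[of u] u by (simp add: mult.commute)
  finally have "Re (Bf (58/100) f (\<lambda>x. u * g x)) = cmod (Bf (58/100) f g)" by simp
  then show ?thesis using Re_Bf_bound[OF f ug] by simp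
qed

section \<open>The value on directions\<close>

lemma integral_coord_coord: "(\<integral>x. x $h m * cnj (x $h k) \<partial>gauss) = of_bool (m = k)"
  and integrable_coord_coord: "integrable gauss (\<lambda>x. x $h m * cnj (x $h k))" for m k :: "'n::finite"
proof -
  let ?f = "\<lambda>l z. herm (of_bool (m = l)) 0 z * cnj (herm (of_bool (k = l)) 0 z)"
  have i: "integrable cgauss (?f l)" for l by (intro slow_integrable slow_intros)
  have "x $h m = (\<Prod>l\<in>UNIV. if l = m then x $h l else 1)" for x :: "complex^'n" and m by simp
  also have "(\<Prod>l\<in>UNIV. if l = m then x $h l else 1) = (\<Prod>l\<in>UNIV. herm (of_bool (m = l)) 0 (x $h l))" for x :: "complex^'n" and m
    by (intro prod.cong) (auto simp: herm_def)
  finally have c: "x $h m = (\<Prod>l\<in>UNIV. herm (of_bool (m = l)) 0 (x $h l))" for x :: "complex^'n" and m .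
  have e: "x $h m * cnj (x $h k) = (\<Prod>l\<in>UNIV. ?f l (x $h l))" for x :: "complex^'n"
    unfolding c[of x m] c[of x k] by (simp add: prod.distrib)
  show "integrable gauss (\<lambda>x. x $h m * cnj (x $h k))"
    unfolding e by (rule integrable_gauss_prod[of ?f, OF i])
  have "(\<integral>x. x $h m * cnj (x $h k) \<partial>gauss) = (\<Prod>l\<in>UNIV. \<integral>z. ?f l z \<partial>cgauss)"
    unfolding e by (rule integral_gauss_prod[of ?f, OF i])
  also have "\<dots> = (\<Prod>l\<in>UNIV. if (m = l) = (k = l) then 1 else 0)"
    by (intro prod.cong refl) (auto simp: herm_orthogonal)
  also have "\<dots> = of_bool (m = k)"
    by (cases "m = k") (auto intro!: prod_zero)
  finally show "(\<integral>x. x $h m * cnj (x $h k) \<partial>gauss) = of_bool (m = k)" .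
qed

text \<open>At the coordinate carrying the antiholomorphic degree of \<open>h3 I\<close>, a
  holomorphic polynomial is integrated against the conjugate of one with \<open>q = 1\<close>, and
  that factor vanishes.\<close>

lemma integral_coord_h3: "(\<integral>x. x $h m * cnj (h3 I x) \<partial>gauss) = 0"
  and integrable_coord_h3: "integrable gauss (\<lambda>x. x $h m * cnj (h3 I x))" for m :: "'n::finite"
proof -
  let ?f = "\<lambda>l z. herm (of_bool (m = l)) 0 z * cnj (herm (hp I l) (hq I l) z)"
  have i: "integrable cgauss (?f l)" for l by (intro slow_integrable slow_intros)
  have "x $h m = (\<Prod>l\<in>UNIV. if l = m then x $h l else 1)" for x :: "complex^'n" by simp
  also have "(\<Prod>l\<in>UNIV. if l = m then x $h l else 1) = (\<Prod>l\<in>UNIV. herm (of_bool (m = l)) 0 (x $h l))" for x :: "complex^'n"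
    by (intro prod.cong) (auto simp: herm_def)
  finally have e: "x $h m * cnj (h3 I x) = (\<Prod>l\<in>UNIV. ?f l (x $h l))" for x :: "complex^'n"
    by (simp only: h3_def cnj_prod prod.distrib)
  show "integrable gauss (\<lambda>x. x $h m * cnj (h3 I x))"
    unfolding e by (rule integrable_gauss_prod[of ?f, OF i])
  obtain l where l: "hq I l \<noteq> 0"
    using sum_hq[of I] by (metis one_neq_zero sum.neutral)
  have z: "(\<integral>z. ?f l z \<partial>cgauss) = 0"
    using herm_orthogonal[of 0 "hq I l" "of_bool (m = l)" "hp I l"] hq_le_1[of I l] l by simp
  have "(\<Prod>l\<in>UNIV. \<integral>z. ?f l z \<partial>cgauss) = 0"
  proof (rule prod_zero)
    show "\<exists>a\<in>UNIV. (\<integral>z. ?f a z \<partial>cgauss) = 0" using z by blast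
  qed simp
  then show "(\<integral>x. x $h m * cnj (h3 I x) \<partial>gauss) = 0"
    unfolding e using integral_gauss_prod[of ?f, OF i] by simp
qed

lemma lam_one: "q \<le> 1 \<Longrightarrow> lam (\<lambda>_. 1) p q = 1"
  using herm_orthogonal[of q q p p] by (simp add: lam_def)

text \<open>Obtained by expanding the mean of |f - P_1 f - P_3 f|^2, which is nonnegative. The
  constant weight 1 turns \<open>integral_quad\<close> into the norm of the cubic part.\<close>

lemma bessel:
  fixes f :: "complex^'n::finite \<Rightarrow> complex"
  assumes f: "f \<in> borel_measurable borel" "\<And>x. cmod (f x) \<le> B"
  shows "(\<Sum>m\<in>UNIV. (cmod (lin f m))\<^sup>2) + (\<Sum>I\<in>UNIV. (cmod (coef f I))\<^sup>2) / 2 \<le> (\<integral>x. (cmod (f x))\<^sup>2 \<partial>gauss)"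
proof -
  note f(1)[measurable]
  define S where "S = (\<Sum>m\<in>UNIV. (cmod (lin f m))\<^sup>2) + (\<Sum>I\<in>UNIV. (cmod (coef f I))\<^sup>2) / 2"
  define G1 where "G1 x = (\<Sum>m\<in>UNIV. lin f m * x $h m)" for x
  define G3 where "G3 x = (\<Sum>I\<in>UNIV. (coef f I / 2) * h3 I x)" for x
  have sq: "of_real ((cmod u)\<^sup>2) = u * cnj u" for u by (rule complex_norm_square)
  have a1: "integrable gauss (\<lambda>x. f x * cnj (G1 x))" "(\<integral>x. f x * cnj (G1 x) \<partial>gauss) = (\<Sum>m\<in>UNIV. of_real ((cmod (lin f m))\<^sup>2))"
  proof -
    have e: "f x * cnj (G1 x) = (\<Sum>m\<in>UNIV. cnj (lin f m) * (f x * cnj (x $h m)))" for x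
      unfolding G1_def cnj_sum sum_distrib_left by (intro sum.cong refl) simp
    note i = integrable_lin[OF f]
    show "integrable gauss (\<lambda>x. f x * cnj (G1 x))"
      unfolding e by (intro Bochner_Integration.integrable_sum integrable_mult_right i)
    have "(\<integral>x. f x * cnj (G1 x) \<partial>gauss) = (\<Sum>m\<in>UNIV. cnj (lin f m) * lin f m)"
      unfolding e by (simp add: i lin_def[of f])
    then show "(\<integral>x. f x * cnj (G1 x) \<partial>gauss) = (\<Sum>m\<in>UNIV. of_real ((cmod (lin f m))\<^sup>2))"
      unfolding sq by (simp add: mult.commute)
  qed
  have a3: "integrable gauss (\<lambda>x. f x * cnj (G3 x))" "(\<integral>x. f x * cnj (G3 x) \<partial>gauss) = (\<Sum>I\<in>UNIV. of_real ((cmod (coef f I))\<^sup>2)) / 2"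
  proof -
    have e: "f x * cnj (G3 x) = (\<Sum>I\<in>UNIV. (cnj (coef f I) / 2) * (f x * cnj (h3 I x)))" for x
      unfolding G3_def cnj_sum sum_distrib_left by (intro sum.cong refl) simp
    note i = integrable_coef[OF f]
    show "integrable gauss (\<lambda>x. f x * cnj (G3 x))"
      unfolding e by (intro Bochner_Integration.integrable_sum integrable_mult_right i)
    have "(\<integral>x. f x * cnj (G3 x) \<partial>gauss) = (\<Sum>I\<in>UNIV. (cnj (coef f I) / 2) * coef f I)"
      unfolding e by (simp add: i coef_def[of f])
    then show "(\<integral>x. f x * cnj (G3 x) \<partial>gauss) = (\<Sum>I\<in>UNIV. of_real ((cmod (coef f I))\<^sup>2)) / 2"
      unfolding sq sum_divide_distrib by (simp add: mult.commute)
  qed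
  have b11: "integrable gauss (\<lambda>x. G1 x * cnj (G1 x))" "(\<integral>x. G1 x * cnj (G1 x) \<partial>gauss) = (\<Sum>m\<in>UNIV. of_real ((cmod (lin f m))\<^sup>2))"
  proof -
    have e: "G1 x * cnj (G1 x) = (\<Sum>m\<in>UNIV. \<Sum>k\<in>UNIV. (lin f m * cnj (lin f k)) * (x $h m * cnj (x $h k)))" for x
      unfolding G1_def cnj_sum sum_product by (intro sum.cong refl) simp
    show "integrable gauss (\<lambda>x. G1 x * cnj (G1 x))"
      unfolding e by (intro Bochner_Integration.integrable_sum integrable_mult_right integrable_coord_coord)
    have "(\<integral>x. G1 x * cnj (G1 x) \<partial>gauss) = (\<Sum>m\<in>UNIV. \<Sum>k\<in>UNIV. (lin f m * cnj (lin f k)) * of_bool (m = k))"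
      unfolding e by (simp add: integrable_coord_coord integral_coord_coord)
    then show "(\<integral>x. G1 x * cnj (G1 x) \<partial>gauss) = (\<Sum>m\<in>UNIV. of_real ((cmod (lin f m))\<^sup>2))"
      unfolding sq by (simp add: of_bool_def if_distrib cong: if_cong)
  qed
  have b13: "integrable gauss (\<lambda>x. G1 x * cnj (G3 x))" "(\<integral>x. G1 x * cnj (G3 x) \<partial>gauss) = 0"
  proof -
    have e: "G1 x * cnj (G3 x) = (\<Sum>m\<in>UNIV. \<Sum>I\<in>UNIV. (lin f m * cnj (coef f I) / 2) * (x $h m * cnj (h3 I x)))" for x
      unfolding G1_def G3_def cnj_sum sum_product by (intro sum.cong refl) simp
    show "integrable gauss (\<lambda>x. G1 x * cnj (G3 x))"
      unfolding e by (intro Bochner_Integration.integrable_sum integrable_mult_right integrable_coord_h3)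
    show "(\<integral>x. G1 x * cnj (G3 x) \<partial>gauss) = 0"
      unfolding e by (simp add: integrable_coord_h3 integral_coord_h3)
  qed
  have b33: "integrable gauss (\<lambda>x. G3 x * cnj (G3 x))" "(\<integral>x. G3 x * cnj (G3 x) \<partial>gauss) = (\<Sum>I\<in>UNIV. of_real ((cmod (coef f I))\<^sup>2)) / 2"
  proof -
    have c2: "coef f (sw I) / 2 = coef f I / 2" for I by (simp add: coef_sw)
    have m: "(\<lambda>_. 1 :: complex) \<in> borel_measurable borel" "\<And>z::complex. cmod 1 \<le> 1" by simp_all
    show "integrable gauss (\<lambda>x. G3 x * cnj (G3 x))"
      using integrable_quad[where b = "\<lambda>I. coef f I / 2" and a = "\<lambda>I. coef f I / 2", OF m c2] by (simp add: G3_def)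
    have "(\<integral>x. G3 x * cnj (G3 x) \<partial>gauss) = 2 * (\<Sum>I\<in>UNIV. coef f I / 2 * cnj (coef f I / 2) * 1)"
      using integral_quad[where b = "\<lambda>I. coef f I / 2" and a = "\<lambda>I. coef f I / 2", OF m c2]
      by (simp add: G3_def lam_one[OF hq_le_1])
    also have "\<dots> = (\<Sum>I\<in>UNIV. of_real ((cmod (coef f I))\<^sup>2)) / 2"
      unfolding sq by (simp add: sum_distrib_left sum_divide_distrib)
    finally show "(\<integral>x. G3 x * cnj (G3 x) \<partial>gauss) = (\<Sum>I\<in>UNIV. of_real ((cmod (coef f I))\<^sup>2)) / 2" .
  qed
  have ff: "integrable gauss (\<lambda>x. (cmod (f x))\<^sup>2)"
  proof (rule gauss.integrable_const_bound[of _ "B\<^sup>2"], intro AE_I2)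
    fix x show "norm ((cmod (f x))\<^sup>2) \<le> B\<^sup>2" using f(2)[of x] by (simp add: power_mono)
  qed simp
  have pt: "(cmod (f x - G1 x - G3 x))\<^sup>2 = (cmod (f x))\<^sup>2 - 2 * Re (f x * cnj (G1 x)) - 2 * Re (f x * cnj (G3 x))
      + Re (G1 x * cnj (G1 x)) + Re (G3 x * cnj (G3 x)) + 2 * Re (G1 x * cnj (G3 x))" for x
    unfolding cmod_power2 by (simp add: power2_eq_square algebra_simps)
  have Re_int: "(\<integral>x. Re (h x) \<partial>gauss) = Re (\<integral>x. h x \<partial>gauss)" if "integrable gauss h" for h :: "complex^'n \<Rightarrow> complex"
    using integral_Re[OF that] .
  have ii: "integrable gauss (\<lambda>x. Re (f x * cnj (G1 x)))" "integrable gauss (\<lambda>x. Re (f x * cnj (G3 x)))"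
    "integrable gauss (\<lambda>x. Re (G1 x * cnj (G1 x)))" "integrable gauss (\<lambda>x. Re (G3 x * cnj (G3 x)))" "integrable gauss (\<lambda>x. Re (G1 x * cnj (G3 x)))"
    by (rule integrable_Re a1 a3 b11 b33 b13)+
  have "0 \<le> (\<integral>x. (cmod (f x - G1 x - G3 x))\<^sup>2 \<partial>gauss)" by simp
  also have "\<dots> = (\<integral>x. (cmod (f x))\<^sup>2 \<partial>gauss) - 2 * Re (\<integral>x. f x * cnj (G1 x) \<partial>gauss) - 2 * Re (\<integral>x. f x * cnj (G3 x) \<partial>gauss)
      + Re (\<integral>x. G1 x * cnj (G1 x) \<partial>gauss) + Re (\<integral>x. G3 x * cnj (G3 x) \<partial>gauss) + 2 * Re (\<integral>x. G1 x * cnj (G3 x) \<partial>gauss)"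
    unfolding pt using ff ii by (simp add: Re_int[OF a1(1), symmetric] Re_int[OF a3(1), symmetric] Re_int[OF b11(1), symmetric]
      Re_int[OF b13(1), symmetric] Re_int[OF b33(1), symmetric] del: times_complex.sel)
  also have "\<dots> = (\<integral>x. (cmod (f x))\<^sup>2 \<partial>gauss) - S"
    unfolding a1(2) a3(2) b11(2) b13(2) b33(2) S_def by (simp flip: of_real_sum)
  finally show ?thesis unfolding S_def by simp
qed

lemma norm_sq_vec: "(norm x)\<^sup>2 = (\<Sum>l\<in>UNIV. (cmod (x $h l))\<^sup>2)" for x :: "complex^'n::finite"
  by (simp add: norm_vec_def L2_set_def sum_nonneg)

lemma gauss_norm_moments:
  shows "integrable gauss (\<lambda>x::complex^'n::finite. (norm x)\<^sup>2)" "(\<integral>(x::complex^'n). (norm x)\<^sup>2 \<partial>gauss) = CARD('n)"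
    and "integrable gauss (\<lambda>x::complex^'n. (norm x) ^ 4)" "(\<integral>(x::complex^'n). (norm x) ^ 4 \<partial>gauss) = (CARD('n))\<^sup>2 + CARD('n)"
proof -
  have pw: "integrable cgauss (\<lambda>z. (cmod z) ^ (2 * k))" "(\<integral>z. (cmod z) ^ (2 * k) \<partial>cgauss) = fact k" for k
    using integral_cgauss_radial[of "\<lambda>t. t ^ k"] integrable_exp1_power[of k] integral_exp1_power[of k] by (simp_all add: power_mult)
  have c1: "integrable gauss (\<lambda>x::complex^'n. (cmod (x $h l))\<^sup>2)" "(\<integral>(x::complex^'n). (cmod (x $h l))\<^sup>2 \<partial>gauss) = 1" for l
    using integrable_gauss_coord[OF pw(1)[of 1], of l] pw(2)[of 1] by simp_all
  show "integrable gauss (\<lambda>x::complex^'n. (norm x)\<^sup>2)" unfolding norm_sq_vec using c1 by simp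
  show "(\<integral>(x::complex^'n). (norm x)\<^sup>2 \<partial>gauss) = CARD('n)" unfolding norm_sq_vec using c1 by simp
  have c2: "integrable gauss (\<lambda>x::complex^'n. (cmod (x $h l))\<^sup>2 * (cmod (x $h m))\<^sup>2)"
    "(\<integral>(x::complex^'n). (cmod (x $h l))\<^sup>2 * (cmod (x $h m))\<^sup>2 \<partial>gauss) = (if l = m then 2 else 1)" for l m
  proof -
    let ?k = "\<lambda>j. of_bool (j = l) + of_bool (j = m) :: nat"
    have p1: "(\<Prod>j\<in>UNIV. (cmod (x $h j)) ^ (2 * of_bool (j = l))) = (cmod (x $h l))\<^sup>2" for x :: "complex^'n" and l
    proof -
      have "(\<Prod>j\<in>UNIV. (cmod (x $h j)) ^ (2 * of_bool (j = l))) = (\<Prod>j\<in>UNIV. if j = l then (cmod (x $h j))\<^sup>2 else 1)"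
        by (intro prod.cong) auto
      then show ?thesis by simp
    qed
    have e: "(cmod (x $h l))\<^sup>2 * (cmod (x $h m))\<^sup>2 = (\<Prod>j\<in>UNIV. (cmod (x $h j)) ^ (2 * ?k j))" for x :: "complex^'n"
      unfolding distrib_left power_add prod.distrib p1 ..
    note i = pw(1)
    show "integrable gauss (\<lambda>x::complex^'n. (cmod (x $h l))\<^sup>2 * (cmod (x $h m))\<^sup>2)"
      unfolding e using integrable_gauss_prod[of "\<lambda>j z. (cmod z) ^ (2 * ?k j)", OF i] .
    have "(\<integral>(x::complex^'n). (cmod (x $h l))\<^sup>2 * (cmod (x $h m))\<^sup>2 \<partial>gauss) = (\<Prod>j\<in>UNIV. fact (?k j))"
      unfolding e using integral_gauss_prod[of "\<lambda>j z. (cmod z) ^ (2 * ?k j)", OF i] by (simp only: pw(2))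
    also have "\<dots> = (\<Prod>j\<in>UNIV. if j = l then (if l = m then 2 else 1) else 1)"
      by (intro prod.cong) (auto simp: fact_2)
    finally show "(\<integral>(x::complex^'n). (cmod (x $h l))\<^sup>2 * (cmod (x $h m))\<^sup>2 \<partial>gauss) = (if l = m then 2 else 1)" by simp
  qed
  have n4: "(norm x) ^ 4 = (\<Sum>l\<in>UNIV. \<Sum>m\<in>UNIV. (cmod (x $h l))\<^sup>2 * (cmod (x $h m))\<^sup>2)" for x :: "complex^'n"
  proof -
    have "(norm x) ^ 4 = (norm x)\<^sup>2 * (norm x)\<^sup>2" by (simp flip: power_add)
    then show ?thesis unfolding norm_sq_vec sum_product .
  qed
  show "integrable gauss (\<lambda>x::complex^'n. (norm x) ^ 4)" unfolding n4 using c2(1) by simp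
  have "(\<integral>(x::complex^'n). (norm x) ^ 4 \<partial>gauss) = (\<Sum>l\<in>UNIV. \<Sum>m\<in>(UNIV :: 'n set). if l = m then 2 else 1)"
    unfolding n4 using c2 by simp
  also have "\<dots> = (\<Sum>l\<in>(UNIV :: 'n set). \<Sum>m\<in>(UNIV :: 'n set). 1 + (if l = m then 1 else 0))"
    by (intro sum.cong refl) simp
  also have "\<dots> = (CARD('n))\<^sup>2 + CARD('n)" by (simp add: sum.distrib power2_eq_square algebra_simps)
  finally show "(\<integral>(x::complex^'n). (norm x) ^ 4 \<partial>gauss) = (CARD('n))\<^sup>2 + CARD('n)" .
qed

text \<open>In units of sqrt n the minorant (3 v^2 - v^4) / 2 of v touches it at v = 1, where the
  norm concentrates. It involves even powers only, so the second and fourth moments suffice and the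
  Gamma function is avoided.\<close>

lemma gauss_norm_lower:
  "integrable gauss (norm :: complex^'n::finite \<Rightarrow> real)"
  "sqrt (real CARD('n)) * (1 - 1 / (2 * real CARD('n))) \<le> (\<integral>(x::complex^'n). norm x \<partial>gauss)"
proof -
  let ?n = "real CARD('n)"
  let ?s = "sqrt ?n"
  have n: "0 < ?n" by simp
  have s: "0 < ?s" "?s * ?s = ?n" by simp_all
  show i: "integrable gauss (norm :: complex^'n \<Rightarrow> real)"
  proof (rule Bochner_Integration.integrable_bound)
    show "integrable gauss (\<lambda>x::complex^'n. 1 + (norm x)\<^sup>2)" using gauss_norm_moments(1)[where 'n = 'n] by simp
    show "AE x in gauss. norm (norm (x::complex^'n)) \<le> norm (1 + (norm x)\<^sup>2)"
    proof (intro AE_I2)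
      fix x :: "complex^'n"
      have "0 \<le> (norm x - 1)\<^sup>2" by simp
      then have "2 * norm x \<le> 1 + (norm x)\<^sup>2" unfolding power2_diff by simp
      then show "norm (norm x) \<le> norm (1 + (norm x)\<^sup>2)" using norm_ge_zero[of x] zero_le_power2[of "norm x"]
        unfolding real_norm_def by linarith
    qed
  qed simp
  have pt: "(3 / (2 * ?s)) * (norm x)\<^sup>2 - (1 / (2 * ?s ^ 3)) * (norm x) ^ 4 \<le> norm x" for x :: "complex^'n"
  proof -
    define v where "v = norm x / ?s"
    have v: "0 \<le> v" "norm x = v * ?s" using s by (simp_all add: v_def)
    have "0 \<le> v * ((v - 1)\<^sup>2 * (v + 2)) * ?s / 2" using v(1) s by simp
    also have "\<dots> = v * ?s - ((3 / 2) * v\<^sup>2 * ?s - (1 / 2) * v ^ 4 * ?s)"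
      by (simp add: power2_eq_square power4_eq_xxxx field_simps)
    finally have "(3 / 2) * v\<^sup>2 * ?s - (1 / 2) * v ^ 4 * ?s \<le> v * ?s" by simp
    moreover have "(3 / (2 * ?s)) * (norm x)\<^sup>2 = (3 / 2) * v\<^sup>2 * ?s"
      unfolding v(2) using s(1) by (simp add: power2_eq_square field_simps del: real_sqrt_mult_self)
    moreover have "(1 / (2 * ?s ^ 3)) * (norm x) ^ 4 = (1 / 2) * v ^ 4 * ?s"
      unfolding v(2) using s(1) by (simp add: power4_eq_xxxx power3_eq_cube field_simps del: real_sqrt_mult_self)
    ultimately show ?thesis using v(2) by linarith
  qed
  have "(3 / (2 * ?s)) * ?n - (1 / (2 * ?s ^ 3)) * (?n\<^sup>2 + ?n)
      = (\<integral>(x::complex^'n). (3 / (2 * ?s)) * (norm x)\<^sup>2 - (1 / (2 * ?s ^ 3)) * (norm x) ^ 4 \<partial>gauss)"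
    using gauss_norm_moments[where 'n = 'n] by simp
  also have "\<dots> \<le> (\<integral>(x::complex^'n). norm x \<partial>gauss)"
    by (rule integral_mono) (use gauss_norm_moments[where 'n = 'n] i pt in auto)
  finally have le: "(3 / (2 * ?s)) * ?n - (1 / (2 * ?s ^ 3)) * (?n\<^sup>2 + ?n) \<le> (\<integral>(x::complex^'n). norm x \<partial>gauss)" .
  have "(3 / (2 * ?s)) * ?n - (1 / (2 * ?s ^ 3)) * (?n\<^sup>2 + ?n) = ?s * (1 - 1 / (2 * ?n))"
  proof -
    have e: "?s\<^sup>2 = ?n" by simp
    have "(3 / (2 * r)) * r\<^sup>2 - (1 / (2 * r ^ 3)) * ((r\<^sup>2)\<^sup>2 + r\<^sup>2) = r * (1 - 1 / (2 * r\<^sup>2))" if "0 < r" for r :: real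
      using that by (simp add: power2_eq_square power3_eq_cube field_simps)
    from this[OF s(1)] show ?thesis by (simp only: e)
  qed
  with le show "?s * (1 - 1 / (2 * ?n)) \<le> (\<integral>(x::complex^'n). norm x \<partial>gauss)" by linarith
qed

text \<open>The value at the origin is an arbitrary unit vector, so that the norm is one without
  exception.\<close>

definition dir :: "complex^'n::finite \<Rightarrow> complex^'n" where
  "dir x = (if x = 0 then axis undefined 1 else (1 / norm x) *\<^sub>R x)"

lemma norm_axis_one: "norm (axis k 1 :: complex^'n::finite) = 1"
proof -
  have "(norm (axis k 1 :: complex^'n))\<^sup>2 = (\<Sum>l\<in>UNIV. if l = k then 1 else 0)"
    unfolding norm_sq_vec by (intro sum.cong) (auto simp: axis_def)
  then have "(norm (axis k 1 :: complex^'n))\<^sup>2 = 1\<^sup>2" by simp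
  then show ?thesis by (rule power2_eq_imp_eq) simp_all
qed

lemma norm_dir: "norm (dir x) = 1"
  by (simp add: dir_def norm_axis_one)

lemma dir_measurable[measurable]: "dir \<in> borel_measurable borel"
  unfolding dir_def[abs_def] by simp

text \<open>Bessel's inequality, summed over the coordinates, bounds the linear plus the cubic mass
  by 1. The diagonal linear coefficients add up to E|x|, so Cauchy-Schwarz makes the linear mass at
  least 1 - 1/n. At most 1/n is left for the cubic mass, and the total loss is (1 + d) / n.\<close>

lemma dir_value:
  assumes d: "0 \<le> d"
  shows "1 - (1 + d) / CARD('n) \<le> Re (\<Sum>l\<in>UNIV. Bf d (\<lambda>x::complex^'n::finite. dir x $h l) (\<lambda>x. dir x $h l))"
proof -
  let ?n = "real CARD('n)"
  let ?X = "\<lambda>l x::complex^'n. dir x $h l"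
  have X: "?X l \<in> borel_measurable borel" "cmod (?X l x) \<le> 1" for l x
    using Finite_Cartesian_Product.norm_nth_le[of "dir x" l] by (simp_all add: norm_dir)
  define N1 where "N1 = (\<Sum>l\<in>UNIV. \<Sum>m\<in>UNIV. (cmod (lin (?X l) m))\<^sup>2)"
  define N3 where "N3 = (\<Sum>l\<in>UNIV. (\<Sum>I\<in>UNIV. (cmod (coef (?X l) I))\<^sup>2) / 2)"
  have "N1 + N3 \<le> (\<Sum>l\<in>UNIV. \<integral>x. (cmod (?X l x))\<^sup>2 \<partial>gauss)"
    unfolding N1_def N3_def sum.distrib[symmetric] by (intro sum_mono bessel[OF X])
  also have "\<dots> = (\<integral>x. (\<Sum>l\<in>UNIV. (cmod (?X l x))\<^sup>2) \<partial>gauss)"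
  proof (rule Bochner_Integration.integral_sum[symmetric])
    fix l show "integrable gauss (\<lambda>x. (cmod (?X l x))\<^sup>2)"
      by (rule gauss.integrable_const_bound[of _ 1]) (use X in \<open>auto intro!: AE_I2 simp: power_le_one\<close>)
  qed
  also have "\<dots> = 1" unfolding norm_sq_vec[symmetric] norm_dir using gauss.prob_space by simp
  finally have N13: "N1 + N3 \<le> 1" .
  define r where "r l = (\<integral>(x::complex^'n). (cmod (x $h l))\<^sup>2 / norm x \<partial>gauss)" for l
  have dx: "dir x $h l * cnj (x $h l) = of_real ((cmod (x $h l))\<^sup>2 / norm x)" for x :: "complex^'n" and l
  proof (cases "x = 0")
    case False
    then have "dir x $h l * cnj (x $h l) = of_real (1 / norm x) * (x $h l * cnj (x $h l))"
      by (simp add: dir_def scaleR_conv_of_real[where 'a = complex])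
    then show ?thesis by (simp only: complex_norm_square[symmetric] of_real_mult[symmetric]) simp
  qed simp
  have ri: "integrable gauss (\<lambda>x::complex^'n. (cmod (x $h l))\<^sup>2 / norm x)" for l
    using integrable_lin[OF X, of l l] unfolding dx by (simp only: complex_of_real_integrable_eq)
  have rl: "lin (?X l) l = of_real (r l)" for l
    unfolding lin_def dx r_def by (rule integral_complex_of_real)
  have "(\<Sum>l\<in>UNIV. r l) = (\<integral>(x::complex^'n). norm x \<partial>gauss)"
  proof -
    have "(\<Sum>l\<in>UNIV. r l) = (\<integral>(x::complex^'n). (\<Sum>l\<in>UNIV. (cmod (x $h l))\<^sup>2 / norm x) \<partial>gauss)"
      unfolding r_def using ri by simp
    also have "\<dots> = (\<integral>(x::complex^'n). norm x \<partial>gauss)"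
      unfolding sum_divide_distrib[symmetric] norm_sq_vec[symmetric]
      by (intro Bochner_Integration.integral_cong refl) (auto simp: power2_eq_square)
    finally show ?thesis .
  qed
  then have R: "sqrt ?n * (1 - 1 / (2 * ?n)) \<le> (\<Sum>l\<in>UNIV. r l)" using gauss_norm_lower(2)[where 'n = 'n] by simp
  have n1: "1 \<le> ?n" by (simp add: Suc_le_eq)
  have "1 / (2 * ?n) \<le> 1 / 1" using n1 by (intro divide_left_mono) linarith+
  then have h: "0 \<le> 1 - 1 / (2 * ?n)" by simp
  have "?n * (1 - 1 / ?n) \<le> (sqrt ?n * (1 - 1 / (2 * ?n)))\<^sup>2"
  proof -
    have "r * (1 - 1 / r) \<le> r * (1 - 1 / (2 * r))\<^sup>2" if "0 < r" for r :: real
      using that by (intro mult_left_mono) (auto simp: power2_diff)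
    from this[of ?n] show ?thesis by (simp add: power_mult_distrib)
  qed
  also have "\<dots> \<le> (\<Sum>l\<in>UNIV. r l)\<^sup>2"
    using R h by (intro power_mono) auto
  also have "\<dots> \<le> ?n * (\<Sum>l\<in>UNIV. (r l)\<^sup>2)"
    using sum_squared_le_sum_of_squares[of r UNIV] by (simp add: mult.commute)
  also have "(\<Sum>l\<in>UNIV. (r l)\<^sup>2) \<le> N1"
    unfolding N1_def
  proof (rule sum_mono)
    fix l
    have "(r l)\<^sup>2 = (cmod (lin (?X l) l))\<^sup>2" by (simp add: rl)
    also have "\<dots> \<le> (\<Sum>m\<in>UNIV. (cmod (lin (?X l) m))\<^sup>2)" by (rule member_le_sum) auto
    finally show "(r l)\<^sup>2 \<le> (\<Sum>m\<in>UNIV. (cmod (lin (?X l) m))\<^sup>2)" .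
  qed
  finally have N1: "1 - 1 / ?n \<le> N1" using n1 by simp
  have Bv: "Re (Bf d (?X l) (?X l)) = (\<Sum>m\<in>UNIV. (cmod (lin (?X l) m))\<^sup>2) - d * ((\<Sum>I\<in>UNIV. (cmod (coef (?X l) I))\<^sup>2) / 2)" for l
    unfolding Bf_def complex_norm_square[symmetric] of_real_sum[symmetric] by simp
  have "Re (\<Sum>l\<in>UNIV. Bf d (?X l) (?X l)) = N1 - d * N3"
    unfolding Re_sum Bv N1_def N3_def by (simp add: sum_subtractf sum_distrib_left)
  moreover have "d * N3 \<le> d * (1 / ?n)"
    using N13 N1 d by (intro mult_left_mono) auto
  ultimately show ?thesis using N1 by (simp add: add_divide_distrib)
qed

section \<open>Approximation of directions by simple functions\<close>

lemma tendsto_bounded_integral: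
  fixes F :: "nat \<Rightarrow> complex^'n::finite \<Rightarrow> complex"
  assumes F: "\<And>k. F k \<in> borel_measurable borel" "\<And>k x. cmod (F k x) \<le> 1" and f: "f \<in> borel_measurable borel"
    and lim: "\<And>x. (\<lambda>k. F k x) \<longlonglongrightarrow> f x" and h: "integrable gauss h"
  shows "(\<lambda>k. \<integral>x. F k x * cnj (h x) \<partial>gauss) \<longlonglongrightarrow> (\<integral>x. f x * cnj (h x) \<partial>gauss)"
proof (rule integral_dominated_convergence[where w = "\<lambda>x. cmod (h x)"])
  have [measurable]: "h \<in> borel_measurable borel" using borel_measurable_integrable[OF h] by simp
  note F(1)[measurable] f[measurable]
  show "(\<lambda>x. f x * cnj (h x)) \<in> borel_measurable gauss" "\<And>k. (\<lambda>x. F k x * cnj (h x)) \<in> borel_measurable gauss"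
    by simp_all
  show "integrable gauss (\<lambda>x. cmod (h x))" using h by simp
  show "AE x in gauss. (\<lambda>k. F k x * cnj (h x)) \<longlonglongrightarrow> f x * cnj (h x)"
    by (intro AE_I2 tendsto_intros lim)
  show "AE x in gauss. cmod (F k x * cnj (h x)) \<le> cmod (h x)" for k
    using F(2)[of k] by (intro AE_I2) (simp add: norm_mult mult_left_le_one_le)
qed

lemma simple_directions:
  obtains F :: "nat \<Rightarrow> complex^'n::finite \<Rightarrow> complex^'n" where
    "\<And>k. finite (range (F k))" "\<And>k. F k \<in> borel_measurable borel" "\<And>k x. norm (F k x) = 1"
    "\<And>x. (\<lambda>k. F k x) \<longlonglongrightarrow> dir x"
proof -
  obtain S :: "nat \<Rightarrow> complex^'n \<Rightarrow> complex^'n" where S: "\<And>k. simple_function borel (S k)" "\<And>x. (\<lambda>k. S k x) \<longlonglongrightarrow> dir x"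
    using borel_measurable_implies_sequence_metric[OF dir_measurable, of 0] by auto
  show ?thesis
  proof (rule that[of "\<lambda>k x. dir (S k x)"])
    fix k
    have "finite (range (S k))" using simple_functionD(1)[OF S(1)[of k]] by simp
    moreover have "range (\<lambda>x. dir (S k x)) = dir ` range (S k)" by auto
    ultimately show "finite (range (\<lambda>x. dir (S k x)))" by simp
    have [measurable]: "S k \<in> borel_measurable borel" by (rule borel_measurable_simple_function[OF S(1)])
    show "(\<lambda>x. dir (S k x)) \<in> borel_measurable borel" by simp
  next
    fix x
    have n: "(\<lambda>k. norm (S k x)) \<longlonglongrightarrow> 1" using tendsto_norm[OF S(2)[of x]] by (simp add: norm_dir)
    \<comment> \<open>Normalizing restores unit vectors. Near the limit the norms stay away from
      zero, so the default value of \<open>dir\<close> does not interfere with convergence.\<close>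
    have "\<forall>\<^sub>F k in sequentially. 1 / 2 < norm (S k x)" by (rule order_tendstoD(1)[OF n]) simp
    then have ev: "\<forall>\<^sub>F k in sequentially. (1 / norm (S k x)) *\<^sub>R S k x = dir (S k x)"
      by eventually_elim (auto simp: dir_def)
    have "(\<lambda>k. (1 / norm (S k x)) *\<^sub>R S k x) \<longlonglongrightarrow> (1 / 1) *\<^sub>R dir x"
      by (intro tendsto_intros n S(2)) simp
    then show "(\<lambda>k. dir (S k x)) \<longlonglongrightarrow> dir x" using tendsto_cong[OF ev] by simp
  qed (simp add: norm_dir)
qed

section \<open>Existence of the least Grothendieck constant\<close>

lemma ex_unimodular_ge:
  assumes "\<And>i. i < m \<Longrightarrow> cmod (\<epsilon> i) \<le> 1"
  shows "\<exists>\<epsilon>'. (\<forall>i. cmod (\<epsilon>' i) = 1) \<and> cmod (\<Sum>i<m. c i * \<epsilon> i) \<le> cmod (\<Sum>i<m. c i * \<epsilon>' i)"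
proof (intro exI[of _ "\<lambda>i. cnj (uph (c i))"] conjI allI)
  have "c i * cnj (uph (c i)) = of_real (cmod (c i))" for i
  proof -
    have "c i * cnj (uph (c i)) = of_real (cmod (c i)) * (uph (c i) * cnj (uph (c i)))"
      using uph_times_cmod[of "c i"] by (metis mult.assoc)
    then show ?thesis by (simp only: complex_norm_square[symmetric] cmod_uph) simp
  qed
  then have "(\<Sum>i<m. c i * cnj (uph (c i))) = of_real (\<Sum>i<m. cmod (c i))" by simp
  then have "cmod (\<Sum>i<m. c i * cnj (uph (c i))) = (\<Sum>i<m. cmod (c i))" by (simp only: norm_of_real) (simp add: sum_nonneg)
  moreover have "cmod (\<Sum>i<m. c i * \<epsilon> i) \<le> (\<Sum>i<m. cmod (c i))"
    by (rule order_trans[OF norm_sum sum_mono]) (use assms in \<open>auto simp: norm_mult mult_left_le\<close>)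
  ultimately show "cmod (\<Sum>i<m. c i * \<epsilon> i) \<le> cmod (\<Sum>i<m. c i * cnj (uph (c i)))" by simp
qed simp

lemma sum_swap3: "(\<Sum>k\<in>K. \<Sum>i\<in>I. \<Sum>j\<in>J. F i j k) = (\<Sum>i\<in>I. \<Sum>j\<in>J. \<Sum>k\<in>K. F i j k)"
  by (subst sum.swap, intro sum.cong refl sum.swap)

definition form :: "complex mat \<Rightarrow> (nat \<Rightarrow> complex) \<Rightarrow> (nat \<Rightarrow> complex) \<Rightarrow> complex" where
  "form A \<epsilon> \<delta> = (\<Sum>i<dim_row A. \<Sum>j<dim_col A. A $$ (i, j) * \<epsilon> i * cnj (\<delta> j))"

lemma form_bound: "cmod (form A \<epsilon> \<delta>) \<le> (\<Sum>i<dim_row A. \<Sum>j<dim_col A. cmod (A $$ (i, j)))"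
  if "\<And>i. i < dim_row A \<Longrightarrow> cmod (\<epsilon> i) \<le> 1" "\<And>j. j < dim_col A \<Longrightarrow> cmod (\<delta> j) \<le> 1"
  unfolding form_def
proof (intro order_trans[OF norm_sum sum_mono])
  fix i j assume "i \<in> {..<dim_row A}" "j \<in> {..<dim_col A}"
  then have "cmod (\<epsilon> i) * cmod (\<delta> j) \<le> 1" using that by (auto intro: mult_le_one)
  then show "cmod (A $$ (i, j) * \<epsilon> i * cnj (\<delta> j)) \<le> cmod (A $$ (i, j))"
    by (simp add: norm_mult mult.assoc mult_left_le)
qed

lemma unimodular_max_ge:
  assumes "\<And>i. i < dim_row A \<Longrightarrow> cmod (\<epsilon> i) = 1" "\<And>j. j < dim_col A \<Longrightarrow> cmod (\<delta> j) = 1"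
  shows "cmod (form A \<epsilon> \<delta>) \<le> unimodular_max A"
  unfolding unimodular_max_def form_def[symmetric]
proof (rule cSup_upper)
  show "cmod (form A \<epsilon> \<delta>) \<in> {cmod (form A \<epsilon> \<delta>) |\<epsilon> \<delta>. (\<forall>i<dim_row A. cmod (\<epsilon> i) = 1) \<and> (\<forall>j<dim_col A. cmod (\<delta> j) = 1)}"
    using assms by blast
  show "bdd_above {cmod (form A \<epsilon> \<delta>) |\<epsilon> \<delta>. (\<forall>i<dim_row A. cmod (\<epsilon> i) = 1) \<and> (\<forall>j<dim_col A. cmod (\<delta> j) = 1)}"
    by (rule bdd_aboveI[of _ "\<Sum>i<dim_row A. \<Sum>j<dim_col A. cmod (A $$ (i, j))"]) (auto intro!: form_bound)
qed

lemma unimodular_max_le: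
  assumes "\<And>\<epsilon> \<delta>. (\<And>i. i < dim_row A \<Longrightarrow> cmod (\<epsilon> i) = 1) \<Longrightarrow> (\<And>j. j < dim_col A \<Longrightarrow> cmod (\<delta> j) = 1) \<Longrightarrow> cmod (form A \<epsilon> \<delta>) \<le> J"
  shows "unimodular_max A \<le> J"
  unfolding unimodular_max_def form_def[symmetric]
proof (rule cSup_least)
  have "cmod (form A (\<lambda>_. 1) (\<lambda>_. 1)) \<in> {cmod (form A \<epsilon> \<delta>) |\<epsilon> \<delta>. (\<forall>i<dim_row A. cmod (\<epsilon> i) = 1) \<and> (\<forall>j<dim_col A. cmod (\<delta> j) = 1)}"
    by (intro CollectI exI[of _ "\<lambda>_. 1"]) simp
  then show "{cmod (form A \<epsilon> \<delta>) |\<epsilon> \<delta>. (\<forall>i<dim_row A. cmod (\<epsilon> i) = 1) \<and> (\<forall>j<dim_col A. cmod (\<delta> j) = 1)} \<noteq> {}" by blast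
qed (use assms in blast)

lemma unimodular_max_nonneg: "0 \<le> unimodular_max A"
  using order_trans[OF norm_ge_zero unimodular_max_ge[of A "\<lambda>_. 1" "\<lambda>_. 1"]] by simp

text \<open>With one set of variables fixed, the largest modulus over the polydisc is reached by
  choosing phases that align all terms. Doing this for the rows and then for the columns moves both
  arguments to the torus.\<close>

lemma form_disc:
  assumes \<epsilon>: "\<And>i. i < dim_row A \<Longrightarrow> cmod (\<epsilon> i) \<le> 1" and \<delta>: "\<And>j. j < dim_col A \<Longrightarrow> cmod (\<delta> j) \<le> 1"
  shows "cmod (form A \<epsilon> \<delta>) \<le> unimodular_max A"
proof -
  have r: "form A \<epsilon> \<delta> = (\<Sum>i<dim_row A. (\<Sum>j<dim_col A. A $$ (i, j) * cnj (\<delta> j)) * \<epsilon> i)" for \<epsilon> \<delta>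
    unfolding form_def sum_distrib_right by (intro sum.cong refl) simp
  have c: "form A \<epsilon> \<delta> = (\<Sum>j<dim_col A. (\<Sum>i<dim_row A. A $$ (i, j) * \<epsilon> i) * cnj (\<delta> j))" for \<epsilon> \<delta>
    unfolding form_def sum_distrib_right by (rule sum.swap)
  have "\<exists>\<epsilon>'. (\<forall>i. cmod (\<epsilon>' i) = 1) \<and> cmod (form A \<epsilon> \<delta>) \<le> cmod (form A \<epsilon>' \<delta>)"
    unfolding r by (rule ex_unimodular_ge[OF \<epsilon>])
  then obtain \<epsilon>' where \<epsilon>': "\<And>i. cmod (\<epsilon>' i) = 1" "cmod (form A \<epsilon> \<delta>) \<le> cmod (form A \<epsilon>' \<delta>)"
    by blast
  have "\<exists>\<delta>'. (\<forall>j. cmod (\<delta>' j) = 1) \<and> cmod (form A \<epsilon>' \<delta>)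
      \<le> cmod (\<Sum>j<dim_col A. (\<Sum>i<dim_row A. A $$ (i, j) * \<epsilon>' i) * \<delta>' j)"
    unfolding c by (rule ex_unimodular_ge) (simp add: \<delta>)
  then obtain \<delta>' where \<delta>': "\<And>j. cmod (\<delta>' j) = 1"
    "cmod (form A \<epsilon>' \<delta>) \<le> cmod (\<Sum>j<dim_col A. (\<Sum>i<dim_row A. A $$ (i, j) * \<epsilon>' i) * \<delta>' j)"
    by blast
  have "cmod (form A \<epsilon>' \<delta>) \<le> cmod (form A \<epsilon>' (\<lambda>j. cnj (\<delta>' j)))"
    using \<delta>'(2) unfolding c[of \<epsilon>' "\<lambda>j. cnj (\<delta>' j)"] by simp
  also have "\<dots> \<le> unimodular_max A" by (rule unimodular_max_ge) (simp_all add: \<epsilon>' \<delta>')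
  finally show ?thesis using \<epsilon>'(2) by simp
qed

section \<open>Rademacher sums and their moments\<close>

definition sgn_of :: "nat \<Rightarrow> nat set \<Rightarrow> complex" where
  "sgn_of k s = (if k \<in> s then 1 else - 1)"

text \<open>A Rademacher sum: the subsets \<open>s\<close> of \<open>{..<d}\<close>, uniformly
  weighted, form the sample space, and membership of \<open>k\<close> in \<open>s\<close> decides
  the k-th sign.\<close>

definition rsum :: "nat \<Rightarrow> (nat \<Rightarrow> complex) \<Rightarrow> nat set \<Rightarrow> complex" where
  "rsum d x s = (\<Sum>k<d. x k * sgn_of k s)"

lemma sum_Pow_Suc: "(\<Sum>s\<in>Pow {..<Suc d}. F s) = (\<Sum>s\<in>Pow {..<d}. F s + F (insert d s))"
  for F :: "nat set \<Rightarrow> 'a::comm_monoid_add"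
proof -
  have "Pow {..<Suc d} = Pow {..<d} \<union> insert d ` Pow {..<d}"
    by (simp add: lessThan_Suc Pow_insert)
  moreover have "inj_on (insert d) (Pow {..<d})"
    by (auto simp: inj_on_def)
  ultimately show ?thesis
    by (simp, subst sum.union_disjoint) (auto simp: sum.reindex sum.distrib)
qed

lemma rsum_Suc:
  assumes "s \<in> Pow {..<d}"
  shows "rsum (Suc d) x s = rsum d x s - x d" "rsum (Suc d) x (insert d s) = rsum d x s + x d"
proof -
  have "d \<notin> s" using assms by auto
  then show "rsum (Suc d) x s = rsum d x s - x d" by (simp add: rsum_def sgn_of_def)
  have "(\<Sum>k<d. x k * sgn_of k (insert d s)) = (\<Sum>k<d. x k * sgn_of k s)"
    by (intro sum.cong) (auto simp: sgn_of_def)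
  then show "rsum (Suc d) x (insert d s) = rsum d x s + x d" by (simp add: rsum_def sgn_of_def)
qed

lemma rsum_inner: "(\<Sum>s\<in>Pow {..<d}. rsum d x s * cnj (rsum d y s)) = 2 ^ d * (\<Sum>k<d. x k * cnj (y k))"
proof (induction d)
  case (Suc d)
  have "(\<Sum>s\<in>Pow {..<Suc d}. rsum (Suc d) x s * cnj (rsum (Suc d) y s))
      = (\<Sum>s\<in>Pow {..<d}. 2 * (rsum d x s * cnj (rsum d y s)) + 2 * (x d * cnj (y d)))"
    unfolding sum_Pow_Suc by (intro sum.cong refl) (simp only: rsum_Suc, simp add: algebra_simps)
  also have "\<dots> = 2 * (2 ^ d * (\<Sum>k<d. x k * cnj (y k))) + 2 ^ d * (2 * (x d * cnj (y d)))"
    by (simp only: sum.distrib sum_distrib_left[symmetric] Suc sum_constant) (simp add: card_Pow)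
  finally show ?case by (simp add: algebra_simps)
qed (simp add: rsum_def)

lemma rsum_sq: "(\<Sum>s\<in>Pow {..<d}. (cmod (rsum d x s))\<^sup>2) = 2 ^ d * (\<Sum>k<d. (cmod (x k))\<^sup>2)"
proof -
  have "complex_of_real (\<Sum>s\<in>Pow {..<d}. (cmod (rsum d x s))\<^sup>2) = complex_of_real (2 ^ d * (\<Sum>k<d. (cmod (x k))\<^sup>2))"
    using rsum_inner[of d x x]
    by (simp only: of_real_sum of_real_mult of_real_power of_real_numeral complex_norm_square)
       (simp only: complex_norm_square[symmetric] of_real_power)
  then show ?thesis by (simp only: of_real_eq_iff)
qed

lemma parallelogram_fourth: "(cmod (u - a)) ^ 4 + (cmod (u + a)) ^ 4 \<le> 2 * ((cmod u) ^ 4 + 6 * (cmod u)\<^sup>2 * (cmod a)\<^sup>2 + (cmod a) ^ 4)"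
proof -
  define c where "c = Re (u * cnj a)"
  have c: "c\<^sup>2 \<le> (cmod u)\<^sup>2 * (cmod a)\<^sup>2"
  proof -
    have "\<bar>c\<bar> \<le> cmod u * cmod a" unfolding c_def using abs_Re_le_cmod[of "u * cnj a"] by (simp add: norm_mult)
    then have "\<bar>c\<bar>\<^sup>2 \<le> (cmod u * cmod a)\<^sup>2" by (intro power_mono) auto
    then show ?thesis by (simp add: power_mult_distrib)
  qed
  have p: "(cmod (u + a))\<^sup>2 = (cmod u)\<^sup>2 + (cmod a)\<^sup>2 + 2 * c" "(cmod (u - a))\<^sup>2 = (cmod u)\<^sup>2 + (cmod a)\<^sup>2 - 2 * c"
    unfolding cmod_power2 c_def by (simp_all add: power2_eq_square algebra_simps)
  have f: "r ^ 4 = (r\<^sup>2)\<^sup>2" for r :: real by (simp flip: power_mult)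
  have "(cmod (u - a)) ^ 4 + (cmod (u + a)) ^ 4 = 2 * (((cmod u)\<^sup>2 + (cmod a)\<^sup>2)\<^sup>2 + 4 * c\<^sup>2)"
    unfolding f p by (simp add: power2_eq_square algebra_simps)
  also have "\<dots> \<le> 2 * (((cmod u)\<^sup>2 + (cmod a)\<^sup>2)\<^sup>2 + 4 * ((cmod u)\<^sup>2 * (cmod a)\<^sup>2))" using c by simp
  also have "\<dots> = 2 * ((cmod u) ^ 4 + 6 * (cmod u)\<^sup>2 * (cmod a)\<^sup>2 + (cmod a) ^ 4)"
    unfolding f by (simp add: power2_eq_square algebra_simps)
  finally show ?thesis .
qed

text \<open>Khintchine's inequality for the fourth moment, proved by adding one sign at a time.
  Averaging over the new sign removes the odd terms, and Cauchy-Schwarz controls the squared cross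
  term.\<close>

lemma rsum_fourth: "(\<Sum>s\<in>Pow {..<d}. (cmod (rsum d x s)) ^ 4) \<le> 3 * 2 ^ d * (\<Sum>k<d. (cmod (x k))\<^sup>2)\<^sup>2"
proof (induction d)
  case (Suc d)
  let ?v = "\<Sum>k<d. (cmod (x k))\<^sup>2" and ?a = "(cmod (x d))\<^sup>2"
  have "(\<Sum>s\<in>Pow {..<Suc d}. (cmod (rsum (Suc d) x s)) ^ 4)
      = (\<Sum>s\<in>Pow {..<d}. (cmod (rsum d x s - x d)) ^ 4 + (cmod (rsum d x s + x d)) ^ 4)"
    unfolding sum_Pow_Suc by (intro sum.cong refl) (simp only: rsum_Suc)
  also have "\<dots> \<le> (\<Sum>s\<in>Pow {..<d}. 2 * ((cmod (rsum d x s)) ^ 4 + 6 * (cmod (rsum d x s))\<^sup>2 * ?a + (cmod (x d)) ^ 4))"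
    by (intro sum_mono parallelogram_fourth)
  also have "\<dots> = 2 * (\<Sum>s\<in>Pow {..<d}. (cmod (rsum d x s)) ^ 4) + 12 * ?a * (\<Sum>s\<in>Pow {..<d}. (cmod (rsum d x s))\<^sup>2) + 2 ^ d * (2 * (cmod (x d)) ^ 4)"
    by (simp add: sum.distrib sum_distrib_left card_Pow algebra_simps)
  also have "\<dots> \<le> 2 * (3 * 2 ^ d * ?v\<^sup>2) + 12 * ?a * (2 ^ d * ?v) + 2 ^ d * (6 * ?a\<^sup>2)"
  proof -
    \<comment> \<open>Enlarging the coefficient 2 to 6 completes the square 6 * 2^d * (v +
      a)^2.\<close>
    have "2 * (cmod (x d)) ^ 4 \<le> 6 * ?a\<^sup>2" by (simp flip: power_mult)
    then have "2 ^ d * (2 * (cmod (x d)) ^ 4) \<le> 2 ^ d * (6 * ?a\<^sup>2)" by (intro mult_left_mono) auto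
    then show ?thesis using Suc unfolding rsum_sq by linarith
  qed
  also have "\<dots> = 3 * 2 ^ Suc d * (?v + ?a)\<^sup>2"
    by (simp add: power2_eq_square algebra_simps)
  finally show ?case by simp
qed (simp add: rsum_def)

text \<open>Coordinates are indexed by finite sets of naturals instead of initial segments, so that
  functions on the cube, encoded by \<open>set_encode\<close>, are vectors of the same kind. The
  supremum \<open>gsup\<close> then ranges over all dimensions at once.\<close>

definition gform :: "complex mat \<Rightarrow> nat set \<Rightarrow> (nat \<Rightarrow> nat \<Rightarrow> complex) \<Rightarrow> (nat \<Rightarrow> nat \<Rightarrow> complex) \<Rightarrow> complex" where
  "gform A K x y = (\<Sum>k\<in>K. form A (\<lambda>i. x i k) (\<lambda>j. y j k))"

definition in_ball :: "nat set \<Rightarrow> (nat \<Rightarrow> nat \<Rightarrow> complex) \<Rightarrow> bool" where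
  "in_ball K x \<longleftrightarrow> (\<forall>i. (\<Sum>k\<in>K. (cmod (x i k))\<^sup>2) \<le> 1)"

definition gsup :: "complex mat \<Rightarrow> real" where
  "gsup A = Sup {cmod (gform A K x y) | K x y. finite K \<and> in_ball K x \<and> in_ball K y}"

lemma gform_bound:
  assumes K: "finite K" and x: "in_ball K x" and y: "in_ball K y"
  shows "cmod (gform A K x y) \<le> (\<Sum>i<dim_row A. \<Sum>j<dim_col A. cmod (A $$ (i, j)))"
proof -
  have e: "gform A K x y = (\<Sum>i<dim_row A. \<Sum>j<dim_col A. A $$ (i, j) * (\<Sum>k\<in>K. x i k * cnj (y j k)))"
    unfolding gform_def form_def sum_distrib_left mult.assoc
    by (rule sum_swap3)
  have i: "cmod (\<Sum>k\<in>K. x i k * cnj (y j k)) \<le> 1" for i j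
  proof -
    have "cmod (\<Sum>k\<in>K. x i k * cnj (y j k)) \<le> (\<Sum>k\<in>K. (cmod (x i k))\<^sup>2 / 2 + (cmod (y j k))\<^sup>2 / 2)"
    proof (intro order_trans[OF norm_sum sum_mono])
      fix k
      have "0 \<le> (cmod (x i k) - cmod (y j k))\<^sup>2" by simp
      then show "cmod (x i k * cnj (y j k)) \<le> (cmod (x i k))\<^sup>2 / 2 + (cmod (y j k))\<^sup>2 / 2"
        unfolding power2_diff by (simp add: norm_mult)
    qed
    also have "\<dots> = ((\<Sum>k\<in>K. (cmod (x i k))\<^sup>2) + (\<Sum>k\<in>K. (cmod (y j k))\<^sup>2)) / 2"
      by (simp add: sum.distrib add_divide_distrib flip: sum_divide_distrib)
    also have "\<dots> \<le> 1"
      using x[unfolded in_ball_def, rule_format, of i] y[unfolded in_ball_def, rule_format, of j] by simp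
    finally show ?thesis .
  qed
  show ?thesis unfolding e
    by (intro order_trans[OF norm_sum sum_mono]) (simp add: norm_mult mult_left_le i)
qed

lemma gsup_ge: "finite K \<Longrightarrow> in_ball K x \<Longrightarrow> in_ball K y \<Longrightarrow> cmod (gform A K x y) \<le> gsup A"
  unfolding gsup_def
  by (rule cSup_upper, blast,
      rule bdd_aboveI[of _ "\<Sum>i<dim_row A. \<Sum>j<dim_col A. cmod (A $$ (i, j))"]) (auto intro!: gform_bound)

definition trunc :: "complex \<Rightarrow> complex" where
  "trunc z = (if cmod z \<le> 8 then z else 0)"

text \<open>Explains the height 8: the fourth moment is at most 3, so the remainder has squared norm
  at most 3/64, below (1/4)^2.\<close>

lemma trunc_tail: "(cmod (z - trunc z))\<^sup>2 \<le> (cmod z) ^ 4 / 64"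
proof (cases "cmod z \<le> 8")
  case False
  then have "8\<^sup>2 \<le> (cmod z)\<^sup>2" by (intro power_mono) auto
  then have "64 * (cmod z)\<^sup>2 \<le> (cmod z)\<^sup>2 * (cmod z)\<^sup>2" by (intro mult_right_mono) auto
  then show ?thesis using False by (simp add: trunc_def flip: power_add)
qed (simp add: trunc_def)

lemma sum_set_decode: "(\<Sum>k\<in>set_encode ` Pow {..<d}. F (set_decode k)) = (\<Sum>s\<in>Pow {..<d}. F s)"
proof -
  have "inj_on set_encode (Pow {..<d})"
    using inj_on_set_encode by (rule inj_on_subset) (auto intro: finite_subset)
  then show ?thesis
    by (subst sum.reindex) (auto intro!: sum.cong simp: finite_subset[of _ "{..<d}"])
qed

text \<open>The Rademacher sums realize the vectors isometrically as functions. Truncating them leaves bounded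
  functions, handled by \<^const>\<open>unimodular_max\<close>, and remainders of norm at most \<open>1/4\<close>, absorbed by \<^const>\<open>gsup\<close>.\<close>

lemma gform_le:
  assumes x: "\<And>i. (\<Sum>k<d. (cmod (x i k))\<^sup>2) \<le> 1" and y: "\<And>j. (\<Sum>k<d. (cmod (y j k))\<^sup>2) \<le> 1"
  shows "cmod (gform A {..<d} x y) \<le> 64 * unimodular_max A + gsup A / 2"
proof -
  define E where "E = set_encode ` Pow {..<d}"
  have fE: "finite E" by (simp add: E_def)
  note sumE = sum_set_decode[of _ d, folded E_def]
  define X where "X i s = rsum d (x i) s" for i s
  define Y where "Y j s = rsum d (y j) s" for j s
  let ?r = "complex_of_real (1 / sqrt (2 ^ d))"
  have rr: "?r * ?r = 1 / 2 ^ d" "(cmod ?r)\<^sup>2 = 1 / 2 ^ d"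
    by (simp_all add: norm_divide power_divide flip: of_real_mult)
  define sc where "sc Z i k = ?r * Z i (set_decode k)" for Z :: "nat \<Rightarrow> nat set \<Rightarrow> complex" and i k
  have ball: "in_ball E (sc Z)" if "\<And>i. (\<Sum>s\<in>Pow {..<d}. (cmod (Z i s))\<^sup>2) \<le> 2 ^ d" for Z
    unfolding in_ball_def
  proof
    fix i
    have "(\<Sum>k\<in>E. (cmod (sc Z i k))\<^sup>2) = (\<Sum>k\<in>E. (\<lambda>s. (1 / 2 ^ d) * (cmod (Z i s))\<^sup>2) (set_decode k))"
      by (simp only: sc_def norm_mult power_mult_distrib rr)
    also have "\<dots> = (1 / 2 ^ d) * (\<Sum>s\<in>Pow {..<d}. (cmod (Z i s))\<^sup>2)"
      using sumE[of "\<lambda>s. (1 / 2 ^ d) * (cmod (Z i s))\<^sup>2"] by (simp only: sum_distrib_left)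
    also have "\<dots> \<le> 1" using that[of i] by simp
    finally show "(\<Sum>k\<in>E. (cmod (sc Z i k))\<^sup>2) \<le> 1" .
  qed
  have gE: "gform A E (sc Z) (sc W) = (\<Sum>s\<in>Pow {..<d}. form A (\<lambda>i. Z i s) (\<lambda>j. W j s)) / 2 ^ d" for Z W
  proof -
    have f: "form A (\<lambda>i. sc Z i k) (\<lambda>j. sc W j k) = (\<lambda>s. form A (\<lambda>i. Z i s) (\<lambda>j. W j s) / 2 ^ d) (set_decode k)" for k
    proof -
      have "form A (\<lambda>i. sc Z i k) (\<lambda>j. sc W j k) = (?r * ?r) * form A (\<lambda>i. Z i (set_decode k)) (\<lambda>j. W j (set_decode k))"
        unfolding form_def sc_def sum_distrib_left by (intro sum.cong refl) (simp add: mult_ac)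
      then show ?thesis unfolding rr by simp
    qed
    show ?thesis unfolding gform_def f sum_divide_distrib by (rule sumE)
  qed
  have x2: "(\<Sum>s\<in>Pow {..<d}. (cmod (X i s))\<^sup>2) \<le> 2 ^ d" for i
    unfolding X_def rsum_sq using x[of i] by (simp add: mult_left_le)
  have y2: "(\<Sum>s\<in>Pow {..<d}. (cmod (Y i s))\<^sup>2) \<le> 2 ^ d" for i
    unfolding Y_def rsum_sq using y[of i] by (simp add: mult_left_le)
  have tail: "(\<Sum>s\<in>Pow {..<d}. (cmod (4 * (rsum d v s - trunc (rsum d v s))))\<^sup>2) \<le> 2 ^ d"
    if v: "(\<Sum>k<d. (cmod (v k))\<^sup>2) \<le> 1" for v
  proof -
    have "(\<Sum>s\<in>Pow {..<d}. (cmod (4 * (rsum d v s - trunc (rsum d v s))))\<^sup>2) \<le> (\<Sum>s\<in>Pow {..<d}. (cmod (rsum d v s)) ^ 4 / 4)"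
    proof (rule sum_mono)
      fix s
      show "(cmod (4 * (rsum d v s - trunc (rsum d v s))))\<^sup>2 \<le> (cmod (rsum d v s)) ^ 4 / 4"
        unfolding norm_mult power_mult_distrib using trunc_tail[of "rsum d v s"] by simp
    qed
    also have "\<dots> \<le> (3 * 2 ^ d * (\<Sum>k<d. (cmod (v k))\<^sup>2)\<^sup>2) / 4"
      unfolding sum_divide_distrib[symmetric] using rsum_fourth[of d v] by (intro divide_right_mono) auto
    also have "\<dots> \<le> (3 * 2 ^ d * 1) / 4"
      using v by (intro divide_right_mono mult_left_mono power_le_one sum_nonneg) auto
    also have "\<dots> \<le> 2 ^ d" by simp
    finally show ?thesis .
  qed
  define X' where "X' i s = trunc (X i s)" for i s
  define Y' where "Y' j s = trunc (Y j s)" for j s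
  define X4 where "X4 i s = 4 * (X i s - X' i s)" for i s
  define Y4 where "Y4 j s = 4 * (Y j s - Y' j s)" for j s
  have t8: "cmod (trunc z) \<le> cmod z" for z by (simp add: trunc_def)
  have x2': "(\<Sum>s\<in>Pow {..<d}. (cmod (X' i s))\<^sup>2) \<le> 2 ^ d" for i
    by (rule order_trans[OF sum_mono x2[of i]]) (simp add: X'_def power_mono t8)
  have y2': "(\<Sum>s\<in>Pow {..<d}. (cmod (Y' i s))\<^sup>2) \<le> 2 ^ d" for i
    by (rule order_trans[OF sum_mono y2[of i]]) (simp add: Y'_def power_mono t8)
  have x4: "(\<Sum>s\<in>Pow {..<d}. (cmod (X4 i s))\<^sup>2) \<le> 2 ^ d" for i
    unfolding X4_def X'_def X_def by (rule tail[OF x])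
  have y4: "(\<Sum>s\<in>Pow {..<d}. (cmod (Y4 i s))\<^sup>2) \<le> 2 ^ d" for i
    unfolding Y4_def Y'_def Y_def by (rule tail[OF y])
  \<comment> \<open>The decomposition X Y = X' Y' + (X - X') Y' + X (Y - Y') has just two error
    terms, each with a single small factor. Rescaled by 4, they cost a quarter of
    \<open>gsup A\<close> each.\<close>
  have split: "form A (\<lambda>i. X i s) (\<lambda>j. Y j s) = form A (\<lambda>i. X' i s) (\<lambda>j. Y' j s)
      + form A (\<lambda>i. X4 i s) (\<lambda>j. Y' j s) / 4 + form A (\<lambda>i. X i s) (\<lambda>j. Y4 j s) / 4" for s
  proof -
    have e: "X' i s + X4 i s / 4 = X i s" "Y' j s + Y4 j s / 4 = Y j s" for i j
      by (simp_all add: X4_def Y4_def field_simps)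
    have "a * (x' + x4 / 4) * cnj (y' + y4 / 4) = a * x' * cnj y' + a * x4 * cnj y' / 4 + a * (x' + x4 / 4) * cnj y4 / 4"
      for a x' x4 y' y4 :: complex by (simp add: field_simps)
    then have "A $$ (i, j) * X i s * cnj (Y j s) = A $$ (i, j) * X' i s * cnj (Y' j s)
      + A $$ (i, j) * X4 i s * cnj (Y' j s) / 4 + A $$ (i, j) * X i s * cnj (Y4 j s) / 4" for i j
      by (metis e)
    then show ?thesis unfolding form_def sum_divide_distrib sum.distrib[symmetric] by (intro sum.cong refl) simp
  qed
  have main: "gform A {..<d} x y = gform A E (sc X) (sc Y)"
  proof -
    have "(\<Sum>s\<in>Pow {..<d}. form A (\<lambda>i. X i s) (\<lambda>j. Y j s)) = (\<Sum>i<dim_row A. \<Sum>j<dim_col A. A $$ (i, j) * (\<Sum>s\<in>Pow {..<d}. X i s * cnj (Y j s)))"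
      unfolding form_def sum_distrib_left mult.assoc
      by (rule sum_swap3)
    also have "\<dots> = 2 ^ d * (\<Sum>i<dim_row A. \<Sum>j<dim_col A. A $$ (i, j) * (\<Sum>k<d. x i k * cnj (y j k)))"
      unfolding X_def Y_def rsum_inner by (simp add: sum_distrib_left mult_ac)
    also have "(\<Sum>i<dim_row A. \<Sum>j<dim_col A. A $$ (i, j) * (\<Sum>k<d. x i k * cnj (y j k))) = gform A {..<d} x y"
      unfolding gform_def form_def sum_distrib_left mult.assoc
      by (rule sum_swap3[symmetric])
    finally show ?thesis unfolding gE by simp
  qed
  have "gform A E (sc X) (sc Y) = gform A E (sc X') (sc Y') + gform A E (sc X4) (sc Y') / 4 + gform A E (sc X) (sc Y4) / 4"
    unfolding gE split by (simp add: sum.distrib sum_divide_distrib add_divide_distrib mult.commute)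
  then have "cmod (gform A {..<d} x y) \<le> cmod (gform A E (sc X') (sc Y')) + cmod (gform A E (sc X4) (sc Y')) / 4 + cmod (gform A E (sc X) (sc Y4)) / 4"
    unfolding main using norm_triangle_ineq[of "gform A E (sc X') (sc Y') + gform A E (sc X4) (sc Y') / 4" "gform A E (sc X) (sc Y4) / 4"]
      norm_triangle_ineq[of "gform A E (sc X') (sc Y')" "gform A E (sc X4) (sc Y') / 4"] by (simp add: norm_divide)
  moreover have "cmod (gform A E (sc X4) (sc Y')) \<le> gsup A" by (rule gsup_ge[OF fE ball[OF x4] ball[OF y2']])
  moreover have "cmod (gform A E (sc X) (sc Y4)) \<le> gsup A" by (rule gsup_ge[OF fE ball[OF x2] ball[OF y4]])
  moreover have "cmod (gform A E (sc X') (sc Y')) \<le> 64 * unimodular_max A"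
  proof -
    have "cmod (form A (\<lambda>i. X' i s) (\<lambda>j. Y' j s)) \<le> 64 * unimodular_max A" for s
    proof -
      have "form A (\<lambda>i. X' i s) (\<lambda>j. Y' j s) = 64 * form A (\<lambda>i. X' i s / 8) (\<lambda>j. Y' j s / 8)"
        unfolding form_def sum_distrib_left by (intro sum.cong refl) simp
      moreover have "cmod (form A (\<lambda>i. X' i s / 8) (\<lambda>j. Y' j s / 8)) \<le> unimodular_max A"
        by (rule form_disc) (auto simp: X'_def Y'_def trunc_def norm_divide)
      ultimately show ?thesis by (simp add: norm_mult)
    qed
    then have "cmod (\<Sum>s\<in>Pow {..<d}. form A (\<lambda>i. X' i s) (\<lambda>j. Y' j s)) \<le> (\<Sum>s\<in>Pow {..<d}. 64 * unimodular_max A)"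
      by (intro order_trans[OF norm_sum sum_mono])
    then show ?thesis unfolding gE by (simp add: norm_divide norm_power card_Pow field_simps)
  qed
  ultimately show ?thesis by simp
qed

text \<open>A bootstrap: \<open>gform_le\<close> bounds every member by 64
  \<open>unimodular_max A\<close> plus half of the supremum. The supremum is finite by
  \<open>gform_bound\<close>, so that half can be absorbed.\<close>

lemma gsup_le: "gsup A \<le> 128 * unimodular_max A"
proof -
  have "gsup A \<le> 64 * unimodular_max A + gsup A / 2"
    unfolding gsup_def[of A]
  proof (rule cSup_least)
    have "cmod (gform A {} (\<lambda>_ _. 0) (\<lambda>_ _. 0)) \<in> {cmod (gform A K x y) |K x y. finite K \<and> in_ball K x \<and> in_ball K y}"
      by (intro CollectI exI[of _ "{}"] exI[of _ "\<lambda>_ _. 0"]) (simp add: in_ball_def)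
    then show "{cmod (gform A K x y) |K x y. finite K \<and> in_ball K x \<and> in_ball K y} \<noteq> {}" by blast
    fix c assume "c \<in> {cmod (gform A K x y) |K x y. finite K \<and> in_ball K x \<and> in_ball K y}"
    then obtain K x y where c: "c = cmod (gform A K x y)" and K: "finite K" "in_ball K x" "in_ball K y" by blast
    \<comment> \<open>\<open>gform_le\<close> speaks of initial segments, so the index set is
      enumerated first.\<close>
    obtain h where h: "bij_betw h {..<card K} K" using ex_bij_betw_nat_finite[OF K(1)] by (auto simp: atLeast0LessThan)
    have "gform A K x y = gform A {..<card K} (\<lambda>i k. x i (h k)) (\<lambda>j k. y j (h k))"
      unfolding gform_def by (rule sum.reindex_bij_betw[OF h, symmetric])
    moreover have "(\<Sum>k<card K. (cmod (x i (h k)))\<^sup>2) \<le> 1" "(\<Sum>k<card K. (cmod (y i (h k)))\<^sup>2) \<le> 1" for i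
      using K(2,3) sum.reindex_bij_betw[OF h, of "\<lambda>k. (cmod (x i k))\<^sup>2"] sum.reindex_bij_betw[OF h, of "\<lambda>k. (cmod (y i k))\<^sup>2"]
      by (simp_all add: in_ball_def)
    ultimately show "c \<le> 64 * unimodular_max A + Sup {cmod (gform A K x y) |K x y. finite K \<and> in_ball K x \<and> in_ball K y} / 2"
      unfolding c gsup_def[symmetric] by (simp add: gform_le)
  qed
  then show ?thesis by simp
qed

lemma cscalar_prod_sum: "dim_vec w = d \<Longrightarrow> v \<bullet>c w = (\<Sum>k<d. vec_index v k * cnj (vec_index w k))"
  by (simp add: scalar_prod_def atLeast0LessThan)

lemma complex_grothendieck_bound_128: "complex_grothendieck_bound 128"
  unfolding complex_grothendieck_bound_def
proof (intro allI impI ballI)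
  fix m n d :: nat and A :: "complex mat" and x y :: "nat \<Rightarrow> complex Matrix.vec"
  assume A: "A \<in> carrier_mat m n" and x: "\<forall>i<m. x i \<in> unit_vecs d" and y: "\<forall>j<n. y j \<in> unit_vecs d"
  \<comment> \<open>Extended by zero because \<open>in_ball\<close> constrains every index,
    including those beyond the matrix.\<close>
  define x' where "x' i k = (if i < m then vec_index (x i) k else 0)" for i k
  define y' where "y' i k = (if i < n then vec_index (y i) k else 0)" for i k
  have dims: "dim_row A = m" "dim_col A = n" using A by auto
  have one: "(\<Sum>k<d. (cmod (vec_index v k))\<^sup>2) = 1" if "v \<in> unit_vecs d" for v
  proof -
    have "complex_of_real (\<Sum>k<d. (cmod (vec_index v k))\<^sup>2) = v \<bullet>c v"
      using that by (subst cscalar_prod_sum[of _ d]) (auto simp: unit_vecs_def complex_norm_square simp del: of_real_power)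
    then have "complex_of_real (\<Sum>k<d. (cmod (vec_index v k))\<^sup>2) = complex_of_real 1"
      using that by (simp add: unit_vecs_def)
    then show ?thesis by (simp only: of_real_eq_iff)
  qed
  have "(\<Sum>i<m. \<Sum>j<n. A $$ (i, j) * (x i \<bullet>c y j)) = gform A {..<d} x' y'"
  proof -
    have "(\<Sum>i<m. \<Sum>j<n. A $$ (i, j) * (x i \<bullet>c y j)) = (\<Sum>i<m. \<Sum>j<n. \<Sum>k<d. A $$ (i, j) * x' i k * cnj (y' j k))"
    proof (intro sum.cong refl)
      fix i j assume "i \<in> {..<m}" "j \<in> {..<n}"
      then show "A $$ (i, j) * (x i \<bullet>c y j) = (\<Sum>k<d. A $$ (i, j) * x' i k * cnj (y' j k))"
        using y by (subst cscalar_prod_sum[of _ d]) (auto simp: unit_vecs_def x'_def y'_def sum_distrib_left mult.assoc)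
    qed
    also have "\<dots> = gform A {..<d} x' y'"
      unfolding gform_def form_def dims mult.assoc
      by (rule sum_swap3[symmetric])
    finally show ?thesis .
  qed
  moreover have "in_ball {..<d} (\<lambda>i k. if i < r then vec_index (z i) k else 0)" if "\<forall>i<r. z i \<in> unit_vecs d" for r z
    unfolding in_ball_def
  proof
    fix i show "(\<Sum>k<d. (cmod (if i < r then vec_index (z i) k else 0))\<^sup>2) \<le> 1"
      using that one[of "z i"] by (cases "i < r") auto
  qed
  from this[OF x] this[OF y] have "in_ball {..<d} x'" "in_ball {..<d} y'" unfolding x'_def y'_def .
  ultimately show "cmod (\<Sum>i<m. \<Sum>j<n. A $$ (i, j) * (x i \<bullet>c y j)) \<le> 128 * unimodular_max A"
    using gsup_ge[of "{..<d}" x' y' A] gsup_le[of A] by simp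
qed

section \<open>Discretization\<close>

lemma sum_times_cnj_sum:
  "(\<Sum>l\<in>S. (\<Sum>i<N. c i * P i l) * cnj (\<Sum>j<M. b j * P j l)) = (\<Sum>i<N. \<Sum>j<M. (\<Sum>l\<in>S. P i l * cnj (P j l)) * c i * cnj (b j))"
proof -
  have "(\<Sum>l\<in>S. (\<Sum>i<N. c i * P i l) * cnj (\<Sum>j<M. b j * P j l)) = (\<Sum>l\<in>S. \<Sum>i<N. \<Sum>j<M. P i l * cnj (P j l) * c i * cnj (b j))"
    unfolding cnj_sum sum_product by (intro sum.cong refl) (simp add: mult_ac)
  also have "\<dots> = (\<Sum>i<N. \<Sum>j<M. \<Sum>l\<in>S. P i l * cnj (P j l) * c i * cnj (b j))"
    by (rule sum_swap3)
  finally show ?thesis by (simp only: sum_distrib_right)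
qed

lemma Bf_sum:
  fixes g :: "nat \<Rightarrow> complex^'n::finite \<Rightarrow> complex"
  assumes g: "\<And>i. g i \<in> borel_measurable borel" "\<And>i x. cmod (g i x) \<le> 1"
  shows "Bf d (\<lambda>x. \<Sum>i<N. c i * g i x) (\<lambda>x. \<Sum>j<N. b j * g j x) = (\<Sum>i<N. \<Sum>j<N. Bf d (g i) (g j) * c i * cnj (b j))"
proof -
  have l: "lin (\<lambda>x. \<Sum>i<N. c i * g i x) l = (\<Sum>i<N. c i * lin (g i) l)" for l c
    using integrable_lin[OF g] by (simp add: lin_def sum_distrib_right mult.assoc)
  have k: "coef (\<lambda>x. \<Sum>i<N. c i * g i x) I = (\<Sum>i<N. c i * coef (g i) I)" for I c
    using integrable_coef[OF g] by (simp add: coef_def sum_distrib_right mult.assoc)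
  have ab: "(\<Sum>i<N. \<Sum>j<N. L i j) - of_real d * ((\<Sum>i<N. \<Sum>j<N. C i j) / 2) = (\<Sum>i<N. \<Sum>j<N. L i j - of_real d * (C i j / 2))"
    for L C :: "nat \<Rightarrow> nat \<Rightarrow> complex"
    by (simp add: sum_subtractf sum_distrib_left sum_divide_distrib)
  show ?thesis
    unfolding Bf_def l k sum_times_cnj_sum ab
    by (intro sum.cong refl) (simp add: algebra_simps)
qed

text \<open>The matrix has the entries Bf(g_i, g_j) for the indicators g_i of the level sets of
  \<open>F\<close>. Unimodular scalars then correspond to unimodular functions constant on these
  sets, to which \<open>cmod_Bf_bound\<close> applies, while the values of \<open>F\<close> are the
  unit vectors that realize the sum on the left.\<close>

lemma simple_directions_bound:
  fixes F :: "complex^'n::finite \<Rightarrow> complex^'n"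
  assumes K: "complex_grothendieck_bound K"
    and F: "finite (range F)" "F \<in> borel_measurable borel" "\<And>x. norm (F x) = 1"
  shows "cmod (\<Sum>l\<in>UNIV. Bf (58/100) (\<lambda>x. F x $h l) (\<lambda>x. F x $h l)) \<le> max K 0 * (7375/10000)"
proof -
  let ?d = "58/100 :: real"
  note F(2)[measurable]
  define N where "N = card (range F)"
  have N: "0 < N" using F(1) by (simp add: N_def card_gt_0_iff)
  obtain v where v: "bij_betw v {..<N} (range F)" using ex_bij_betw_nat_finite[OF F(1)] by (auto simp: atLeast0LessThan N_def)
  obtain e :: "nat \<Rightarrow> 'n" where e: "bij_betw e {..<CARD('n)} UNIV"
    using ex_bij_betw_nat_finite[OF finite_class.finite_UNIV] by (auto simp: atLeast0LessThan)
  define g where "g i x = (if F x = v i then 1 else 0 :: complex)" for i x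
  have g: "g i \<in> borel_measurable borel" "cmod (g i x) \<le> 1" for i x
  proof -
    have "F -` {v i} \<in> sets borel" using measurable_sets_borel[OF F(2), of "{v i}"] by simp
    then have "(\<lambda>x. indicator (F -` {v i}) x :: complex) \<in> borel_measurable borel" by simp
    moreover have "g i = indicator (F -` {v i})" by (auto simp: g_def fun_eq_iff indicator_def)
    ultimately show "g i \<in> borel_measurable borel" by simp
  qed (simp add: g_def)
  have pick: "(\<Sum>i<N. c i * g i x) = c (the_inv_into {..<N} v (F x))" "the_inv_into {..<N} v (F x) < N" for c x
  proof -
    have inj: "inj_on v {..<N}" and im: "F x \<in> v ` {..<N}" using v by (auto simp: bij_betw_def)
    let ?i = "the_inv_into {..<N} v (F x)"
    have i: "?i < N" "v ?i = F x"
      using the_inv_into_into[OF inj im, of "{..<N}"] f_the_inv_into_f[OF inj im] by auto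
    have "(\<Sum>i<N. c i * g i x) = (\<Sum>i<N. if i = ?i then c i else 0)"
    proof (intro sum.cong refl)
      fix i assume "i \<in> {..<N}"
      then have "F x = v i \<longleftrightarrow> i = ?i" using i inj by (metis inj_on_eq_iff lessThan_iff)
      then show "c i * g i x = (if i = ?i then c i else 0)" by (simp add: g_def)
    qed
    then show "(\<Sum>i<N. c i * g i x) = c ?i" using i by simp
    show "?i < N" by (rule i)
  qed
  define A where "A = Matrix.mat N N (\<lambda>(i, j). Bf ?d (g i) (g j))"
  have A: "A \<in> carrier_mat N N" "dim_row A = N" "dim_col A = N" by (simp_all add: A_def)
  have fA: "form A \<epsilon> \<delta> = Bf ?d (\<lambda>x. \<Sum>i<N. \<epsilon> i * g i x) (\<lambda>x. \<Sum>j<N. \<delta> j * g j x)" for \<epsilon> \<delta>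
    unfolding Bf_sum[OF g] form_def A(2,3) by (intro sum.cong refl) (simp add: A_def)
  have um: "unimodular_max A \<le> 7375/10000"
  proof (rule unimodular_max_le)
    fix \<epsilon> \<delta> assume \<epsilon>: "\<And>i. i < dim_row A \<Longrightarrow> cmod (\<epsilon> i) = 1" and \<delta>: "\<And>j. j < dim_col A \<Longrightarrow> cmod (\<delta> j) = 1"
    have "unimodular (\<lambda>x. \<Sum>i<N. b i * g i x)" if b: "\<And>i. i < N \<Longrightarrow> cmod (b i) = 1" for b
    proof -
      have "(\<lambda>x. \<Sum>i<N. b i * g i x) \<in> borel_measurable borel" using g(1) by simp
      moreover have "cmod (\<Sum>i<N. b i * g i x) = 1" for x unfolding pick(1) by (rule b[OF pick(2)])
      ultimately show ?thesis by (simp add: unimodular_def)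
    qed
    then show "cmod (form A \<epsilon> \<delta>) \<le> 7375/10000"
      unfolding fA by (intro cmod_Bf_bound) (use \<epsilon> \<delta> A in auto)
  qed
  define X where "X i = Matrix.vec CARD('n) (\<lambda>k. v i $h e k)" for i
  have ips: "X i \<bullet>c X j = (\<Sum>l\<in>UNIV. v i $h l * cnj (v j $h l))" for i j
  proof -
    have "X i \<bullet>c X j = (\<Sum>k<CARD('n). v i $h e k * cnj (v j $h e k))"
      by (subst cscalar_prod_sum[of _ "CARD('n)"]) (auto simp: X_def)
    also have "\<dots> = (\<Sum>l\<in>UNIV. v i $h l * cnj (v j $h l))" by (rule sum.reindex_bij_betw[OF e])
    finally show ?thesis .
  qed
  have X: "X i \<in> unit_vecs CARD('n)" if "i < N" for i
  proof -
    have "v i \<in> range F" using v that by (auto simp: bij_betw_def)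
    then have "norm (v i) = 1" using F(3) by auto
    then have "X i \<bullet>c X i = 1"
      unfolding ips complex_norm_square[symmetric] of_real_sum[symmetric] norm_sq_vec[symmetric] by simp
    then show ?thesis by (simp add: unit_vecs_def X_def)
  qed
  have "(\<Sum>l\<in>UNIV. Bf ?d (\<lambda>x. F x $h l) (\<lambda>x. F x $h l)) = (\<Sum>i<N. \<Sum>j<N. A $$ (i, j) * (X i \<bullet>c X j))"
  proof -
    have comp: "(\<lambda>x. F x $h l) = (\<lambda>x. \<Sum>i<N. v i $h l * g i x)" for l
    proof
      fix x
      have "v (the_inv_into {..<N} v (F x)) = F x"
        using v by (intro f_the_inv_into_f) (auto simp: bij_betw_def)
      then show "F x $h l = (\<Sum>i<N. v i $h l * g i x)" using pick(1)[of "\<lambda>i. v i $h l" x] by simp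
    qed
    have "(\<Sum>l\<in>UNIV. Bf ?d (\<lambda>x. F x $h l) (\<lambda>x. F x $h l)) = (\<Sum>l\<in>UNIV. \<Sum>i<N. \<Sum>j<N. A $$ (i, j) * v i $h l * cnj (v j $h l))"
      unfolding comp Bf_sum[OF g] by (intro sum.cong refl) (simp add: A_def)
    also have "\<dots> = (\<Sum>i<N. \<Sum>j<N. \<Sum>l\<in>UNIV. A $$ (i, j) * v i $h l * cnj (v j $h l))"
      by (rule sum_swap3)
    also have "\<dots> = (\<Sum>i<N. \<Sum>j<N. A $$ (i, j) * (X i \<bullet>c X j))"
      unfolding ips by (simp add: sum_distrib_left mult.assoc)
    finally show ?thesis .
  qed
  also have "cmod \<dots> \<le> K * unimodular_max A"
    using K[unfolded complex_grothendieck_bound_def, rule_format, OF N N _ A(1), of "CARD('n)" X X] X by simp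
  \<comment> \<open>Only an upper bound for \<open>unimodular_max A\<close> is known, so the factor
    in front of it has to be nonnegative.\<close>
  also have "\<dots> \<le> max K 0 * unimodular_max A"
    by (intro mult_right_mono unimodular_max_nonneg) simp
  also have "\<dots> \<le> max K 0 * (7375/10000)"
    by (intro mult_left_mono um) simp
  finally show ?thesis .
qed

text \<open>The form involves finitely many linear and cubic coefficients, each continuous under
  bounded pointwise convergence, so the estimate for simple directions passes to \<open>dir\<close>.
  The dimension is the cardinality of a type and is fixed later by a numeral type.\<close>

lemma complex_grothendieck_bound_lower:
  assumes K: "complex_grothendieck_bound K"
  shows "1 - (1 + 58/100) / CARD('n::finite) \<le> max K 0 * (7375/10000)"
proof -
  let ?d = "58/100 :: real"
  obtain F :: "nat \<Rightarrow> complex^'n \<Rightarrow> complex^'n" where F: "\<And>k. finite (range (F k))" "\<And>k. F k \<in> borel_measurable borel"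
    "\<And>k x. norm (F k x) = 1" "\<And>x. (\<lambda>k. F k x) \<longlonglongrightarrow> dir x"
    using simple_directions by blast
  have Fm: "(\<lambda>x. F k x $h l) \<in> borel_measurable borel" for k l using F(2)[of k] by simp
  have F1: "cmod (F k x $h l) \<le> 1" for k x l using Finite_Cartesian_Product.norm_nth_le[of "F k x" l] F(3) by simp
  have dm: "(\<lambda>x::complex^'n. dir x $h l) \<in> borel_measurable borel" for l by simp
  have Fl: "(\<lambda>k. F k x $h l) \<longlonglongrightarrow> dir x $h l" for x l by (intro tendsto_vec_nth F(4))
  have lin: "(\<lambda>k. lin (\<lambda>x. F k x $h l) m) \<longlonglongrightarrow> lin (\<lambda>x. dir x $h l) m" for l m
    unfolding lin_def by (rule tendsto_bounded_integral[OF Fm F1 dm Fl integrable_coord])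
  have coef: "(\<lambda>k. coef (\<lambda>x. F k x $h l) I) \<longlonglongrightarrow> coef (\<lambda>x. dir x $h l) I" for l I
    unfolding coef_def by (rule tendsto_bounded_integral[OF Fm F1 dm Fl integrable_h3])
  have "(\<lambda>k. Bf ?d (\<lambda>x. F k x $h l) (\<lambda>x. F k x $h l)) \<longlonglongrightarrow> Bf ?d (\<lambda>x. dir x $h l) (\<lambda>x. dir x $h l)" for l
    unfolding Bf_def by (intro tendsto_diff tendsto_mult tendsto_divide tendsto_sum tendsto_cnj tendsto_const lin coef) simp
  then have "(\<lambda>k. \<Sum>l\<in>UNIV. Bf ?d (\<lambda>x. F k x $h l) (\<lambda>x. F k x $h l)) \<longlonglongrightarrow> (\<Sum>l\<in>UNIV. Bf ?d (\<lambda>x::complex^'n. dir x $h l) (\<lambda>x. dir x $h l))"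
    by (rule tendsto_sum)
  then have "(\<lambda>k. cmod (\<Sum>l\<in>UNIV. Bf ?d (\<lambda>x. F k x $h l) (\<lambda>x. F k x $h l))) \<longlonglongrightarrow> cmod (\<Sum>l\<in>UNIV. Bf ?d (\<lambda>x::complex^'n. dir x $h l) (\<lambda>x. dir x $h l))"
    by (rule tendsto_norm)
  then have "cmod (\<Sum>l\<in>UNIV. Bf ?d (\<lambda>x::complex^'n. dir x $h l) (\<lambda>x. dir x $h l)) \<le> max K 0 * (7375/10000)"
    by (rule tendsto_upperbound) (rule always_eventually, rule allI, rule simple_directions_bound[OF K F(1-3)], simp)
  moreover have "1 - (1 + ?d) / CARD('n) \<le> Re (\<Sum>l\<in>UNIV. Bf ?d (\<lambda>x::complex^'n. dir x $h l) (\<lambda>x. dir x $h l))"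
    by (rule dir_value) simp
  ultimately show ?thesis
    using complex_Re_le_cmod[of "\<Sum>l\<in>UNIV. Bf ?d (\<lambda>x::complex^'n. dir x $h l) (\<lambda>x. dir x $h l)"] by linarith
qed

text \<open>The set of bounds is nonempty by the constant 128, bounded below by the lower estimate,
  and closed because each instance is a non-strict inequality linear in K. Hence its infimum is its
  least element.\<close>

lemma complex_grothendieck_constant_bound: "complex_grothendieck_bound complex_grothendieck_constant"
proof -
  define S where "S = {K. complex_grothendieck_bound K}"
  have ne: "S \<noteq> {}" using complex_grothendieck_bound_128 by (auto simp: S_def)
  have low: "1 \<le> K" if "K \<in> S" for K
    using complex_grothendieck_bound_lower[OF that[unfolded S_def mem_Collect_eq], where 'n = 1000000] by (simp add: S_def max_def split: if_splits)
  have bdd: "bdd_below S" using low by (rule bdd_belowI)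
  have inf: "complex_grothendieck_bound (Inf S)"
    unfolding complex_grothendieck_bound_def
  proof (intro allI impI ballI)
    fix m n d :: nat and A :: "complex mat" and x y :: "nat \<Rightarrow> complex Matrix.vec"
    assume h: "0 < m" "0 < n" "0 < d" "A \<in> carrier_mat m n" "\<forall>i<m. x i \<in> unit_vecs d" "\<forall>j<n. y j \<in> unit_vecs d"
    let ?c = "cmod (\<Sum>i<m. \<Sum>j<n. A $$ (i, j) * (x i \<bullet>c y j))"
    have c: "?c \<le> K * unimodular_max A" if "K \<in> S" for K
      using that h unfolding S_def complex_grothendieck_bound_def by blast
    \<comment> \<open>If the maximum vanishes, any member of \<open>S\<close> forces the left side
      to be 0; otherwise division by it gives a lower bound of \<open>S\<close>.\<close>
    show "?c \<le> Inf S * unimodular_max A"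
    proof (cases "unimodular_max A = 0")
      case True
      then show ?thesis using c ne by auto
    next
      case False
      then have pos: "0 < unimodular_max A" using unimodular_max_nonneg[of A] by simp
      have "?c / unimodular_max A \<le> Inf S"
        by (rule cInf_greatest[OF ne]) (use c pos in \<open>simp add: pos_divide_le_eq\<close>)
      then show ?thesis using pos by (simp add: pos_divide_le_eq)
    qed
  qed
  have "complex_grothendieck_constant = Inf S"
    unfolding complex_grothendieck_constant_def
    by (rule Least_equality[where P = complex_grothendieck_bound, OF inf]) (rule cInf_lower[OF _ bdd], simp add: S_def)
  then show ?thesis using inf by simp
qed

theorem theorem1p1:
  shows "complex_grothendieck_constant > 1.35584631827168"
  \<comment> \<open>Numerically, (1 - 1.58 / 10^6) / 0.7375 exceeds 1.35593.\<close>
  using complex_grothendieck_bound_lower[OF complex_grothendieck_constant_bound, where 'n = 1000000]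
  by (simp add: max_def split: if_splits)

end
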